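(* There exist absolute constants $A, C>0$ and a randomized algorithm with the following property. Let $n,d\ge 1$, let $\delta\in(0,1)$ satisfy $\delta\ge A e^{-n}$, let $k=\lceil 3600\log(1/\delta)\rceil$, and assume $k\le n/2$. Let the input consist of $\delta$ and $n$ points $\mathcal G\cup\mathcal B$ in $\mathbb R^d$, where the points of $\mathcal G$ are i.i.d. samples from a distribution on $\mathbb R^d$ with (finite) mean $\boldsymbol\mu$ and (finite) covariance matrix $\boldsymbol\Sigma$, and $\mathcal B$ is a set of arbitrary points with $|\mathcal B|\le k/200$. Then the algorithm outputs an estimate $\widehat{\boldsymbol\mu}\in\mathbb R^d$ such that, with probability at least $1-\delta$, $$\|\boldsymbol\mu-\widehat{\boldsymbol\mu}\|\le C\left(\sqrt{\frac{\operatorname{Tr}(\boldsymbol\Sigma)}{n}}+\sqrt{\frac{\|\boldsymbol\Sigma\|\log(1/\delta)}{n}}\right).$$ Furthermore, the algorithm runs in time $O\big(nd+k^2 d\,\mathrm{polylog}(k,d)\big)$.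
   Context: $\|\cdot\|$ is the Euclidean norm for vectors and the spectral (operator) norm for matrices. The algorithm receives the $n$ points as a list and does not know $\boldsymbol\mu$, $\boldsymbol\Sigma$, the underlying distribution, or which points belong to $\mathcal B$. The probability is over the samples in $\mathcal G$ and the internal randomness of the algorithm. Running time counts arithmetic operations on real numbers. *)

theory Defs
  imports "HOL-Probability.Probability"
begin

section \<open>Randomized algorithms: programs for a unit-cost real RAM\<close>

text \<open>
  A randomized algorithm is one fixed program, independent of \<open>n\<close> and \<open>d\<close>, over two kinds of
  storage: index registers holding natural numbers, and arrays of exact real numbers. Cell
  \<open>(a, i, j)\<close> is entry \<open>(i, j)\<close> of array \<open>a\<close>; only the indices \<open>i\<close> and \<open>j\<close> can be computed at run
  time. Indices can be added, subtracted (truncating at 0) and compared; real numbers can be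
  added, subtracted, multiplied, divided, compared, and their square roots taken. There are no
  real constants besides the naturals, and there is no rounding from reals to indices, so a real
  number influences the control flow and the addressing only through comparisons.
\<close>

datatype nexp =
    NConst nat
  | NReg nat
  | NAdd nexp nexp
  | NSub nexp nexp

datatype rexp =
    OfNat nexp
  | Cell nat nexp nexp
  | Add rexp rexp
  | Sub rexp rexp
  | Mul rexp rexp
  | Div rexp rexp
  | Sqrt rexp

datatype bexp =
    NLess nexp nexp
  | RLess rexp rexp
  | Not bexp
  | And bexp bexp

datatype com =
    Skip
  | NAssign nat nexp
  | RAssign nat nexp nexp rexp
  | Draw nat nexp nexp \<comment> \<open>store a fresh uniform sample from the unit interval in a cell\<close>
  | Seq com com
  | If bexp com com
  | While bexp com

record state =
  reg :: "nat \<Rightarrow> nat"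
  cell :: "nat \<times> nat \<times> nat \<Rightarrow> real"
  drawn :: nat \<comment> \<open>number of random samples consumed so far\<close>

primrec nval :: "nexp \<Rightarrow> state \<Rightarrow> nat" where
  "nval (NConst c) s = c"
| "nval (NReg r) s = reg s r"
| "nval (NAdd e f) s = nval e s + nval f s"
| "nval (NSub e f) s = nval e s - nval f s"

primrec rval :: "rexp \<Rightarrow> state \<Rightarrow> real" where
  "rval (OfNat e) s = real (nval e s)"
| "rval (Cell a i j) s = cell s (a, nval i s, nval j s)"
| "rval (Add e f) s = rval e s + rval f s"
| "rval (Sub e f) s = rval e s - rval f s"
| "rval (Mul e f) s = rval e s * rval f s"
| "rval (Div e f) s = rval e s / rval f s"
| "rval (Sqrt e) s = sqrt (rval e s)"

primrec bval :: "bexp \<Rightarrow> state \<Rightarrow> bool" where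
  "bval (NLess e f) s = (nval e s < nval f s)"
| "bval (RLess e f) s = (rval e s < rval f s)"
| "bval (Not b) s = (\<not> bval b s)"
| "bval (And b c) s = (bval b s \<and> bval c s)"

text \<open>
  Every node of an evaluated expression and every executed command costs one unit. The total cost
  thus counts all operations on real numbers, and also memory accesses and index bookkeeping.
\<close>

primrec ncost :: "nexp \<Rightarrow> nat" where
  "ncost (NConst c) = 1"
| "ncost (NReg r) = 1"
| "ncost (NAdd e f) = 1 + ncost e + ncost f"
| "ncost (NSub e f) = 1 + ncost e + ncost f"

primrec rcost :: "rexp \<Rightarrow> nat" where
  "rcost (OfNat e) = 1 + ncost e"
| "rcost (Cell a i j) = 1 + ncost i + ncost j"
| "rcost (Add e f) = 1 + rcost e + rcost f"
| "rcost (Sub e f) = 1 + rcost e + rcost f"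
| "rcost (Mul e f) = 1 + rcost e + rcost f"
| "rcost (Div e f) = 1 + rcost e + rcost f"
| "rcost (Sqrt e) = 1 + rcost e"

primrec bcost :: "bexp \<Rightarrow> nat" where
  "bcost (NLess e f) = 1 + ncost e + ncost f"
| "bcost (RLess e f) = 1 + rcost e + rcost f"
| "bcost (Not b) = 1 + bcost b"
| "bcost (And b c) = 1 + bcost b + bcost c"

text \<open>
  \<open>exec u c s t s'\<close>: started in state \<open>s\<close> with the stream \<open>u\<close> as its source of randomness, \<open>c\<close>
  terminates in state \<open>s'\<close> at total cost \<open>t\<close>.
\<close>

inductive exec :: "(nat \<Rightarrow> real) \<Rightarrow> com \<Rightarrow> state \<Rightarrow> nat \<Rightarrow> state \<Rightarrow> bool" for u where
  Skip: "exec u Skip s 1 s"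
| NAssign: "exec u (NAssign r e) s (1 + ncost e) (s\<lparr>reg := (reg s)(r := nval e s)\<rparr>)"
| RAssign: "exec u (RAssign a i j e) s (1 + ncost i + ncost j + rcost e)
    (s\<lparr>cell := (cell s)((a, nval i s, nval j s) := rval e s)\<rparr>)"
| Draw: "exec u (Draw a i j) s (1 + ncost i + ncost j)
    (s\<lparr>cell := (cell s)((a, nval i s, nval j s) := u (drawn s)), drawn := Suc (drawn s)\<rparr>)"
| Seq: "exec u c1 s t1 s1 \<Longrightarrow> exec u c2 s1 t2 s2 \<Longrightarrow> exec u (Seq c1 c2) s (1 + t1 + t2) s2"
| IfTrue: "bval b s \<Longrightarrow> exec u c1 s t s' \<Longrightarrow> exec u (If b c1 c2) s (1 + bcost b + t) s'"
| IfFalse: "\<not> bval b s \<Longrightarrow> exec u c2 s t s' \<Longrightarrow> exec u (If b c1 c2) s (1 + bcost b + t) s'"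
| WhileFalse: "\<not> bval b s \<Longrightarrow> exec u (While b c) s (1 + bcost b) s"
| WhileTrue: "bval b s \<Longrightarrow> exec u c s t1 s1 \<Longrightarrow> exec u (While b c) s1 t2 s2 \<Longrightarrow>
    exec u (While b c) s (1 + bcost b + t1 + t2) s2"

inductive_cases exec_SkipE: "exec u Skip s t s'"
inductive_cases exec_NAssignE: "exec u (NAssign r e) s t s'"
inductive_cases exec_RAssignE: "exec u (RAssign a i j e) s t s'"
inductive_cases exec_DrawE: "exec u (Draw a i j) s t s'"
inductive_cases exec_SeqE: "exec u (Seq c1 c2) s t s'"
inductive_cases exec_IfE: "exec u (If b c1 c2) s t s'"
inductive_cases exec_WhileE: "exec u (While b c) s t s'"

lemma exec_deterministic:
  "exec u c s t s' \<Longrightarrow> exec u c s t' s'' \<Longrightarrow> t' = t \<and> s'' = s'"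
proof (induction arbitrary: t' s'' rule: exec.induct)
  case (Skip s) then show ?case by (auto elim: exec_SkipE)
next
  case (NAssign r e s) then show ?case by (auto elim: exec_NAssignE)
next
  case (RAssign a i j e s) then show ?case by (auto elim: exec_RAssignE)
next
  case (Draw a i j s) then show ?case by (auto elim: exec_DrawE)
next
  case (Seq c1 s t1 s1 c2 t2 s2)
  from Seq.prems obtain r1 r2 z where
    "exec u c1 s r1 z" "exec u c2 z r2 s''" and "t' = Suc (r1 + r2)"
    by (blast elim: exec_SeqE)
  with Seq.IH(1)[of r1 z] Seq.IH(2)[of r2 s''] show ?case by simp
next
  case (IfTrue b s c1 t s' c2)
  from IfTrue.prems obtain r where "exec u c1 s r s''" and "t' = Suc (bcost b + r)"
    using IfTrue.hyps(1) by (blast elim: exec_IfE)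
  with IfTrue.IH[of r s''] show ?case by simp
next
  case (IfFalse b s c2 t s' c1)
  from IfFalse.prems obtain r where "exec u c2 s r s''" and "t' = Suc (bcost b + r)"
    using IfFalse.hyps(1) by (blast elim: exec_IfE)
  with IfFalse.IH[of r s''] show ?case by simp
next
  case (WhileFalse b s c)
  from WhileFalse.prems show ?case
    by (rule exec_WhileE) (simp_all add: WhileFalse.hyps(1))
next
  case (WhileTrue b s c t1 s1 t2 s2)
  from WhileTrue.prems obtain r1 r2 z where
    "exec u c s r1 z" "exec u (While b c) z r2 s''" and "t' = Suc (bcost b + r1 + r2)"
    using WhileTrue.hyps(1) by (blast elim: exec_WhileE)
  with WhileTrue.IH(1)[of r1 z] WhileTrue.IH(2)[of r2 s''] show ?case by simp
qed

text \<open>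
  Input and output conventions: registers 0 and 1 hold \<open>n\<close> and \<open>d\<close>, array 0 holds the list of
  points (one point per row), cell \<open>(1, 0, 0)\<close> holds \<open>\<delta>\<close>, and all else is 0. The result is read
  off the first \<open>d\<close> entries of row 0 of array 2.
\<close>

definition init_state :: "nat \<Rightarrow> nat \<Rightarrow> real \<Rightarrow> (nat \<Rightarrow> nat \<Rightarrow> real) \<Rightarrow> state" where
  "init_state n d \<delta> x =
    \<lparr>reg = (\<lambda>r. if r = 0 then n else if r = 1 then d else 0),
     cell = (\<lambda>(a, i, j).
       if a = 0 \<and> i < n \<and> j < d then x i j
       else if a = 1 \<and> i = 0 \<and> j = 0 then \<delta>
       else 0),
     drawn = 0\<rparr>"

definition runs ::
  "com \<Rightarrow> nat \<Rightarrow> nat \<Rightarrow> real \<Rightarrow> (nat \<Rightarrow> nat \<Rightarrow> real) \<Rightarrow> (nat \<Rightarrow> real) \<Rightarrow> nat \<Rightarrow> (nat \<Rightarrow> real) \<Rightarrow> bool"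
where
  "runs P n d \<delta> x u t y \<longleftrightarrow>
    (\<exists>s'. exec u P (init_state n d \<delta> x) t s' \<and> y = (\<lambda>j. cell s' (2, 0, j)))"

definition random_stream :: "(nat \<Rightarrow> real) measure" where
  "random_stream = (\<Pi>\<^sub>M i\<in>UNIV. uniform_measure lborel {0..1})"

section \<open>Vectors, matrices and distributions in dimension \<open>d\<close>\<close>

text \<open>
  One program serves all dimensions, so \<open>d\<close> cannot be a type: vectors and matrices are functions on
  \<open>nat\<close>, of which only the arguments below \<open>d\<close> matter. A distribution on \<open>d\<close>-dimensional space is a
  probability measure on \<open>Rd d\<close>.
\<close>

definition Rd :: "nat \<Rightarrow> (nat \<Rightarrow> real) measure" where
  "Rd d = (\<Pi>\<^sub>M i\<in>{..<d}. borel)"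

definition vnorm :: "nat \<Rightarrow> (nat \<Rightarrow> real) \<Rightarrow> real" where
  "vnorm d v = L2_set v {..<d}"

definition trace_mat :: "nat \<Rightarrow> (nat \<Rightarrow> nat \<Rightarrow> real) \<Rightarrow> real" where
  "trace_mat d S = (\<Sum>i<d. S i i)"

definition spectral_norm :: "nat \<Rightarrow> (nat \<Rightarrow> nat \<Rightarrow> real) \<Rightarrow> real" where
  "spectral_norm d S = (SUP v\<in>{v. vnorm d v \<le> 1}. vnorm d (\<lambda>i. \<Sum>j<d. S i j * v j))"

definition mean_vec :: "(nat \<Rightarrow> real) measure \<Rightarrow> nat \<Rightarrow> real" where
  "mean_vec D i = (\<integral>x. x i \<partial>D)"

definition cov_mat :: "(nat \<Rightarrow> real) measure \<Rightarrow> nat \<Rightarrow> nat \<Rightarrow> real" where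
  "cov_mat D i j = (\<integral>x. (x i - mean_vec D i) * (x j - mean_vec D j) \<partial>D)"

definition finite_mean_cov :: "nat \<Rightarrow> (nat \<Rightarrow> real) measure \<Rightarrow> bool" where
  "finite_mean_cov d D \<longleftrightarrow>
    (\<forall>i<d. integrable D (\<lambda>x. x i)) \<and>
    (\<forall>i<d. \<forall>j<d. integrable D (\<lambda>x. (x i - mean_vec D i) * (x j - mean_vec D j)))"

text \<open>
  The input list when its entries at the positions in \<open>B\<close> are arbitrary points. These may be chosen
  with full knowledge of the i.i.d. samples \<open>X\<close> at the other positions: \<open>b j\<close> maps \<open>X\<close> to the
  point at position \<open>j\<close>.
\<close>

definition contaminate ::
  "nat set \<Rightarrow> (nat \<Rightarrow> (nat \<Rightarrow> nat \<Rightarrow> real) \<Rightarrow> nat \<Rightarrow> real) \<Rightarrow> (nat \<Rightarrow> nat \<Rightarrow> real) \<Rightarrow> nat \<Rightarrow> nat \<Rightarrow> real"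
where
  "contaminate B b X i = (if i \<in> B then b i X else X i)"

end

theory Submission
  imports Defs
begin

text \<open>
  The sample is cut into \<open>k\<close> blocks of equal length, where \<open>k\<close> is of the order of \<open>log (1/\<delta>)\<close>, and
  replaced by the block means \<open>z\<close>. Everything the estimator has to know about them is the property
  \<open>dispersed\<close>: along every direction all but one percent of the block means are within \<open>r\<close> of \<open>\<mu>\<close>,
  where \<open>r\<^sup>2\<close> is of the order of \<open>Tr \<Sigma> / n + k \<parallel>\<Sigma>\<parallel> / n\<close>. The property is stated for families of
  directions, that is, for all positive semidefinite quadratic forms in place of squares of linear
  forms; blocks hit by \<open>B\<close> make up half of the exceptional percent.

  It holds with probability \<open>1 - \<delta>\<close> (\<open>dispersed_whp\<close>). For a single direction, Chebyshev's inequality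
  for one block and independence of the blocks give an exponential moment. All directions are then
  handled at once by a PAC-Bayes argument (\<open>uniform_direction_count\<close>): the exponential moment is
  averaged over a Gaussian direction, Markov's inequality is applied to this one average, and the
  Gaussian is translated to an arbitrary \<open>v\<close> at the price \<open>\<parallel>v\<parallel>\<^sup>2 / (2 \<sigma>\<^sup>2)\<close>. The dimension enters only through
  \<open>Tr \<Sigma>\<close>. Random signs extend the bound from directions to families (\<open>families_of_directions\<close>).

  Given \<open>dispersed\<close>, the mean is found by a filter (\<open>filter_correct\<close>). Weights \<open>u\<close> on the block means
  define a weighted mean and a weighted covariance operator \<open>A\<close>. The score of a point \<open>x\<close>, measured
  from the weighted mean, is \<open>\<parallel>A\<^sup>m x\<parallel>\<^sup>2\<close> with \<open>4\<^sup>m \<ge> d\<close>; the weighted sum of the scores is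
  \<open>Tr A\<^sup>2\<^sup>m\<^sup>+\<^sup>1\<close>, and Peierls' inequality (\<open>peierls\<close>) shows that halving the weighted sum of scores
  by lowering weights halves this trace. So a number of rounds logarithmic in the initial spread, raised
  to the power \<open>2m + 1\<close>, brings the top eigenvalue down to the order of \<open>k r\<^sup>2\<close>, and then the weighted
  mean is within \<open>10 r\<close> of \<open>\<mu>\<close> (\<open>wmean_shift\<close>). Pruning far points from the coordinatewise median makes
  the initial spread polynomial in \<open>d\<close>, hence the number of rounds is polylogarithmic.

  The filter must not remove too much mass on the way. The weight that a point loses over all rounds is
  at most \<open>\<Sum>\<^sub>t q\<^sub>t / \<tau>\<^sub>t\<close>, the value at this point of one quadratic form, whose trace is bounded by the mass
  removed so far divided by the smallest average score. As long as the average scores are large compared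
  with \<open>r\<^sup>2\<close>, \<open>dispersed\<close> therefore shows that all but one percent of the points keep most of their
  weight (\<open>step_accepted\<close>). A guard on the total mass stops the filter when this ceases to hold, and
  then \<open>A\<close> is already small.

  The scores require no eigenvectors: \<open>A\<close> is applied to a vector in \<open>O(k d)\<close> operations, so a round
  costs \<open>O(k\<^sup>2 d m)\<close>. The program is deterministic. It is verified in a calculus that tracks cost, and a
  general theorem on programs (\<open>measurable_result\<close>) gives the measurability of its output.
\<close>

section \<open>Vectors and the spectral theorem in dimension \<open>d\<close>\<close>

definition ip :: "nat \<Rightarrow> (nat \<Rightarrow> real) \<Rightarrow> (nat \<Rightarrow> real) \<Rightarrow> real" where
  "ip d x y = (\<Sum>i<d. x i * y i)"

definition unit_vec :: "nat \<Rightarrow> nat \<Rightarrow> real" where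
  "unit_vec j = (\<lambda>i. if i = j then 1 else 0)"

lemma ip_commute: "ip d x y = ip d y x"
  by (simp add: ip_def mult.commute)

lemma ip_nonneg: "0 \<le> ip d x x"
  by (simp add: ip_def sum_nonneg)

lemma ip_diff_right: "ip d v (\<lambda>j. x j - y j) = ip d v x - ip d v y"
  by (simp add: ip_def algebra_simps sum_subtractf)

lemma ip_scale_right: "ip d v (\<lambda>j. c * y j) = c * ip d v y"
  by (simp add: ip_def sum_distrib_left algebra_simps)

lemma ip_divide_right: "ip d v (\<lambda>j. y j / c) = ip d v y / c"
  by (simp add: ip_def sum_divide_distrib)

lemma ip_sum_right: "ip d v (\<lambda>j. \<Sum>i\<in>I. f i j) = (\<Sum>i\<in>I. ip d v (f i))"
  by (simp add: ip_def sum_distrib_left sum.swap[of _ "{..<d}"])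

lemma ip_cong: "(\<And>j. j < d \<Longrightarrow> x j = x' j) \<Longrightarrow> (\<And>j. j < d \<Longrightarrow> y j = y' j) \<Longrightarrow> ip d x y = ip d x' y'"
  by (simp add: ip_def)

lemma ip_unit_vec: "j < d \<Longrightarrow> ip d x (unit_vec j) = x j"
  by (simp add: ip_def unit_vec_def if_distrib[of "\<lambda>c. _ * c"] sum.delta cong: if_cong)

lemma vnorm_eq_sqrt_ip: "vnorm d v = sqrt (ip d v v)"
  by (simp add: vnorm_def L2_set_def ip_def power2_eq_square)

lemma ip_cauchy_schwarz: "(ip d x y)\<^sup>2 \<le> ip d x x * ip d y y"
  using Cauchy_Schwarz_ineq_sum[of x y "{..<d}"] by (simp add: ip_def power2_eq_square)

definition is_orthobasis :: "nat \<Rightarrow> (nat \<Rightarrow> nat \<Rightarrow> real) \<Rightarrow> bool" where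
  "is_orthobasis d E \<longleftrightarrow>
    (\<forall>a<d. \<forall>b<d. ip d (E a) (E b) = (if a = b then 1 else 0)) \<and>
    (\<forall>i<d. \<forall>j<d. (\<Sum>a<d. E a i * E a j) = (if i = j then 1 else 0))"

lemma orthobasis_parseval:
  assumes "is_orthobasis d E"
  shows "ip d x y = (\<Sum>a<d. ip d (E a) x * ip d (E a) y)"
proof -
  have "(\<Sum>a<d. ip d (E a) x * ip d (E a) y) = (\<Sum>a<d. \<Sum>i<d. \<Sum>j<d. E a i * x i * (E a j * y j))"
    by (simp add: ip_def sum_product)
  also have "\<dots> = (\<Sum>i<d. \<Sum>j<d. \<Sum>a<d. E a i * x i * (E a j * y j))"
    by (rule trans[OF sum.swap], rule sum.cong[OF refl], rule sum.swap)
  also have "\<dots> = (\<Sum>i<d. \<Sum>j<d. (\<Sum>a<d. E a i * E a j) * (x i * y j))"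
    by (simp add: sum_distrib_left algebra_simps)
  also have "\<dots> = (\<Sum>i<d. \<Sum>j<d. (if i = j then 1 else 0) * (x i * y j))"
    using assms unfolding is_orthobasis_def by (intro sum.cong refl) auto
  also have "\<dots> = ip d x y"
    unfolding ip_def by (intro sum.cong refl) (simp add: if_distrib[of "\<lambda>c. c * _"] sum.delta' cong: if_cong)
  finally show ?thesis by simp
qed

definition qform :: "nat \<Rightarrow> (nat \<Rightarrow> nat \<Rightarrow> real) \<Rightarrow> (nat \<Rightarrow> real) \<Rightarrow> (nat \<Rightarrow> real) \<Rightarrow> real" where
  "qform d B x y = (\<Sum>i<d. \<Sum>j<d. x i * B i j * y j)"

lemma qform_linear:
  "qform d B (\<lambda>i. p * x i + q * y i) (\<lambda>i. r * v i + t * w i)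
    = p * r * qform d B x v + p * t * qform d B x w + q * r * qform d B y v + q * t * qform d B y w"
  unfolding qform_def sum_distrib_left sum.distrib[symmetric]
  by (intro sum.cong refl) (simp add: algebra_simps)

lemma qform_sym:
  assumes "\<forall>i<d. \<forall>j<d. B i j = B j i"
  shows "qform d B x y = qform d B y x"
  unfolding qform_def by (subst sum.swap, intro sum.cong refl) (use assms in \<open>auto simp: algebra_simps\<close>)

lemma ip_linear:
  "ip d (\<lambda>i. p * x i + q * y i) (\<lambda>i. r * v i + t * w i)
    = p * r * ip d x v + p * t * ip d x w + q * r * ip d y v + q * t * ip d y w"
  unfolding ip_def sum_distrib_left sum.distrib[symmetric]
  by (intro sum.cong refl) (simp add: algebra_simps)

text \<open>
  A rotation keeps the trace of a symmetric \<open>2 \<times> 2\<close> matrix, so the sum of the squared diagonal entries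
  is determined by their difference. The rotation by half the polar angle of \<open>(\<alpha> - \<gamma>, 2 \<beta>)\<close>
  diagonalises the matrix and makes the difference as large as possible.
\<close>

lemma plane_rotation_increases_diagonal:
  fixes \<alpha> \<beta> \<gamma> :: real
  assumes "\<beta> \<noteq> 0"
  shows "\<exists>c s. c\<^sup>2 + s\<^sup>2 = 1 \<and>
    \<alpha>\<^sup>2 + \<gamma>\<^sup>2 < (c\<^sup>2 * \<alpha> + 2 * c * s * \<beta> + s\<^sup>2 * \<gamma>)\<^sup>2 + (s\<^sup>2 * \<alpha> - 2 * c * s * \<beta> + c\<^sup>2 * \<gamma>)\<^sup>2"
proof -
  define D where "D = \<alpha> - \<gamma>"
  define R where "R = sqrt (D\<^sup>2 + 4 * \<beta>\<^sup>2)"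
  have pos: "D\<^sup>2 + 4 * \<beta>\<^sup>2 > 0" using assms by (simp add: add_nonneg_pos)
  have R: "R\<^sup>2 = D\<^sup>2 + 4 * \<beta>\<^sup>2" "R > 0" unfolding R_def using pos by auto
  have "(D / R)\<^sup>2 + (2 * \<beta> / R)\<^sup>2 = (D\<^sup>2 + 4 * \<beta>\<^sup>2) / R\<^sup>2"
    by (simp add: power_divide add_divide_distrib power_mult_distrib)
  then have "(D / R)\<^sup>2 + (2 * \<beta> / R)\<^sup>2 = 1" using R pos by simp
  then obtain t where t: "D / R = cos t" "2 * \<beta> / R = sin t"
    using sincos_total_2pi by metis
  define c s where "c = cos (t/2)" and "s = sin (t/2)"
  have cs: "c\<^sup>2 + s\<^sup>2 = 1" by (simp add: c_def s_def)
  have C: "c\<^sup>2 - s\<^sup>2 = D / R" "2 * c * s = 2 * \<beta> / R"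
    unfolding t c_def s_def using cos_double[of "t/2"] sin_double[of "t/2"] by (simp_all add: mult_ac)
  have e: "(c\<^sup>2 * \<alpha> + 2 * c * s * \<beta> + s\<^sup>2 * \<gamma>) - (s\<^sup>2 * \<alpha> - 2 * c * s * \<beta> + c\<^sup>2 * \<gamma>)
      = (c\<^sup>2 - s\<^sup>2) * D + 2 * (2 * c * s) * \<beta>"
    by (simp add: D_def algebra_simps)
  also have "\<dots> = (D\<^sup>2 + 4 * \<beta>\<^sup>2) / R" unfolding C by (simp add: power2_eq_square add_divide_distrib)
  also have "\<dots> = R" unfolding R(1)[symmetric] using R(2) by (simp add: power2_eq_square)
  finally have diff: "(c\<^sup>2 * \<alpha> + 2 * c * s * \<beta> + s\<^sup>2 * \<gamma>) - (s\<^sup>2 * \<alpha> - 2 * c * s * \<beta> + c\<^sup>2 * \<gamma>) = R" .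
  have "(c\<^sup>2 * \<alpha> + 2 * c * s * \<beta> + s\<^sup>2 * \<gamma>) + (s\<^sup>2 * \<alpha> - 2 * c * s * \<beta> + c\<^sup>2 * \<gamma>) = (c\<^sup>2 + s\<^sup>2) * (\<alpha> + \<gamma>)"
    by (simp add: algebra_simps)
  then have sm: "(c\<^sup>2 * \<alpha> + 2 * c * s * \<beta> + s\<^sup>2 * \<gamma>) + (s\<^sup>2 * \<alpha> - 2 * c * s * \<beta> + c\<^sup>2 * \<gamma>) = \<alpha> + \<gamma>"
    using cs by simp
  have id: "p\<^sup>2 + q\<^sup>2 = ((p + q)\<^sup>2 + (p - q)\<^sup>2) / 2" for p q :: real
    by (simp add: power2_eq_square field_simps)
  have "\<alpha>\<^sup>2 + \<gamma>\<^sup>2 = ((\<alpha> + \<gamma>)\<^sup>2 + D\<^sup>2) / 2" unfolding D_def by (rule id)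
  also have "\<dots> < ((\<alpha> + \<gamma>)\<^sup>2 + R\<^sup>2) / 2" using R(1) assms by simp
  finally have "\<alpha>\<^sup>2 + \<gamma>\<^sup>2 < (c\<^sup>2 * \<alpha> + 2 * c * s * \<beta> + s\<^sup>2 * \<gamma>)\<^sup>2 + (s\<^sup>2 * \<alpha> - 2 * c * s * \<beta> + c\<^sup>2 * \<gamma>)\<^sup>2"
    unfolding id[of "c\<^sup>2 * \<alpha> + 2 * c * s * \<beta> + s\<^sup>2 * \<gamma>"] diff sm .
  with cs show ?thesis by blast
qed

text \<open>
  Jacobi's proof of the spectral theorem. Orthogonal matrices form a compact set, so some orthonormal
  basis maximises the sum of the squared diagonal entries of \<open>B\<close>. A nonzero off-diagonal entry could
  be rotated away in its coordinate plane, which would increase that sum.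
\<close>

theorem symmetric_diagonalizable:
  assumes sym: "\<forall>i<d. \<forall>j<d. B i j = B j i"
  shows "\<exists>E. is_orthobasis d E \<and> (\<forall>a<d. \<forall>b<d. a \<noteq> b \<longrightarrow> qform d B (E a) (E b) = 0)"
proof -
  define box :: "(nat \<times> nat \<Rightarrow> real) set"
    where "box = PiE UNIV (\<lambda>(i, j). if i < d \<and> j < d then {-1..1} else {0})"
  define O1 where "O1 a b = {F::nat \<times> nat \<Rightarrow> real. (\<Sum>i<d. F (a, i) * F (b, i)) = (if a = b then 1 else 0)}" for a b
  define O2 where "O2 i j = {F::nat \<times> nat \<Rightarrow> real. (\<Sum>a<d. F (a, i) * F (a, j)) = (if i = j then 1 else 0)}" for i j
  define Q where "Q = box \<inter> ((\<Inter>a\<in>{..<d}. \<Inter>b\<in>{..<d}. O1 a b) \<inter> (\<Inter>a\<in>{..<d}. \<Inter>b\<in>{..<d}. O2 a b))"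
  define f where "f F = (\<Sum>a<d. (\<Sum>i<d. \<Sum>j<d. F (a, i) * B i j * F (a, j))\<^sup>2)" for F :: "nat \<times> nat \<Rightarrow> real"
  have cbox: "compact box"
    unfolding box_def compactin_euclidean_iff[symmetric] euclidean_product_topology[symmetric] compactin_PiE
    by (auto simp: split: if_splits)
  have "closed (O1 a b)" for a b
    unfolding O1_def by (intro closed_Collect_eq continuous_intros continuous_on_product_coordinates)
  moreover have "closed (O2 a b)" for a b
    unfolding O2_def by (intro closed_Collect_eq continuous_intros continuous_on_product_coordinates)
  ultimately have "compact Q"
    unfolding Q_def by (intro compact_Int_closed[OF cbox] closed_Int closed_INT ballI)
  moreover have "(\<lambda>(i, j). if i = j \<and> i < d then 1 else 0) \<in> Q"
    unfolding Q_def box_def O1_def O2_def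
    by (auto simp: if_distrib[of "\<lambda>c. c * _"] sum.delta cong: if_cong)
  moreover have "continuous_on Q f"
    unfolding f_def by (intro continuous_intros continuous_on_subset[OF continuous_on_product_coordinates]) auto
  ultimately obtain F where F: "F \<in> Q" and max: "\<And>G. G \<in> Q \<Longrightarrow> f G \<le> f F"
    using continuous_attains_sup[of Q f] by blast
  define E where "E a i = F (a, i)" for a i
  have E: "is_orthobasis d E"
    using F unfolding Q_def O1_def O2_def is_orthobasis_def ip_def E_def by auto
  have fE: "f F = (\<Sum>a<d. (qform d B (E a) (E a))\<^sup>2)"
    by (simp add: f_def qform_def E_def)
  have "qform d B (E a) (E b) = 0" if ab: "a < d" "b < d" "a \<noteq> b" for a b
  proof (rule ccontr)
    assume nz: "qform d B (E a) (E b) \<noteq> 0"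
    define \<alpha> \<beta> \<gamma> where "\<alpha> = qform d B (E a) (E a)" and "\<beta> = qform d B (E a) (E b)"
      and "\<gamma> = qform d B (E b) (E b)"
    obtain c s where cs: "c\<^sup>2 + s\<^sup>2 = 1" and gt:
      "\<alpha>\<^sup>2 + \<gamma>\<^sup>2 < (c\<^sup>2 * \<alpha> + 2 * c * s * \<beta> + s\<^sup>2 * \<gamma>)\<^sup>2 + (s\<^sup>2 * \<alpha> - 2 * c * s * \<beta> + c\<^sup>2 * \<gamma>)\<^sup>2"
      using plane_rotation_increases_diagonal[of \<beta> \<alpha> \<gamma>] nz unfolding \<beta>_def by blast
    define r where "r = - s"
    define E' where "E' e = (if e = a then (\<lambda>i. c * E a i + s * E b i)
        else if e = b then (\<lambda>i. r * E a i + c * E b i) else E e)" for e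
    define G where "G = (\<lambda>(e, i). if e < d \<and> i < d then E' e i else 0)"
    have E1: "ip d (E e) (E e') = (if e = e' then 1 else 0)" if "e < d" "e' < d" for e e'
      using E that unfolding is_orthobasis_def by simp
    have cs': "c * c + s * s = 1" using cs by (simp add: power2_eq_square)
    then have rc: "r * r + c * c = 1" "c * r + s * c = 0" "r * c + c * s = 0"
      by (simp_all add: r_def)
    have mixed: "ip d (\<lambda>i. p * E a i + q * E b i) (E e) = 0" if "e < d" "e \<noteq> a" "e \<noteq> b" for p q e
      using ip_linear[of d p "E a" q "E b" 1 "E e" 0 "E e"] E1 ab that by simp
    have E'1: "ip d (E' e) (E' e') = (if e = e' then 1 else 0)" if "e < d" "e' < d" for e e'
    proof -
      consider "e = a" "e' = a" | "e = a" "e' = b" | "e = b" "e' = a" | "e = b" "e' = b"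
        | "e \<in> {a, b}" "e' \<noteq> a" "e' \<noteq> b" | "e' \<in> {a, b}" "e \<noteq> a" "e \<noteq> b"
        | "e \<noteq> a" "e \<noteq> b" "e' \<noteq> a" "e' \<noteq> b" by blast
      then show ?thesis
      proof cases
        case 5 then show ?thesis using mixed[of e'] mixed[of e' r c] that ab unfolding E'_def by auto
      next
        case 6 then show ?thesis using mixed[of e] mixed[of e r c] that ab unfolding E'_def
          by (auto simp: ip_commute[of d "E e"])
      qed (use ab E1 that cs' rc in \<open>auto simp: E'_def ip_linear\<close>)
    qed
    have E'2: "(\<Sum>e<d. E' e i * E' e j) = (if i = j then 1 else 0)" if "i < d" "j < d" for i j
    proof -
      have split: "(\<Sum>e<d. g e) = g a + g b + (\<Sum>e\<in>{..<d} - {a, b}. g e)" for g :: "nat \<Rightarrow> real"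
        using ab by (subst sum.subset_diff[of "{a, b}"]) auto
      have "(\<Sum>e<d. E' e i * E' e j) = (c * E a i + s * E b i) * (c * E a j + s * E b j)
          + (c * E b i - s * E a i) * (c * E b j - s * E a j) + (\<Sum>e\<in>{..<d} - {a, b}. E e i * E e j)"
        unfolding split using ab by (auto simp: E'_def r_def intro!: sum.cong)
      also have "\<dots> = (c * c + s * s) * (E a i * E a j + E b i * E b j) + (\<Sum>e\<in>{..<d} - {a, b}. E e i * E e j)"
        by (simp add: algebra_simps)
      also have "\<dots> = (\<Sum>e<d. E e i * E e j)" unfolding cs' split by simp
      finally show ?thesis using E that unfolding is_orthobasis_def by simp
    qed
    have "\<bar>E' e i\<bar> \<le> 1" if "e < d" "i < d" for e i
    proof -
      have "(E' e i)\<^sup>2 \<le> (\<Sum>e<d. E' e i * E' e i)"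
        using member_le_sum[of e "{..<d}" "\<lambda>e. E' e i * E' e i"] that by (simp add: power2_eq_square)
      also have "\<dots> = 1" using E'2 that by simp
      finally show ?thesis by (simp add: abs_square_le_1)
    qed
    then have "G \<in> box" unfolding box_def G_def by (auto simp: abs_le_iff)
    then have "G \<in> Q"
      using E'1 E'2 unfolding Q_def O1_def O2_def ip_def by (auto simp: G_def cong: sum.cong_simp)
    then have "f G \<le> f F" by (rule max)
    have fG: "f G = (\<Sum>e<d. (qform d B (E' e) (E' e))\<^sup>2)"
      unfolding f_def qform_def G_def by (intro sum.cong refl arg_cong[where f="\<lambda>x. x\<^sup>2"]) auto
    have q: "qform d B (E b) (E a) = \<beta>" using qform_sym[OF sym] \<beta>_def by simp
    have qa: "qform d B (E' a) (E' a) = c\<^sup>2 * \<alpha> + 2 * c * s * \<beta> + s\<^sup>2 * \<gamma>"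
      unfolding E'_def using q by (simp add: qform_linear \<alpha>_def \<gamma>_def \<beta>_def power2_eq_square)
    have qb: "qform d B (E' b) (E' b) = s\<^sup>2 * \<alpha> - 2 * c * s * \<beta> + c\<^sup>2 * \<gamma>"
    proof -
      have "E' b = (\<lambda>i. r * E a i + c * E b i)" using ab by (simp add: E'_def)
      then show ?thesis
        by (simp only: qform_linear q) (simp add: \<alpha>_def \<gamma>_def \<beta>_def r_def power2_eq_square)
    qed
    have split: "(\<Sum>e<d. g e) = g a + g b + (\<Sum>e\<in>{..<d} - {a, b}. g e)" for g :: "nat \<Rightarrow> real"
      using ab by (subst sum.subset_diff[of "{a, b}"]) auto
    have "(\<Sum>e\<in>{..<d} - {a, b}. (qform d B (E' e) (E' e))\<^sup>2) = (\<Sum>e\<in>{..<d} - {a, b}. (qform d B (E e) (E e))\<^sup>2)"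
      by (intro sum.cong refl) (simp add: E'_def)
    then have "f F < f G"
      unfolding fE fG split qa qb using gt by (simp add: \<alpha>_def \<gamma>_def)
    with \<open>f G \<le> f F\<close> show False by simp
  qed
  with E show ?thesis by blast
qed

section \<open>Weighted covariance operators and traces of their powers\<close>

definition covop :: "nat \<Rightarrow> nat \<Rightarrow> (nat \<Rightarrow> real) \<Rightarrow> (nat \<Rightarrow> nat \<Rightarrow> real) \<Rightarrow> (nat \<Rightarrow> real) \<Rightarrow> nat \<Rightarrow> real" where
  "covop d k u x y = (\<lambda>j. \<Sum>l<k. u l * ip d (x l) y * x l j)"

text \<open>
  Operators are functions on vectors, as the algorithm applies \<open>covop\<close> without forming a matrix.
  Nonnegative eigenvalues are part of the notion: all operators below are positive semidefinite.
\<close>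

definition is_eigenbasis ::
  "nat \<Rightarrow> ((nat \<Rightarrow> real) \<Rightarrow> nat \<Rightarrow> real) \<Rightarrow> (nat \<Rightarrow> nat \<Rightarrow> real) \<Rightarrow> (nat \<Rightarrow> real) \<Rightarrow> bool" where
  "is_eigenbasis d A E lam \<longleftrightarrow> is_orthobasis d E \<and> (\<forall>a<d. 0 \<le> lam a) \<and>
    (\<forall>a<d. \<forall>y. ip d (E a) (A y) = lam a * ip d (E a) y)"

lemma ip_covop: "ip d y (covop d k u x v) = (\<Sum>l<k. u l * ip d (x l) y * ip d (x l) v)"
  unfolding covop_def ip_sum_right ip_scale_right by (simp add: ip_commute[of d y] algebra_simps)

lemma covop_eigenbasis:
  assumes "\<And>l. l < k \<Longrightarrow> 0 \<le> u l"
  shows "\<exists>E lam. is_eigenbasis d (covop d k u x) E lam"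
proof -
  let ?A = "covop d k u x"
  define B where "B i j = (\<Sum>l<k. u l * (x l i * x l j))" for i j
  have q: "qform d B y v = ip d y (?A v)" for y v
  proof -
    have "qform d B y v = (\<Sum>i<d. \<Sum>j<d. \<Sum>l<k. y i * (u l * (x l i * x l j)) * v j)"
      by (simp add: qform_def B_def sum_distrib_left sum_distrib_right)
    also have "\<dots> = (\<Sum>l<k. \<Sum>i<d. \<Sum>j<d. y i * (u l * (x l i * x l j)) * v j)"
      by (rule trans[OF sum.cong[OF refl sum.swap] sum.swap])
    also have "\<dots> = (\<Sum>l<k. u l * ip d (x l) y * ip d (x l) v)"
    proof (intro sum.cong refl)
      fix l
      have "u l * ip d (x l) y * ip d (x l) v = u l * ((\<Sum>i<d. x l i * y i) * (\<Sum>j<d. x l j * v j))"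
        by (simp add: ip_def mult.assoc)
      also have "\<dots> = (\<Sum>i<d. \<Sum>j<d. y i * (u l * (x l i * x l j)) * v j)"
        by (simp only: sum_product) (simp add: sum_distrib_left mult_ac)
      finally show "(\<Sum>i<d. \<Sum>j<d. y i * (u l * (x l i * x l j)) * v j) = u l * ip d (x l) y * ip d (x l) v" ..
    qed
    finally show ?thesis by (simp add: ip_covop)
  qed
  have "\<forall>i<d. \<forall>j<d. B i j = B j i" by (simp add: B_def mult.commute)
  from symmetric_diagonalizable[OF this] obtain E where E: "is_orthobasis d E"
    and off: "\<And>a b. a < d \<Longrightarrow> b < d \<Longrightarrow> a \<noteq> b \<Longrightarrow> ip d (E a) (?A (E b)) = 0"
    unfolding q by blast
  define lam where "lam a = ip d (E a) (?A (E a))" for a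
  have "0 \<le> lam a" for a
    unfolding lam_def ip_covop using assms by (auto intro!: sum_nonneg simp: mult.assoc)
  moreover have "ip d (E a) (?A y) = lam a * ip d (E a) y" if a: "a < d" for a y
  proof -
    have "ip d (E a) (?A y) = ip d y (?A (E a))" by (simp add: ip_covop algebra_simps)
    also have "\<dots> = (\<Sum>b<d. ip d (E b) y * ip d (E b) (?A (E a)))" by (rule orthobasis_parseval[OF E])
    also have "\<dots> = (\<Sum>b\<in>{a}. ip d (E b) y * ip d (E b) (?A (E a)))"
      using a off by (intro sum.mono_neutral_right) auto
    finally show ?thesis by (simp add: lam_def)
  qed
  ultimately show ?thesis using E unfolding is_eigenbasis_def by blast
qed

context
  fixes d A E lam
  assumes eig: "is_eigenbasis d A E lam"
begin

lemma eig_ortho: "is_orthobasis d E" using eig unfolding is_eigenbasis_def by simp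

lemma eig_nonneg: "a < d \<Longrightarrow> 0 \<le> lam a" using eig unfolding is_eigenbasis_def by simp

lemma eig_pow: "a < d \<Longrightarrow> ip d (E a) ((A ^^ m) y) = lam a ^ m * ip d (E a) y"
  using eig unfolding is_eigenbasis_def by (induction m) (auto simp: algebra_simps)

lemma eig_self: "a < d \<Longrightarrow> b < d \<Longrightarrow> ip d (E a) (E b) = (if a = b then 1 else 0)"
  using eig_ortho unfolding is_orthobasis_def by simp

lemma eig_pow_adjoint: "ip d y ((A ^^ m) v) = ip d ((A ^^ m) y) v"
  unfolding orthobasis_parseval[OF eig_ortho, of y] orthobasis_parseval[OF eig_ortho, of "(A ^^ m) y"]
  by (intro sum.cong refl) (simp add: eig_pow)

lemma eig_pow_norm: "ip d ((A ^^ m) y) ((A ^^ m) y) = (\<Sum>a<d. lam a ^ (2 * m) * (ip d (E a) y)\<^sup>2)"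
  unfolding orthobasis_parseval[OF eig_ortho, of "(A ^^ m) y"]
  by (intro sum.cong refl) (simp add: eig_pow power_even_eq power2_eq_square)

lemma eig_trace: "(\<Sum>j<d. ip d ((A ^^ m) (unit_vec j)) ((A ^^ m) (unit_vec j))) = (\<Sum>a<d. lam a ^ (2 * m))"
proof -
  have "(\<Sum>j<d. ip d ((A ^^ m) (unit_vec j)) ((A ^^ m) (unit_vec j)))
      = (\<Sum>j<d. \<Sum>a<d. lam a ^ (2 * m) * (E a j)\<^sup>2)"
    unfolding eig_pow_norm by (intro sum.cong refl) (simp add: ip_unit_vec)
  also have "\<dots> = (\<Sum>a<d. lam a ^ (2 * m) * ip d (E a) (E a))"
    by (subst sum.swap) (simp add: ip_def sum_distrib_left power2_eq_square)
  finally show ?thesis by (simp add: eig_self)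
qed

text \<open>
  By self-adjointness of \<open>A\<^sup>m\<close> a score is a sum of squares of \<open>d\<close> linear forms in the scored vector. This
  is the shape of quadratic form to which \<open>dispersed\<close> applies.
\<close>

lemma eig_pow_rows: "ip d ((A ^^ m) y) ((A ^^ m) y) = (\<Sum>j<d. (ip d ((A ^^ m) (unit_vec j)) y)\<^sup>2)"
proof -
  have "(A ^^ m) y j = ip d ((A ^^ m) (unit_vec j)) y" if "j < d" for j
    using ip_unit_vec[OF that, of "(A ^^ m) y"] eig_pow_adjoint[of "unit_vec j" m y] by (simp add: ip_commute)
  then show ?thesis unfolding ip_def[of d "(A ^^ m) y"] by (simp add: power2_eq_square)
qed

end

context
  fixes d k :: nat and u :: "nat \<Rightarrow> real" and x E lam
  assumes eig: "is_eigenbasis d (covop d k u x) E lam"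
begin

lemma covop_quad: "(\<Sum>l<k. u l * (ip d (x l) v)\<^sup>2) = (\<Sum>a<d. lam a * (ip d (E a) v)\<^sup>2)"
proof -
  have "(\<Sum>l<k. u l * (ip d (x l) v)\<^sup>2) = ip d v (covop d k u x v)"
    by (simp add: ip_covop power2_eq_square mult.assoc)
  also have "\<dots> = (\<Sum>a<d. ip d (E a) v * ip d (E a) (covop d k u x v))"
    by (rule orthobasis_parseval[OF eig_ortho[OF eig]])
  also have "\<dots> = (\<Sum>a<d. lam a * (ip d (E a) v)\<^sup>2)"
    using eig unfolding is_eigenbasis_def
    by (intro sum.cong refl) (auto simp: power2_eq_square algebra_simps)
  finally show ?thesis .
qed

lemma covop_quad_eig: "a < d \<Longrightarrow> (\<Sum>l<k. u l * (ip d (x l) (E a))\<^sup>2) = lam a"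
  unfolding covop_quad by (simp add: eig_self[OF eig] if_distrib[of "\<lambda>c. _ * c"] if_distrib[of "\<lambda>c. c\<^sup>2"] sum.delta cong: if_cong)

lemma covop_potential:
  "(\<Sum>l<k. u l * ip d ((covop d k u x ^^ m) (x l)) ((covop d k u x ^^ m) (x l))) = (\<Sum>a<d. lam a ^ (2 * m + 1))"
proof -
  have "(\<Sum>l<k. u l * ip d ((covop d k u x ^^ m) (x l)) ((covop d k u x ^^ m) (x l)))
      = (\<Sum>l<k. \<Sum>a<d. lam a ^ (2 * m) * (u l * (ip d (x l) (E a))\<^sup>2))"
    unfolding eig_pow_norm[OF eig] sum_distrib_left by (simp add: mult_ac ip_commute)
  also have "\<dots> = (\<Sum>a<d. lam a ^ (2 * m) * (\<Sum>l<k. u l * (ip d (x l) (E a))\<^sup>2))"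
    by (subst sum.swap) (simp add: sum_distrib_left)
  also have "\<dots> = (\<Sum>a<d. lam a ^ (2 * m + 1))"
    by (intro sum.cong refl) (simp add: covop_quad_eig)
  finally show ?thesis .
qed

lemma covop_quad_le:
  assumes "\<And>a. a < d \<Longrightarrow> lam a \<le> b"
  shows "(\<Sum>l<k. u l * (ip d (x l) v)\<^sup>2) \<le> b * ip d v v"
proof -
  have "(\<Sum>l<k. u l * (ip d (x l) v)\<^sup>2) \<le> (\<Sum>a<d. b * (ip d (E a) v)\<^sup>2)"
    unfolding covop_quad using assms by (intro sum_mono mult_right_mono) auto
  also have "\<dots> = b * ip d v v"
    unfolding orthobasis_parseval[OF eig_ortho[OF eig], of v v] by (simp add: sum_distrib_left power2_eq_square)
  finally show ?thesis .
qed

end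

lemma power_mean_le:
  fixes w lam :: "nat \<Rightarrow> real"
  assumes "even n" "\<And>a. a < d \<Longrightarrow> 0 \<le> w a" "(\<Sum>a<d. w a) = 1"
  shows "(\<Sum>a<d. lam a * w a) ^ n \<le> (\<Sum>a<d. lam a ^ n * w a)"
proof -
  have "convex_on UNIV (\<lambda>x::real. x ^ n)"
    using assms(1) by (rule convex_power_even)
  moreover have "d > 0" using assms(3) by (cases d) auto
  ultimately have "(\<Sum>a<d. w a *\<^sub>R lam a) ^ n \<le> (\<Sum>a<d. w a * lam a ^ n)"
    using assms by (intro convex_on_sum[where C=UNIV]) auto
  then show ?thesis by (simp add: mult.commute)
qed

text \<open>
  Peierls' inequality \<open>Tr B\<^sup>p \<le> Tr (B A\<^sup>p\<^sup>-\<^sup>1)\<close> for \<open>0 \<le> B \<le> A\<close>, with \<open>p = 2 m + 1\<close>. The matrices need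
  not commute: in an eigenbasis \<open>f\<close> of \<open>B\<close> each eigenvalue is at most the mean of the spectral measure
  of \<open>A\<close> at \<open>f\<close>, and the power of a mean is at most the mean of the powers.
\<close>

lemma peierls:
  assumes u: "\<And>l. l < k \<Longrightarrow> 0 \<le> u l" and u': "\<And>l. l < k \<Longrightarrow> 0 \<le> u' l"
    and le: "\<And>v. (\<Sum>l<k. u' l * (ip d (x' l) v)\<^sup>2) \<le> (\<Sum>l<k. u l * (ip d (x l) v)\<^sup>2)"
  shows "(\<Sum>l<k. u' l * ip d ((covop d k u' x' ^^ m) (x' l)) ((covop d k u' x' ^^ m) (x' l)))
     \<le> (\<Sum>l<k. u' l * ip d ((covop d k u x ^^ m) (x' l)) ((covop d k u x ^^ m) (x' l)))"
proof -
  let ?A = "covop d k u x" and ?B = "covop d k u' x'"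
  obtain E lam where E: "is_eigenbasis d ?A E lam" using covop_eigenbasis[of k u, OF u] by blast
  obtain F b where F: "is_eigenbasis d ?B F b" using covop_eigenbasis[of k u', OF u'] by blast
  have "(\<Sum>l<k. u' l * ip d ((?B ^^ m) (x' l)) ((?B ^^ m) (x' l))) = (\<Sum>c<d. b c ^ (2 * m + 1))"
    by (rule covop_potential[OF F])
  also have "\<dots> \<le> (\<Sum>c<d. b c * ip d ((?A ^^ m) (F c)) ((?A ^^ m) (F c)))"
  proof (rule sum_mono)
    fix c assume "c \<in> {..<d}"
    then have c: "c < d" by simp
    define w where "w a = (ip d (E a) (F c))\<^sup>2" for a
    have sw: "(\<Sum>a<d. w a) = 1"
      using orthobasis_parseval[OF eig_ortho[OF E], of "F c" "F c"] eig_self[OF F c c]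
      by (simp add: w_def power2_eq_square)
    have "b c = (\<Sum>l<k. u' l * (ip d (x' l) (F c))\<^sup>2)" using covop_quad_eig[OF F c] by simp
    also have "\<dots> \<le> (\<Sum>a<d. lam a * w a)"
      unfolding w_def covop_quad[OF E, symmetric] by (rule le)
    finally have "b c ^ (2 * m) \<le> (\<Sum>a<d. lam a * w a) ^ (2 * m)"
      using eig_nonneg[OF F c] by (rule power_mono)
    also have "\<dots> \<le> (\<Sum>a<d. lam a ^ (2 * m) * w a)"
      using sw by (intro power_mean_le) (auto simp: w_def)
    also have "\<dots> = ip d ((?A ^^ m) (F c)) ((?A ^^ m) (F c))"
      by (simp add: eig_pow_norm[OF E] w_def)
    finally show "b c ^ (2 * m + 1) \<le> b c * ip d ((?A ^^ m) (F c)) ((?A ^^ m) (F c))"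
      using eig_nonneg[OF F c] by (simp add: mult_left_mono)
  qed
  also have "\<dots> = (\<Sum>c<d. \<Sum>a<d. lam a ^ (2 * m) * (b c * (ip d (F c) (E a))\<^sup>2))"
    unfolding eig_pow_norm[OF E] sum_distrib_left by (simp add: ip_commute mult_ac)
  also have "\<dots> = (\<Sum>a<d. lam a ^ (2 * m) * (\<Sum>c<d. b c * (ip d (F c) (E a))\<^sup>2))"
    by (subst sum.swap) (simp add: sum_distrib_left)
  also have "\<dots> = (\<Sum>a<d. \<Sum>l<k. u' l * (lam a ^ (2 * m) * (ip d (E a) (x' l))\<^sup>2))"
    unfolding covop_quad[OF F, symmetric] sum_distrib_left by (simp add: ip_commute mult_ac)
  also have "\<dots> = (\<Sum>l<k. u' l * ip d ((?A ^^ m) (x' l)) ((?A ^^ m) (x' l)))"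
    unfolding eig_pow_norm[OF E] sum_distrib_left by (rule sum.swap)
  finally show ?thesis .
qed

text \<open>
  The ratio of the traces of the powers \<open>2m + 1\<close> and \<open>2m\<close> is the average score, and it determines the
  top eigenvalue \<open>b\<close> up to the factor 3: the at most \<open>d \<le> 4\<^sup>m\<close> eigenvalues below \<open>b / 2\<close> contribute no more
  than \<open>b\<^sup>2\<^sup>m\<close> to the second trace, and each of the others contributes at most \<open>2 / b\<close> times what it
  contributes to the first.
\<close>

lemma eigenvalues_le_of_potential_le:
  fixes lam :: "nat \<Rightarrow> real"
  assumes nn: "\<And>a. a < d \<Longrightarrow> 0 \<le> lam a" and d: "d \<le> 4 ^ m" and c: "0 \<le> c"
    and le: "(\<Sum>a<d. lam a ^ (2 * m + 1)) \<le> c * (\<Sum>a<d. lam a ^ (2 * m))" and a: "a < d"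
  shows "lam a \<le> 3 * c"
proof -
  define b where "b = Max (lam ` {..<d})"
  have ne: "lam ` {..<d} \<noteq> {}" using a by auto
  have bge: "lam a' \<le> b" if "a' < d" for a' unfolding b_def using that by simp
  obtain a0 where a0: "a0 < d" "lam a0 = b" using Max_in[OF _ ne] unfolding b_def by auto
  have "b \<le> 3 * c"
  proof (cases "b > 0")
    case True
    let ?\<phi> = "\<Sum>a<d. lam a ^ (2 * m + 1)"
    have \<phi>: "b ^ (2 * m + 1) \<le> ?\<phi>"
      using member_le_sum[of a0 "{..<d}" "\<lambda>a. lam a ^ (2 * m + 1)"] a0 nn by auto
    then have pos: "?\<phi> > 0" using True zero_less_power[of b "2 * m + 1"] by linarith
    have "lam a ^ (2 * m) \<le> 2 / b * lam a ^ (2 * m + 1) + (b / 2) ^ (2 * m)" if "a < d" for a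
    proof (cases "lam a \<ge> b / 2")
      case T: True
      have "lam a ^ (2 * m) * 1 \<le> lam a ^ (2 * m) * (2 / b * lam a)"
        using T True nn[OF that] by (intro mult_left_mono) (auto simp: field_simps)
      then show ?thesis using True by (simp add: mult_ac) (smt (verit) divide_pos_pos zero_le_power)
    next
      case False
      then have "lam a ^ (2 * m) \<le> (b / 2) ^ (2 * m)" using nn[OF that] by (intro power_mono) auto
      then show ?thesis using True nn[OF that] by (simp add: add_increasing)
    qed
    then have "(\<Sum>a<d. lam a ^ (2 * m)) \<le> (\<Sum>a<d. 2 / b * lam a ^ (2 * m + 1) + (b / 2) ^ (2 * m))"
      by (intro sum_mono) auto
    also have "\<dots> = 2 / b * ?\<phi> + real d * (b / 2) ^ (2 * m)"
      by (simp add: sum.distrib sum_distrib_left)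
    also have "real d * (b / 2) ^ (2 * m) \<le> ?\<phi> / b"
    proof -
      have "real d \<le> 4 ^ m" using d by (metis of_nat_le_iff of_nat_numeral of_nat_power)
      then have "real d * (b / 2) ^ (2 * m) \<le> 4 ^ m * (b / 2) ^ (2 * m)"
        by (intro mult_right_mono) auto
      also have "\<dots> = b ^ (2 * m)" by (simp add: power_mult power_divide)
      also have "\<dots> \<le> ?\<phi> / b" using \<phi> True by (simp add: field_simps)
      finally show ?thesis .
    qed
    finally have "(\<Sum>a<d. lam a ^ (2 * m)) \<le> 3 * ?\<phi> / b" by simp
    then have "?\<phi> \<le> c * (3 * ?\<phi> / b)" using le c by (meson mult_left_mono order_trans)
    then have "b * ?\<phi> \<le> (3 * c) * ?\<phi>" using True by (simp add: field_simps)
    then show ?thesis using pos by simp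
  qed (use c in auto)
  with bge[OF a] show ?thesis by simp
qed

section \<open>One step of the filter\<close>

definition wmass :: "nat \<Rightarrow> (nat \<Rightarrow> real) \<Rightarrow> real" where
  "wmass k u = (\<Sum>i<k. u i)"

definition wmean :: "nat \<Rightarrow> (nat \<Rightarrow> nat \<Rightarrow> real) \<Rightarrow> (nat \<Rightarrow> real) \<Rightarrow> nat \<Rightarrow> real" where
  "wmean k z u = (\<lambda>j. (\<Sum>i<k. u i * z i j) / wmass k u)"

definition centered :: "nat \<Rightarrow> (nat \<Rightarrow> nat \<Rightarrow> real) \<Rightarrow> (nat \<Rightarrow> real) \<Rightarrow> nat \<Rightarrow> nat \<Rightarrow> real" where
  "centered k z u i = (\<lambda>j. z i j - wmean k z u j)"

definition wcov :: "nat \<Rightarrow> nat \<Rightarrow> (nat \<Rightarrow> nat \<Rightarrow> real) \<Rightarrow> (nat \<Rightarrow> real) \<Rightarrow> (nat \<Rightarrow> real) \<Rightarrow> nat \<Rightarrow> real" where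
  "wcov d k z u = covop d k u (centered k z u)"

text \<open>
  The quadratic form of \<open>A\<^sup>2\<^sup>m\<close>, a smooth substitute for the squared component along the top
  eigenvectors of \<open>A\<close>: points with a large score are responsible for the large eigenvalues.
\<close>

definition power_score :: "nat \<Rightarrow> nat \<Rightarrow> nat \<Rightarrow> (nat \<Rightarrow> nat \<Rightarrow> real) \<Rightarrow> (nat \<Rightarrow> real) \<Rightarrow> (nat \<Rightarrow> real) \<Rightarrow> real" where
  "power_score d k m z u y = ip d ((wcov d k z u ^^ m) y) ((wcov d k z u ^^ m) y)"

definition scores :: "nat \<Rightarrow> nat \<Rightarrow> nat \<Rightarrow> (nat \<Rightarrow> nat \<Rightarrow> real) \<Rightarrow> (nat \<Rightarrow> real) \<Rightarrow> nat \<Rightarrow> real" where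
  "scores d k m z u i = power_score d k m z u (centered k z u i)"

definition wsum :: "nat \<Rightarrow> (nat \<Rightarrow> real) \<Rightarrow> (nat \<Rightarrow> real) \<Rightarrow> real" where
  "wsum k u q = (\<Sum>i<k. u i * q i)"

text \<open>
  The smallest score at which truncation still preserves half of the weighted sum. The sum of all scores
  is an upper bound for them, which keeps the set nonempty.
\<close>

definition threshold :: "nat \<Rightarrow> (nat \<Rightarrow> real) \<Rightarrow> (nat \<Rightarrow> real) \<Rightarrow> real" where
  "threshold k u q = Min (insert (\<Sum>i<k. q i)
     {q j | j. j < k \<and> wsum k u q \<le> 2 * (\<Sum>i<k. u i * min (q i) (q j))})"

definition downweight :: "nat \<Rightarrow> (nat \<Rightarrow> real) \<Rightarrow> (nat \<Rightarrow> real) \<Rightarrow> nat \<Rightarrow> real" where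
  "downweight k u q i = u i * (1 - min 1 (q i / threshold k u q))"

text \<open>
  A step that would leave less than four fifths of the mass is not carried out. Every later step is then
  refused as well, so the loop needs no other stopping rule and no knowledge of the error \<open>r\<close>.
\<close>

definition filter_step :: "nat \<Rightarrow> nat \<Rightarrow> nat \<Rightarrow> (nat \<Rightarrow> nat \<Rightarrow> real) \<Rightarrow> (nat \<Rightarrow> real) \<Rightarrow> nat \<Rightarrow> real" where
  "filter_step d k m z u = (let u' = downweight k u (scores d k m z u) in
     if 4 * real k \<le> 5 * wmass k u' then u' else u)"

text \<open>
  Truncating at \<open>\<tau>\<close> keeps half of the weighted sum, which bounds the removed mass from below by
  \<open>\<Sum> u q / (2 \<tau>)\<close>. Truncating at the largest score below \<open>\<tau>\<close> does not keep half, so the points that survive a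
  step carry at most half of the weighted sum.
\<close>

lemma threshold_props:
  assumes u: "\<And>i. i < k \<Longrightarrow> 0 \<le> u i" and q: "\<And>i. i < k \<Longrightarrow> 0 \<le> q i" and k: "k > 0"
  defines "\<tau> \<equiv> threshold k u q"
  shows "0 \<le> \<tau>" and "wsum k u q \<le> 2 * (\<Sum>i<k. u i * min (q i) \<tau>)"
    and "2 * (\<Sum>i | i < k \<and> q i < \<tau>. u i * q i) \<le> wsum k u q"
    and "wsum k u q > 0 \<Longrightarrow> \<tau> > 0"
proof -
  let ?h = "\<lambda>t. \<Sum>i<k. u i * min (q i) t"
  define S where "S = {q j | j. j < k \<and> wsum k u q \<le> 2 * ?h (q j)}"
  have fin: "finite S" unfolding S_def by simp
  have t: "\<tau> = Min (insert (\<Sum>i<k. q i) S)" unfolding \<tau>_def threshold_def S_def ..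
  have tin: "\<tau> \<in> insert (\<Sum>i<k. q i) S" unfolding t using fin by (intro Min_in) auto
  have qs: "q i \<le> (\<Sum>i<k. q i)" if "i < k" for i
    using that q by (intro member_le_sum) auto
  show nn: "0 \<le> \<tau>" using tin q unfolding S_def by (auto intro: sum_nonneg)
  have wn: "0 \<le> wsum k u q" unfolding wsum_def using u q by (auto intro!: sum_nonneg)
  have "?h (\<Sum>i<k. q i) = wsum k u q"
    unfolding wsum_def using qs by (intro sum.cong refl) (simp add: min_absorb1)
  then show h: "wsum k u q \<le> 2 * ?h \<tau>" using tin wn unfolding S_def by auto
  show "2 * (\<Sum>i | i < k \<and> q i < \<tau>. u i * q i) \<le> wsum k u q"
  proof (cases "{i. i < k \<and> q i < \<tau>} = {}")
    case True then show ?thesis unfolding True using wn by simp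
  next
    case False
    define L where "L = {i. i < k \<and> q i < \<tau>}"
    have L: "finite L" "L \<noteq> {}" using False unfolding L_def by auto
    have "Max (q ` L) \<in> q ` L" using L by (intro Max_in) auto
    then obtain j where j: "j \<in> L" "Max (q ` L) = q j" by (rule imageE)
    have jm: "q i \<le> q j" if "i \<in> L" for i
      unfolding j(2)[symmetric] using L(1) that by (intro Max_ge) auto
    have "q j \<notin> S" using Min_le[of "insert (\<Sum>i<k. q i) S" "q j"] fin j(1) unfolding t[symmetric] L_def by auto
    then have lt: "2 * ?h (q j) < wsum k u q" using j(1) unfolding S_def L_def by auto
    have "(\<Sum>i\<in>L. u i * q i) = (\<Sum>i\<in>L. u i * min (q i) (q j))"
      using jm by (intro sum.cong refl) (simp add: min_def)
    also have "\<dots> \<le> ?h (q j)"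
      using u q j(1) unfolding L_def by (intro sum_mono2) auto
    finally show ?thesis using lt unfolding L_def by simp
  qed
  show "\<tau> > 0" if "wsum k u q > 0"
  proof (rule ccontr)
    assume "\<not> \<tau> > 0"
    then have "\<tau> = 0" using nn by simp
    then have "?h \<tau> = 0" using q by (intro sum.neutral ballI) (simp add: min_absorb2)
    with h that show False by simp
  qed
qed

lemma downweight_props:
  assumes u: "\<And>i. i < k \<Longrightarrow> 0 \<le> u i" and q: "\<And>i. i < k \<Longrightarrow> 0 \<le> q i" and k: "k > 0"
  defines "u' \<equiv> downweight k u q" and "\<tau> \<equiv> threshold k u q"
  shows "\<And>i. i < k \<Longrightarrow> 0 \<le> u' i" and "\<And>i. i < k \<Longrightarrow> u' i \<le> u i"
    and "\<And>i. i < k \<Longrightarrow> u i \<le> 1 \<Longrightarrow> u i - q i / \<tau> \<le> u' i"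
    and "2 * wsum k u' q \<le> wsum k u q"
    and "wsum k u q / \<tau> \<le> 2 * (wmass k u - wmass k u')"
proof -
  have T: "0 \<le> \<tau>" "wsum k u q \<le> 2 * (\<Sum>i<k. u i * min (q i) \<tau>)"
    "2 * (\<Sum>i | i < k \<and> q i < \<tau>. u i * q i) \<le> wsum k u q" "wsum k u q > 0 \<Longrightarrow> \<tau> > 0"
    unfolding \<tau>_def using threshold_props[of k u q] u q k by blast+
  have u'_eq: "u' i = u i * (1 - min 1 (q i / \<tau>))" for i by (simp add: u'_def downweight_def \<tau>_def)
  have r: "0 \<le> q i / \<tau>" if "i < k" for i using T(1) q[OF that] by simp
  show n: "0 \<le> u' i" if "i < k" for i unfolding u'_eq using u[OF that] by (intro mult_nonneg_nonneg) auto
  show le: "u' i \<le> u i" if "i < k" for i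
    unfolding u'_eq using u[OF that] r[OF that] by (intro mult_left_le) auto
  show "u i - q i / \<tau> \<le> u' i" if "i < k" "u i \<le> 1" for i
  proof -
    have "u i * min 1 (q i / \<tau>) \<le> 1 * (q i / \<tau>)"
      using u[OF that(1)] that r[OF that(1)] by (intro mult_mono) auto
    then show ?thesis unfolding u'_eq by (simp add: algebra_simps)
  qed
  have "wsum k u q \<ge> 0" unfolding wsum_def using u q by (auto intro!: sum_nonneg)
  then consider "wsum k u q = 0" | "wsum k u q > 0" by linarith
  then show "2 * wsum k u' q \<le> wsum k u q"
  proof cases
    case 1
    then have "\<forall>i<k. u i * q i = 0" using sum_nonneg_eq_0_iff[of "{..<k}" "\<lambda>i. u i * q i"] u q
      unfolding wsum_def by auto
    then have "wsum k u' q = 0" unfolding wsum_def u'_eq by (intro sum.neutral) auto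
    then show ?thesis using 1 by simp
  next
    case 2
    have z: "u' i = 0" if "\<not> q i < \<tau>" for i
      using T(4)[OF 2] that by (simp add: u'_eq min_def le_divide_eq)
    have "wsum k u' q \<le> (\<Sum>i | i < k \<and> q i < \<tau>. u' i * q i)"
      unfolding wsum_def by (rule eq_refl, rule sum.mono_neutral_right) (auto simp: z)
    also have "\<dots> \<le> (\<Sum>i | i < k \<and> q i < \<tau>. u i * q i)"
      using le q by (intro sum_mono mult_right_mono) auto
    finally show ?thesis using T(3) by simp
  qed
  show "wsum k u q / \<tau> \<le> 2 * (wmass k u - wmass k u')"
  proof (cases "\<tau> = 0")
    case True
    then show ?thesis using le by (auto simp: wmass_def intro!: sum_mono)
  next
    case False
    then have t: "\<tau> > 0" using T(1) by simp
    have "wmass k u - wmass k u' = (\<Sum>i<k. u i * min (q i) \<tau> / \<tau>)"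
      unfolding wmass_def sum_subtractf[symmetric] u'_eq
      using t by (intro sum.cong refl) (auto simp: min_def field_simps)
    then have "2 * (wmass k u - wmass k u') = 2 * (\<Sum>i<k. u i * min (q i) \<tau>) / \<tau>"
      by (simp flip: sum_divide_distrib)
    then show ?thesis using T(2) t by (simp add: divide_right_mono)
  qed
qed

lemma wmean_minimizes:
  fixes a u :: "nat \<Rightarrow> real"
  assumes "0 < (\<Sum>i<k. u i)"
  shows "(\<Sum>i<k. u i * (a i - (\<Sum>i<k. u i * a i) / (\<Sum>i<k. u i))\<^sup>2) \<le> (\<Sum>i<k. u i * (a i - c)\<^sup>2)"
proof -
  define M S where "M = (\<Sum>i<k. u i)" and "S = (\<Sum>i<k. u i * a i)"
  have e: "(\<Sum>i<k. u i * (a i - c)\<^sup>2) = (\<Sum>i<k. u i * (a i)\<^sup>2) - 2 * c * S + c\<^sup>2 * M" for c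
  proof -
    have "(\<Sum>i<k. u i * (a i - c)\<^sup>2) = (\<Sum>i<k. u i * (a i)\<^sup>2 - 2 * c * (u i * a i) + c\<^sup>2 * u i)"
      by (intro sum.cong refl) (simp add: power2_eq_square algebra_simps)
    then show ?thesis by (simp add: sum.distrib sum_subtractf sum_distrib_left M_def S_def)
  qed
  have M: "M > 0" using assms by (simp add: M_def)
  have "(\<Sum>i<k. u i * (a i - c)\<^sup>2) - (\<Sum>i<k. u i * (a i - S / M)\<^sup>2) = M * (c - S / M)\<^sup>2"
    unfolding e using M by (simp add: power2_eq_square field_simps)
  moreover have "0 \<le> M * (c - S / M)\<^sup>2" using M by simp
  ultimately show ?thesis unfolding M_def S_def by linarith
qed

lemma ip_wmean: "ip d v (wmean k z u) = (\<Sum>i<k. u i * ip d v (z i)) / wmass k u"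
  unfolding wmean_def ip_divide_right ip_sum_right ip_scale_right ..

lemma ip_centered: "ip d v (centered k z u i) = ip d v (z i) - ip d v (wmean k z u)"
  unfolding centered_def ip_diff_right ..

lemma centered_quad_le:
  assumes "0 < wmass k u"
  shows "(\<Sum>i<k. u i * (ip d v (centered k z u i))\<^sup>2) \<le> (\<Sum>i<k. u i * (ip d v (\<lambda>j. z i j - c j))\<^sup>2)"
  using wmean_minimizes[of u k "\<lambda>i. ip d v (z i)" "ip d v c"] assms
  unfolding ip_centered ip_wmean ip_diff_right wmass_def .

lemma centered_quad_mono:
  assumes "0 < wmass k u'" "\<And>i. i < k \<Longrightarrow> u' i \<le> u i"
  shows "(\<Sum>i<k. u' i * (ip d v (centered k z u' i))\<^sup>2) \<le> (\<Sum>i<k. u i * (ip d v (centered k z u i))\<^sup>2)"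
proof -
  have "(\<Sum>i<k. u' i * (ip d v (centered k z u' i))\<^sup>2) \<le> (\<Sum>i<k. u' i * (ip d v (centered k z u i))\<^sup>2)"
    using centered_quad_le[OF assms(1), of d v z "wmean k z u"] unfolding centered_def .
  also have "\<dots> \<le> (\<Sum>i<k. u i * (ip d v (centered k z u i))\<^sup>2)"
    using assms(2) by (intro sum_mono mult_right_mono) auto
  finally show ?thesis .
qed

text \<open>
  The families \<open>v\<close> range over all positive semidefinite forms \<open>Q y = \<Sum> \<langle>v s, y\<rangle>\<^sup>2\<close>, normalised by their
  trace. Pairs as indices suffice: a family runs over rounds of the filter and coordinates.
\<close>

definition dispersed :: "nat \<Rightarrow> nat \<Rightarrow> (nat \<Rightarrow> nat \<Rightarrow> real) \<Rightarrow> (nat \<Rightarrow> real) \<Rightarrow> real \<Rightarrow> bool" where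
  "dispersed d k z \<mu> r \<longleftrightarrow> (\<forall>(J :: (nat \<times> nat) set) v. finite J \<longrightarrow>
     real (card {i. i < k \<and> r\<^sup>2 * (\<Sum>s\<in>J. ip d (v s) (v s)) < (\<Sum>s\<in>J. (ip d (v s) (\<lambda>j. z i j - \<mu> j))\<^sup>2)})
       \<le> real k / 100)"

lemma weighted_cauchy_schwarz:
  fixes u a :: "nat \<Rightarrow> real"
  assumes "\<And>i. i \<in> I \<Longrightarrow> 0 \<le> u i"
  shows "(\<Sum>i\<in>I. u i * a i)\<^sup>2 \<le> (\<Sum>i\<in>I. u i) * (\<Sum>i\<in>I. u i * (a i)\<^sup>2)"
proof -
  have "(\<Sum>i\<in>I. sqrt (u i) * (sqrt (u i) * a i))\<^sup>2
      \<le> (\<Sum>i\<in>I. (sqrt (u i))\<^sup>2) * (\<Sum>i\<in>I. (sqrt (u i) * a i)\<^sup>2)"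
    by (rule Cauchy_Schwarz_ineq_sum)
  also have "(\<Sum>i\<in>I. sqrt (u i) * (sqrt (u i) * a i)) = (\<Sum>i\<in>I. u i * a i)"
    using assms by (intro sum.cong refl) (simp flip: mult.assoc)
  also have "(\<Sum>i\<in>I. (sqrt (u i))\<^sup>2) = (\<Sum>i\<in>I. u i)"
    using assms by (intro sum.cong refl) simp
  also have "(\<Sum>i\<in>I. (sqrt (u i) * a i)\<^sup>2) = (\<Sum>i\<in>I. u i * (a i)\<^sup>2)"
    using assms by (intro sum.cong refl) (simp add: power_mult_distrib)
  finally show ?thesis .
qed

text \<open>
  Points with a large value of \<open>Q\<close> carry mass at most \<open>k / 100\<close>. The deviations from the weighted mean sum
  to zero, so the rest is displaced from that mean only by what these few points contribute, which is
  small by Cauchy--Schwarz unless the weighted sum of \<open>Q\<close> is large.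
\<close>

lemma wmean_shift:
  fixes J :: "(nat \<times> nat) set"
  assumes disp: "dispersed d k z \<mu> r" and J: "finite J" and k: "k > 0"
    and u: "\<And>i. i < k \<Longrightarrow> 0 \<le> u i" "\<And>i. i < k \<Longrightarrow> u i \<le> 1"
    and mass: "4 * real k \<le> 5 * wmass k u"
  shows "(\<Sum>s\<in>J. (ip d (v s) (\<lambda>j. wmean k z u j - \<mu> j))\<^sup>2)
    \<le> (\<Sum>i<k. u i * (\<Sum>s\<in>J. (ip d (v s) (centered k z u i))\<^sup>2)) / (31 * real k)
        + 2 * r\<^sup>2 * (\<Sum>s\<in>J. ip d (v s) (v s))"
proof -
  define T where "T = (\<Sum>s\<in>J. ip d (v s) (v s))"
  define Q where "Q y = (\<Sum>s\<in>J. (ip d (v s) y)\<^sup>2)" for y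
  define Y where "Y i = (\<lambda>j. z i j - \<mu> j)" for i
  define X where "X i = centered k z u i" for i
  define Bd where "Bd = {i. i < k \<and> r\<^sup>2 * T < Q (Y i)}"
  define G where "G = {..<k} - Bd"
  define \<phi> where "\<phi> = (\<Sum>i<k. u i * Q (X i))"
  have Bk: "Bd \<subseteq> {..<k}" and fin: "finite Bd" "finite G" unfolding Bd_def G_def by auto
  have cB: "real (card Bd) \<le> real k / 100"
    using disp J unfolding dispersed_def Bd_def Q_def T_def Y_def by blast
  define mG mB where "mG = (\<Sum>i\<in>G. u i)" and "mB = (\<Sum>i\<in>Bd. u i)"
  have split: "(\<Sum>i<k. f i) = (\<Sum>i\<in>G. f i) + (\<Sum>i\<in>Bd. f i)" for f :: "nat \<Rightarrow> real"
    unfolding G_def by (rule sum.subset_diff[OF Bk]) simp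
  have uB: "0 \<le> u i" "u i \<le> 1" if "i \<in> Bd" for i using that u Bk by auto
  have uG: "0 \<le> u i" if "i \<in> G" for i using that u unfolding G_def by auto
  have "mB \<le> (\<Sum>i\<in>Bd. 1)" unfolding mB_def using uB by (intro sum_mono) auto
  then have mB: "mB \<le> real k / 100" "0 \<le> mB" using cB uB unfolding mB_def by (auto intro: sum_nonneg)
  have "wmass k u = mG + mB" unfolding wmass_def mG_def mB_def by (rule split)
  then have mG: "mG \<ge> 79 / 100 * real k" using mB mass by simp
  then have mGpos: "mG > 0" using k by (simp add: less_le_trans[rotated])
  have Mpos: "wmass k u > 0" using mass k by simp
  have Qn: "0 \<le> Q y" for y unfolding Q_def by (intro sum_nonneg) auto
  have \<phi>n: "0 \<le> \<phi>" unfolding \<phi>_def using u(1) Qn by (auto intro!: sum_nonneg)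
  have one: "mG\<^sup>2 * (ip d w (\<lambda>j. wmean k z u j - \<mu> j))\<^sup>2
      \<le> 2 * mG * (\<Sum>i\<in>G. u i * (ip d w (Y i))\<^sup>2) + 2 * mB * (\<Sum>i\<in>Bd. u i * (ip d w (X i))\<^sup>2)" for w
  proof -
    define g where "g = ip d w (\<lambda>j. wmean k z u j - \<mu> j)"
    have yx: "ip d w (Y i) = ip d w (X i) + g" for i
      unfolding g_def Y_def X_def ip_centered ip_diff_right by simp
    have z: "(\<Sum>i<k. u i * ip d w (X i)) = 0"
    proof -
      have "(\<Sum>i<k. u i * (ip d w (z i) - c)) = (\<Sum>i<k. u i * ip d w (z i)) - wmass k u * c" for c
        by (simp add: algebra_simps sum_subtractf sum_distrib_left wmass_def)
      then show ?thesis unfolding X_def ip_centered ip_wmean using Mpos by simp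
    qed
    have "(\<Sum>i\<in>G. u i * ip d w (Y i)) = (\<Sum>i\<in>G. u i * ip d w (X i)) + mG * g"
      unfolding yx mG_def by (simp add: algebra_simps sum.distrib sum_distrib_left)
    also have "\<dots> = mG * g - (\<Sum>i\<in>Bd. u i * ip d w (X i))" using z unfolding split by simp
    finally have "mG * g = (\<Sum>i\<in>G. u i * ip d w (Y i)) + (\<Sum>i\<in>Bd. u i * ip d w (X i))" by simp
    then have "(mG * g)\<^sup>2 \<le> 2 * (\<Sum>i\<in>G. u i * ip d w (Y i))\<^sup>2 + 2 * (\<Sum>i\<in>Bd. u i * ip d w (X i))\<^sup>2"
      using sum_squares_bound[of "\<Sum>i\<in>G. u i * ip d w (Y i)" "\<Sum>i\<in>Bd. u i * ip d w (X i)"]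
      by (simp add: power2_sum)
    also have "\<dots> \<le> 2 * (mG * (\<Sum>i\<in>G. u i * (ip d w (Y i))\<^sup>2)) + 2 * (mB * (\<Sum>i\<in>Bd. u i * (ip d w (X i))\<^sup>2))"
      unfolding mG_def mB_def using uG uB by (intro add_mono mult_left_mono weighted_cauchy_schwarz) auto
    finally show ?thesis unfolding g_def by (simp add: power_mult_distrib)
  qed
  have "mG\<^sup>2 * Q (\<lambda>j. wmean k z u j - \<mu> j) = (\<Sum>s\<in>J. mG\<^sup>2 * (ip d (v s) (\<lambda>j. wmean k z u j - \<mu> j))\<^sup>2)"
    by (simp add: Q_def sum_distrib_left)
  also have "\<dots> \<le> (\<Sum>s\<in>J. 2 * mG * (\<Sum>i\<in>G. u i * (ip d (v s) (Y i))\<^sup>2) + 2 * mB * (\<Sum>i\<in>Bd. u i * (ip d (v s) (X i))\<^sup>2))"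
    by (intro sum_mono one)
  also have "\<dots> = 2 * mG * (\<Sum>i\<in>G. u i * Q (Y i)) + 2 * mB * (\<Sum>i\<in>Bd. u i * Q (X i))"
  proof -
    have "(\<Sum>s\<in>J. \<Sum>i\<in>I. u i * (ip d (v s) (f i))\<^sup>2) = (\<Sum>i\<in>I. u i * Q (f i))" for I f
      unfolding Q_def sum_distrib_left by (rule sum.swap)
    then show ?thesis unfolding sum.distrib sum_distrib_left[symmetric] by simp
  qed
  also have "\<dots> \<le> 2 * mG * (mG * (r\<^sup>2 * T)) + 2 * (real k / 100) * \<phi>"
  proof (intro add_mono mult_mono mult_left_mono)
    have "(\<Sum>i\<in>G. u i * Q (Y i)) \<le> (\<Sum>i\<in>G. u i * (r\<^sup>2 * T))"
      using uG unfolding G_def Bd_def by (intro sum_mono mult_left_mono) auto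
    then show "(\<Sum>i\<in>G. u i * Q (Y i)) \<le> mG * (r\<^sup>2 * T)" by (simp add: mG_def sum_distrib_right)
    show "(\<Sum>i\<in>Bd. u i * Q (X i)) \<le> \<phi>"
      unfolding \<phi>_def split using uG Qn by (simp add: sum_nonneg)
  qed (use mB mGpos uB uG Qn in \<open>auto intro!: sum_nonneg\<close>)
  finally have main: "mG\<^sup>2 * Q (\<lambda>j. wmean k z u j - \<mu> j) \<le> mG\<^sup>2 * (2 * r\<^sup>2 * T) + real k / 50 * \<phi>"
    by (simp add: power2_eq_square algebra_simps)
  \<comment> \<open>The constant 31 comes from \<open>(4/5 - 1/100)\<^sup>2 / (2/100) \<ge> 31\<close>.\<close>
  have "(79 / 100 * real k)\<^sup>2 \<le> mG\<^sup>2" using mG by (intro power_mono) auto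
  then have "6241 / 10000 * (real k * real k) \<le> mG\<^sup>2" by (simp add: power2_eq_square)
  then have "31 / 50 * (real k * real k) \<le> mG\<^sup>2"
    using zero_le_square[of "real k"] by linarith
  then have "31 / 50 * (real k * real k) * (\<phi> / (31 * real k)) \<le> mG\<^sup>2 * (\<phi> / (31 * real k))"
    using \<phi>n by (intro mult_right_mono) auto
  then have "real k / 50 * \<phi> \<le> mG\<^sup>2 * (\<phi> / (31 * real k))" using k by (simp add: field_simps)
  with main have "mG\<^sup>2 * Q (\<lambda>j. wmean k z u j - \<mu> j) \<le> mG\<^sup>2 * (\<phi> / (31 * real k) + 2 * r\<^sup>2 * T)"
    by (simp add: algebra_simps)
  then have "Q (\<lambda>j. wmean k z u j - \<mu> j) \<le> \<phi> / (31 * real k) + 2 * r\<^sup>2 * T"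
    using mGpos by simp
  then show ?thesis unfolding \<phi>_def Q_def X_def T_def .
qed

section \<open>Coordinatewise median and pruning\<close>

definition coord_median :: "nat \<Rightarrow> nat \<Rightarrow> (nat \<Rightarrow> nat \<Rightarrow> real) \<Rightarrow> (nat \<Rightarrow> real) \<Rightarrow> bool" where
  "coord_median d k z c \<longleftrightarrow> (\<forall>j<d.
     2 * card {l. l < k \<and> z l j < c j} \<le> k \<and> 2 * card {l. l < k \<and> c j < z l j} \<le> k)"

definition sqdist :: "nat \<Rightarrow> (nat \<Rightarrow> nat \<Rightarrow> real) \<Rightarrow> (nat \<Rightarrow> real) \<Rightarrow> nat \<Rightarrow> real" where
  "sqdist d z c i = (\<Sum>j<d. (z i j - c j)\<^sup>2)"

definition prune :: "nat \<Rightarrow> (nat \<Rightarrow> real) \<Rightarrow> nat \<Rightarrow> real" where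
  "prune k D i = (if 100 * card {l. l < k \<and> D l < D i} < 99 * k then 1 else 0)"

text \<open>
  The smallest value with at most half of the values above it: the next smaller value has more than half
  above it, so at most half are below.
\<close>

lemma median_exists:
  fixes a :: "nat \<Rightarrow> real"
  assumes "k > 0"
  shows "\<exists>i<k. 2 * card {l. l < k \<and> a l < a i} \<le> k \<and> 2 * card {l. l < k \<and> a i < a l} \<le> k"
proof -
  define S where "S = {i. i < k \<and> 2 * card {l. l < k \<and> a i < a l} \<le> k}"
  have "Max (a ` {..<k}) \<in> a ` {..<k}" using assms by (intro Max_in) auto
  then obtain im where im: "im < k" "\<And>l. l < k \<Longrightarrow> a l \<le> a im"
    by (metis (no_types, lifting) Max_ge finite_imageI finite_lessThan imageE imageI lessThan_iff)
  then have none: "{l. l < k \<and> a im < a l} = {}" by force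
  have "im \<in> S" unfolding S_def mem_Collect_eq none using im(1) by simp
  moreover have fin: "finite S" unfolding S_def by simp
  ultimately have "Min (a ` S) \<in> a ` S" by (intro Min_in) auto
  then obtain i where i: "i \<in> S" "\<And>l. l \<in> S \<Longrightarrow> a i \<le> a l"
    using fin by (metis (no_types, lifting) Min_le finite_imageI imageE imageI)
  define L where "L = {l. l < k \<and> a l < a i}"
  have "2 * card L \<le> k"
  proof (cases "L = {}")
    case False
    have finL: "finite L" unfolding L_def by simp
    then have "Max (a ` L) \<in> a ` L" using False by (intro Max_in) auto
    then obtain j where j: "j \<in> L" "\<And>l. l \<in> L \<Longrightarrow> a l \<le> a j"
      using finL by (metis (no_types, lifting) Max_ge finite_imageI imageE imageI)
    have "j \<notin> S" using i(2)[of j] j(1) unfolding L_def by force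
    then have gt: "k < 2 * card {l. l < k \<and> a j < a l}" using j(1) unfolding S_def L_def by simp
    have "L \<inter> {l. l < k \<and> a j < a l} = {}" using j(2) by force
    then have "card L + card {l. l < k \<and> a j < a l} = card (L \<union> {l. l < k \<and> a j < a l})"
      using finL by (subst card_Un_disjoint) auto
    also have "\<dots> \<le> card {..<k}" by (intro card_mono) (auto simp: L_def)
    finally show ?thesis using gt by simp
  qed simp
  then show ?thesis using i(1) unfolding S_def L_def by blast
qed

text \<open>
  If some point is discarded, the nearest discarded one has at least 99 percent of the points strictly
  nearer, and these are all kept.
\<close>

lemma prune_mass:
  assumes "k > 0"
  shows "99 * real k \<le> 100 * wmass k (prune k D)"
proof -
  define K where "K = {i. i < k \<and> prune k D i = 1}"
  have w: "wmass k (prune k D) = real (card K)"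
  proof -
    have "wmass k (prune k D) = (\<Sum>i\<in>K. 1)"
      unfolding wmass_def by (rule sum.mono_neutral_cong_right) (auto simp: K_def prune_def)
    then show ?thesis by simp
  qed
  have "99 * k \<le> 100 * card K"
  proof (cases "K = {..<k}")
    case False
    define N where "N = {..<k} - K"
    have N: "finite N" "N \<noteq> {}" unfolding N_def using False by (auto simp: K_def)
    then have "Min (D ` N) \<in> D ` N" by (intro Min_in) auto
    then obtain i where i: "i \<in> N" "\<And>l. l \<in> N \<Longrightarrow> D i \<le> D l"
      using N(1) by (metis (no_types, lifting) Min_le finite_imageI imageE imageI)
    have "99 * k \<le> 100 * card {l. l < k \<and> D l < D i}"
      using i(1) unfolding N_def K_def prune_def by (auto split: if_splits)
    also have "card {l. l < k \<and> D l < D i} \<le> card K"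
      using i(2) by (intro card_mono) (force simp: K_def N_def)+
    finally show ?thesis by simp
  qed simp
  then show ?thesis unfolding w by (metis of_nat_le_iff of_nat_mult of_nat_numeral)
qed

lemma dispersedD:
  assumes "dispersed d k z \<mu> r" "finite (J :: (nat \<times> nat) set)"
  shows "99 * real k \<le> 100 * real (card {i. i < k \<and>
    (\<Sum>s\<in>J. (ip d (v s) (\<lambda>j. z i j - \<mu> j))\<^sup>2) \<le> r\<^sup>2 * (\<Sum>s\<in>J. ip d (v s) (v s))})"
    (is "_ \<le> 100 * real (card ?G)")
proof -
  let ?B = "{i. i < k \<and> r\<^sup>2 * (\<Sum>s\<in>J. ip d (v s) (v s)) < (\<Sum>s\<in>J. (ip d (v s) (\<lambda>j. z i j - \<mu> j))\<^sup>2)}"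
  have "card ?B + card ?G = card (?B \<union> ?G)" by (rule card_Un_disjoint[symmetric]) auto
  also have "?B \<union> ?G = {..<k}" by auto
  finally have "card ?B + card ?G = k" by simp
  moreover have "real (card ?B) \<le> real k / 100" using assms unfolding dispersed_def by blast
  ultimately show ?thesis by simp
qed

lemma coord_median_close:
  assumes disp: "dispersed d k z \<mu> r" and r: "0 \<le> r" and k: "k > 0" and c: "coord_median d k z c" and j: "j < d"
  shows "\<bar>c j - \<mu> j\<bar> \<le> r"
proof -
  define G where "G = {i. i < k \<and> (z i j - \<mu> j)\<^sup>2 \<le> r\<^sup>2}"
  have "ip d (unit_vec j) y = y j" for y using j ip_unit_vec[of j d y] by (simp add: ip_commute)
  then have "99 * real k \<le> 100 * real (card G)"
    using dispersedD[OF disp, of "{(0,0)}" "\<lambda>_. unit_vec j"] by (simp add: G_def unit_vec_def)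
  then have G: "card G + card G > k" using k by linarith
  have in_G: "\<bar>z i j - \<mu> j\<bar> \<le> r" if "i \<in> G" for i
    using that r abs_le_square_iff[of "z i j - \<mu> j" r] unfolding G_def by simp
  show ?thesis
  proof (rule ccontr)
    assume "\<not> \<bar>c j - \<mu> j\<bar> \<le> r"
    then consider "c j > \<mu> j + r" | "c j < \<mu> j - r" by linarith
    then show False
    proof cases
      case 1
      have "card G \<le> card {l. l < k \<and> z l j < c j}"
        using in_G 1 by (intro card_mono) (force simp: G_def)+
      then show False using c j G unfolding coord_median_def by fastforce
    next
      case 2
      have "card G \<le> card {l. l < k \<and> c j < z l j}"
        using in_G 2 by (intro card_mono) (force simp: G_def)+
      then show False using c j G unfolding coord_median_def by fastforce
    qed
  qed
qed

text \<open>
  Applied to the family of all unit vectors, \<open>dispersed\<close> says that all but one percent of the points are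
  within \<open>r \<surd>d\<close> of \<open>\<mu>\<close>. These are near the median, and a kept point cannot be farther from it than all of them.
\<close>

lemma prune_radius:
  assumes disp: "dispersed d k z \<mu> r" and r: "0 \<le> r" and k: "k > 0" and c: "coord_median d k z c"
    and i: "i < k" "prune k (sqdist d z c) i \<noteq> 0"
  shows "sqdist d z c i \<le> 4 * real d * r\<^sup>2"
proof -
  define G where "G = {i. i < k \<and> (\<Sum>j<d. (z i j - \<mu> j)\<^sup>2) \<le> r\<^sup>2 * real d}"
  have e: "(\<Sum>s\<in>{0}\<times>{..<d}. f (snd s)) = (\<Sum>j<d. f j)" for f :: "nat \<Rightarrow> real"
    by (rule sum.reindex_bij_witness[of _ "\<lambda>j. (0, j)" snd]) auto
  have u: "ip d (unit_vec j) y = y j" if "j < d" for y j using that ip_unit_vec[of j d y] by (simp add: ip_commute)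
  have "99 * real k \<le> 100 * real (card G)"
  proof -
    have "(\<Sum>j<d. (ip d (unit_vec j) y)\<^sup>2) = (\<Sum>j<d. (y j)\<^sup>2)" for y by (simp add: u)
    moreover have "(\<Sum>j<d. ip d (unit_vec j) (unit_vec j)) = real d" by (simp add: u) (simp add: unit_vec_def)
    ultimately show ?thesis
      using dispersedD[OF disp, of "{0} \<times> {..<d}" "\<lambda>s. unit_vec (snd s)"] unfolding G_def
      by (simp add: e[of "\<lambda>j. (ip d (unit_vec j) _)\<^sup>2"] e[of "\<lambda>j. ip d (unit_vec j) (unit_vec j)"])
  qed
  then have cG: "99 * k \<le> 100 * card G" by linarith
  have gd: "sqdist d z c l \<le> 4 * real d * r\<^sup>2" if "l \<in> G" for l
  proof -
    have "sqdist d z c l \<le> (\<Sum>j<d. 2 * (z l j - \<mu> j)\<^sup>2 + 2 * r\<^sup>2)"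
      unfolding sqdist_def
    proof (rule sum_mono)
      fix j assume "j \<in> {..<d}"
      then have "\<bar>c j - \<mu> j\<bar> \<le> r" using coord_median_close[OF disp r k c] by simp
      then have "(c j - \<mu> j)\<^sup>2 \<le> r\<^sup>2" using abs_le_square_iff[of "c j - \<mu> j" r] r by simp
      moreover have "(z l j - c j)\<^sup>2 \<le> 2 * (z l j - \<mu> j)\<^sup>2 + 2 * (c j - \<mu> j)\<^sup>2"
        using zero_le_power2[of "(z l j - \<mu> j) + (c j - \<mu> j)"] by (simp add: power2_eq_square algebra_simps)
      ultimately show "(z l j - c j)\<^sup>2 \<le> 2 * (z l j - \<mu> j)\<^sup>2 + 2 * r\<^sup>2" by simp
    qed
    also have "\<dots> = 2 * (\<Sum>j<d. (z l j - \<mu> j)\<^sup>2) + 2 * real d * r\<^sup>2"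
      by (simp add: sum.distrib sum_distrib_left)
    also have "\<dots> \<le> 4 * real d * r\<^sup>2" using that unfolding G_def by (simp add: mult.commute)
    finally show ?thesis .
  qed
  show ?thesis
  proof (rule ccontr)
    assume "\<not> ?thesis"
    then have "card G \<le> card {l. l < k \<and> sqdist d z c l < sqdist d z c i}"
      using gd by (intro card_mono) (force simp: G_def)+
    then show False using cG i(2) unfolding prune_def by (auto split: if_splits)
  qed
qed

section \<open>Correctness of the iterated filter\<close>

definition admissible :: "nat \<Rightarrow> (nat \<Rightarrow> real) \<Rightarrow> bool" where
  "admissible k u \<longleftrightarrow> (\<forall>i<k. 0 \<le> u i \<and> u i \<le> 1) \<and> 4 * real k \<le> 5 * wmass k u"

definition potential :: "nat \<Rightarrow> nat \<Rightarrow> nat \<Rightarrow> (nat \<Rightarrow> nat \<Rightarrow> real) \<Rightarrow> (nat \<Rightarrow> real) \<Rightarrow> real" where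
  "potential d k m z u = wsum k u (scores d k m z u)"

definition score_row :: "nat \<Rightarrow> nat \<Rightarrow> nat \<Rightarrow> (nat \<Rightarrow> nat \<Rightarrow> real) \<Rightarrow> (nat \<Rightarrow> real) \<Rightarrow> nat \<Rightarrow> nat \<Rightarrow> real" where
  "score_row d k m z u j = (wcov d k z u ^^ m) (unit_vec j)"

definition score_trace :: "nat \<Rightarrow> nat \<Rightarrow> nat \<Rightarrow> (nat \<Rightarrow> nat \<Rightarrow> real) \<Rightarrow> (nat \<Rightarrow> real) \<Rightarrow> real" where
  "score_trace d k m z u = (\<Sum>j<d. ip d (score_row d k m z u j) (score_row d k m z u j))"

definition wquad :: "nat \<Rightarrow> nat \<Rightarrow> (nat \<Rightarrow> nat \<Rightarrow> real) \<Rightarrow> (nat \<Rightarrow> real) \<Rightarrow> (nat \<Rightarrow> real) \<Rightarrow> real" where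
  "wquad d k z u v = (\<Sum>i<k. u i * (ip d (centered k z u i) v)\<^sup>2)"

lemma admissible_pos: "k > 0 \<Longrightarrow> admissible k u \<Longrightarrow> 0 < wmass k u"
  unfolding admissible_def by auto

lemma admissibleD: "admissible k u \<Longrightarrow> i < k \<Longrightarrow> 0 \<le> u i" "admissible k u \<Longrightarrow> i < k \<Longrightarrow> u i \<le> 1"
  unfolding admissible_def by auto

lemma scores_nonneg: "0 \<le> scores d k m z u i"
  unfolding scores_def power_score_def by (rule ip_nonneg)

lemma admissible_eigenbasis:
  assumes "admissible k u"
  obtains E lam where "is_eigenbasis d (wcov d k z u) E lam"
  using covop_eigenbasis[of k u d "centered k z u"] admissibleD(1)[OF assms] unfolding wcov_def by blast

lemma power_score_rows:
  assumes "admissible k u"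
  shows "power_score d k m z u y = (\<Sum>j<d. (ip d (score_row d k m z u j) y)\<^sup>2)"
proof -
  obtain E lam where "is_eigenbasis d (wcov d k z u) E lam" using admissible_eigenbasis[OF assms] .
  from eig_pow_rows[OF this] show ?thesis unfolding power_score_def score_row_def .
qed

lemma admissible_filter_step:
  assumes "k > 0" "admissible k u"
  shows "admissible k (filter_step d k m z u)" and "\<And>i. i < k \<Longrightarrow> filter_step d k m z u i \<le> u i"
proof -
  let ?u' = "downweight k u (scores d k m z u)"
  have D: "0 \<le> ?u' i" "?u' i \<le> u i" if "i < k" for i
    using downweight_props(1,2)[of k u "scores d k m z u" i] admissibleD[OF assms(2)] scores_nonneg assms(1) that
    by auto
  then show "admissible k (filter_step d k m z u)" and "\<And>i. i < k \<Longrightarrow> filter_step d k m z u i \<le> u i"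
    using assms(2) unfolding filter_step_def admissible_def Let_def by (auto intro: order_trans)
qed

text \<open>
  Three comparisons: Peierls' inequality replaces the new operator in the scores by the old one, the
  minimality of the weighted mean replaces the new centre by the old one, and the choice of the
  threshold bounds what is left by half of the old potential.
\<close>

lemma potential_downweight:
  assumes k: "k > 0" and u: "admissible k u"
    and acc: "4 * real k \<le> 5 * wmass k (downweight k u (scores d k m z u))"
  shows "2 * potential d k m z (filter_step d k m z u) \<le> potential d k m z u"
proof -
  define q where "q = scores d k m z u"
  define u' where "u' = downweight k u q"
  have eq: "filter_step d k m z u = u'" using acc by (simp add: filter_step_def Let_def u'_def q_def)
  have u': "admissible k u'" using admissible_filter_step(1)[OF k u, of d m z] unfolding eq .
  have le: "u' i \<le> u i" if "i < k" for i using admissible_filter_step(2)[OF k u that, of d m z] unfolding eq .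
  have "potential d k m z u' = (\<Sum>l<k. u' l * ip d ((covop d k u' (centered k z u') ^^ m) (centered k z u' l))
      ((covop d k u' (centered k z u') ^^ m) (centered k z u' l)))"
    by (simp add: potential_def wsum_def scores_def power_score_def wcov_def)
  also have "\<dots> \<le> (\<Sum>l<k. u' l * ip d ((covop d k u (centered k z u) ^^ m) (centered k z u' l))
      ((covop d k u (centered k z u) ^^ m) (centered k z u' l)))"
  proof (rule peierls)
    show "(\<Sum>l<k. u' l * (ip d (centered k z u' l) v)\<^sup>2) \<le> (\<Sum>l<k. u l * (ip d (centered k z u l) v)\<^sup>2)" for v
      using centered_quad_mono[OF admissible_pos[OF k u'] le, of d v z] by (simp add: ip_commute)
  qed (use admissibleD(1)[OF u] admissibleD(1)[OF u'] in auto)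
  also have "\<dots> = (\<Sum>l<k. \<Sum>j<d. u' l * (ip d (score_row d k m z u j) (centered k z u' l))\<^sup>2)"
    using power_score_rows[OF u, of d m z] by (simp add: power_score_def wcov_def sum_distrib_left)
  also have "\<dots> = (\<Sum>j<d. \<Sum>l<k. u' l * (ip d (score_row d k m z u j) (centered k z u' l))\<^sup>2)"
    by (rule sum.swap)
  also have "\<dots> \<le> (\<Sum>j<d. \<Sum>l<k. u' l * (ip d (score_row d k m z u j) (centered k z u l))\<^sup>2)"
    using centered_quad_le[OF admissible_pos[OF k u'], of d _ z "wmean k z u", folded centered_def]
    by (rule sum_mono)
  also have "\<dots> = (\<Sum>l<k. \<Sum>j<d. u' l * (ip d (score_row d k m z u j) (centered k z u l))\<^sup>2)"
    by (rule sum.swap)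
  also have "\<dots> = wsum k u' q"
    by (simp add: wsum_def q_def scores_def power_score_rows[OF u] sum_distrib_left)
  finally have "2 * potential d k m z u' \<le> 2 * wsum k u' q" by simp
  also have "\<dots> \<le> wsum k u q"
    unfolding u'_def using admissibleD(1)[OF u] scores_nonneg k
    by (intro downweight_props(4)) (auto simp: q_def)
  finally show ?thesis unfolding eq by (simp add: potential_def q_def)
qed

lemma potential_eq_eigenvalues:
  assumes "admissible k u" "is_eigenbasis d (wcov d k z u) E lam"
  shows "potential d k m z u = (\<Sum>a<d. lam a ^ (2 * m + 1))"
  using covop_potential[OF assms(2)[unfolded wcov_def], of m]
  by (simp add: potential_def wsum_def scores_def power_score_def wcov_def)

lemma wquad_le_of_score:
  assumes u: "admissible k u" and d: "d \<le> 4 ^ m" and c: "0 \<le> c"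
    and le: "potential d k m z u \<le> c * score_trace d k m z u"
  shows "wquad d k z u v \<le> 3 * c * ip d v v"
proof -
  obtain E lam where E: "is_eigenbasis d (wcov d k z u) E lam" using admissible_eigenbasis[OF u] .
  have "score_trace d k m z u = (\<Sum>a<d. lam a ^ (2 * m))"
    unfolding score_trace_def score_row_def by (rule eig_trace[OF E])
  then have "lam a \<le> 3 * c" if "a < d" for a
    using le eig_nonneg[OF E] d c that unfolding potential_eq_eigenvalues[OF u E]
    by (intro eigenvalues_le_of_potential_le) auto
  then show ?thesis unfolding wquad_def by (rule covop_quad_le[OF E[unfolded wcov_def]])
qed

lemma wquad_le_of_potential:
  assumes u: "admissible k u" and b: "0 \<le> b" and le: "potential d k m z u \<le> b ^ (2 * m + 1)"
  shows "wquad d k z u v \<le> b * ip d v v"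
proof -
  obtain E lam where E: "is_eigenbasis d (wcov d k z u) E lam" using admissible_eigenbasis[OF u] .
  have "lam a \<le> b" if "a < d" for a
  proof -
    have "lam a ^ (2 * m + 1) \<le> (\<Sum>a<d. lam a ^ (2 * m + 1))"
      using that eig_nonneg[OF E] by (intro member_le_sum) auto
    also have "\<dots> \<le> b ^ (2 * m + 1)" using le unfolding potential_eq_eigenvalues[OF u E] .
    finally have "lam a ^ Suc (2 * m) \<le> b ^ Suc (2 * m)" by simp
    then show ?thesis using b by (rule power_le_imp_le_base)
  qed
  then show ?thesis unfolding wquad_def by (rule covop_quad_le[OF E[unfolded wcov_def]])
qed

lemma potential_le_of_wquad:
  assumes u: "admissible k u" and le: "\<And>v. wquad d k z u v \<le> b * ip d v v"
  shows "potential d k m z u \<le> real d * b ^ (2 * m + 1)"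
proof -
  obtain E lam where E: "is_eigenbasis d (wcov d k z u) E lam" using admissible_eigenbasis[OF u] .
  have "lam a \<le> b" if "a < d" for a
    using covop_quad_eig[OF E[unfolded wcov_def] that] le[of "E a"] eig_self[OF E that that] unfolding wquad_def by simp
  then have "(\<Sum>a<d. lam a ^ (2 * m + 1)) \<le> (\<Sum>a<d. b ^ (2 * m + 1))"
    using eig_nonneg[OF E] by (intro sum_mono power_mono) auto
  then show ?thesis unfolding potential_eq_eigenvalues[OF u E] by simp
qed

lemma wquad_mono:
  assumes "k > 0" "admissible k u'" "\<And>i. i < k \<Longrightarrow> u' i \<le> u i"
  shows "wquad d k z u' v \<le> wquad d k z u v"
  using centered_quad_mono[OF admissible_pos[OF assms(1,2)] assms(3), of d v z]
  unfolding wquad_def by (simp add: ip_commute)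

text \<open>
  The loss \<open>\<Sum>\<^sub>s q\<^sub>s / \<tau>\<^sub>s\<close> of weight at a point is controlled by one quadratic form, assembled from the score
  forms of all rounds with the factors \<open>1 / \<tau>\<^sub>s\<close>. Since a step removes mass at least \<open>\<phi>\<^sub>s / (2 \<tau>\<^sub>s)\<close>, the sum of
  \<open>\<phi>\<^sub>s / \<tau>\<^sub>s\<close> is at most \<open>2 k\<close>; together with the lower bound on the potentials this bounds the trace of the
  form, and \<open>dispersed\<close> bounds its values at all but one percent of the points. The displacement of the
  centres is absorbed by \<open>wmean_shift\<close>.
\<close>

lemma step_accepted:
  fixes U :: "nat \<Rightarrow> nat \<Rightarrow> real"
  assumes disp: "dispersed d k z \<mu> r" and k: "k > 0"
    and adm: "\<And>s. s \<le> t \<Longrightarrow> admissible k (U s)"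
    and large: "\<And>s. s \<le> t \<Longrightarrow> 1000 * real k * r\<^sup>2 * score_trace d k m z (U s) \<le> potential d k m z (U s)"
    and step: "\<And>s. s < t \<Longrightarrow> U (Suc s) = downweight k (U s) (scores d k m z (U s))"
    and init: "99 * real k \<le> 100 * wmass k (U 0)"
  shows "4 * real k \<le> 5 * wmass k (downweight k (U t) (scores d k m z (U t)))"
proof -
  define q where "q s = scores d k m z (U s)" for s
  define W where "W s = downweight k (U s) (q s)" for s
  define \<tau> where "\<tau> s = threshold k (U s) (q s)" for s
  define \<phi> where "\<phi> s = potential d k m z (U s)" for s
  define P where "P s = power_score d k m z (U s)" for s
  define Tr where "Tr s = score_trace d k m z (U s)" for s
  have qn: "0 \<le> q s i" for s i unfolding q_def by (rule scores_nonneg)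
  have un: "0 \<le> U s i" "U s i \<le> 1" if "s \<le> t" "i < k" for s i using adm[OF that(1)] that(2) admissibleD by auto
  have \<tau>n: "0 \<le> \<tau> s" if "s \<le> t" for s
    unfolding \<tau>_def using threshold_props(1)[of k "U s" "q s"] un that qn k by auto
  have W1: "0 \<le> W s i" "W s i \<le> U s i" "U s i - q s i / \<tau> s \<le> W s i" if "s \<le> t" "i < k" for s i
    unfolding W_def \<tau>_def using downweight_props(1-3)[of k "U s" "q s" i] un that qn k by auto
  have W2: "\<phi> s / \<tau> s \<le> 2 * (wmass k (U s) - wmass k (W s))" if "s \<le> t" for s
    unfolding W_def \<tau>_def \<phi>_def potential_def q_def[symmetric]
    using downweight_props(5)[of k "U s" "q s"] un that qn k by auto
  have UW: "U (Suc s) = W s" if "s < t" for s using step[OF that] by (simp add: W_def q_def)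
  have "s \<le> t \<Longrightarrow> (\<Sum>s'<s. \<phi> s' / \<tau> s') \<le> 2 * (wmass k (U 0) - wmass k (U s))" for s
  proof (induction s)
    case (Suc s)
    then show ?case using W2[of s] UW[of s] by simp
  qed simp
  from this[of t] W2[of t] have S0: "(\<Sum>s\<le>t. \<phi> s / \<tau> s) \<le> 2 * (wmass k (U 0) - wmass k (W t))"
    by (simp add: lessThan_Suc_atMost[symmetric])
  have "0 \<le> wmass k (W t)" unfolding wmass_def using W1(1)[of t] by (auto intro: sum_nonneg)
  moreover have "wmass k (U 0) \<le> real k"
    unfolding wmass_def using un(2)[of 0] sum_mono[of "{..<k}" "U 0" "\<lambda>_. 1"] by simp
  ultimately have "2 * (wmass k (U 0) - wmass k (W t)) \<le> 2 * real k" by simp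
  with S0 have S: "(\<Sum>s\<le>t. \<phi> s / \<tau> s) \<le> 2 * real k" by (rule order_trans)
  have R: "s \<le> t \<Longrightarrow> i < k \<Longrightarrow> U 0 i - (\<Sum>s'<s. q s' i / \<tau> s') \<le> U s i" for s i
  proof (induction s)
    case (Suc s)
    then show ?case using W1(3)[of s i] UW[of s] by simp
  qed simp
  have retain: "U 0 i - (\<Sum>s\<le>t. q s i / \<tau> s) \<le> W t i" if "i < k" for i
    using R[of t i] W1(3)[of t i] that by (simp add: lessThan_Suc_atMost[symmetric])
  \<comment> \<open>If \<open>\<tau> s = 0\<close> then the score is 0 at every point of positive weight, and division by 0 drops the round from the family.\<close>
  define J where "J = {..t} \<times> {..<d}"
  define v where "v = (\<lambda>(s, j) c. score_row d k m z (U s) j c / sqrt (\<tau> s))"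
  have ipv: "(ip d (v (s, j)) y)\<^sup>2 = (ip d (score_row d k m z (U s) j) y)\<^sup>2 / \<tau> s" if "s \<le> t" for s j y
    using \<tau>n[OF that] by (simp add: v_def ip_commute[of d _ y] ip_divide_right power_divide)
  have JQ: "(\<Sum>sj\<in>J. (ip d (v sj) y)\<^sup>2) = (\<Sum>s\<le>t. P s y / \<tau> s)" for y
  proof -
    have "(\<Sum>sj\<in>J. (ip d (v sj) y)\<^sup>2) = (\<Sum>s\<le>t. \<Sum>j<d. (ip d (v (s, j)) y)\<^sup>2)"
      unfolding J_def by (simp add: sum.cartesian_product)
    also have "\<dots> = (\<Sum>s\<le>t. P s y / \<tau> s)"
      using adm by (intro sum.cong refl) (simp add: ipv P_def power_score_rows sum_divide_distrib)
    finally show ?thesis .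
  qed
  have ipvv: "ip d (v (s, j)) (v (s, j)) = ip d (score_row d k m z (U s) j) (score_row d k m z (U s) j) / \<tau> s"
    if "s \<le> t" for s j
    using \<tau>n[OF that] unfolding ip_def v_def by (simp add: sum_divide_distrib)
  have JT: "(\<Sum>sj\<in>J. ip d (v sj) (v sj)) = (\<Sum>s\<le>t. Tr s / \<tau> s)"
  proof -
    have "(\<Sum>sj\<in>J. ip d (v sj) (v sj)) = (\<Sum>s\<le>t. \<Sum>j<d. ip d (v (s, j)) (v (s, j)))"
      unfolding J_def by (simp add: sum.cartesian_product)
    also have "\<dots> = (\<Sum>s\<le>t. Tr s / \<tau> s)"
      by (intro sum.cong refl) (simp add: ipvv Tr_def score_trace_def sum_divide_distrib)
    finally show ?thesis .
  qed
  have "1000 * real k * (r\<^sup>2 * (\<Sum>s\<le>t. Tr s / \<tau> s)) = (\<Sum>s\<le>t. (1000 * real k * r\<^sup>2 * Tr s) / \<tau> s)"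
    by (simp add: sum_distrib_left mult.assoc)
  also have "\<dots> \<le> (\<Sum>s\<le>t. \<phi> s / \<tau> s)"
    using large \<tau>n unfolding \<phi>_def Tr_def by (intro sum_mono divide_right_mono) auto
  finally have rT: "r\<^sup>2 * (\<Sum>s\<le>t. Tr s / \<tau> s) \<le> 1 / 500"
  proof -
    assume "1000 * real k * (r\<^sup>2 * (\<Sum>s\<le>t. Tr s / \<tau> s)) \<le> (\<Sum>s\<le>t. \<phi> s / \<tau> s)"
    with S have "real k * (1000 * (r\<^sup>2 * (\<Sum>s\<le>t. Tr s / \<tau> s))) \<le> real k * 2" by simp
    then have "1000 * (r\<^sup>2 * (\<Sum>s\<le>t. Tr s / \<tau> s)) \<le> 2" using k by (subst (asm) mult_le_cancel_left_pos) auto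
    then show ?thesis by simp
  qed
  define Y where "Y i = (\<lambda>j. z i j - \<mu> j)" for i
  define e where "e s = (\<lambda>j. wmean k z (U s) j - \<mu> j)" for s
  define G where "G = {i. i < k \<and> (\<Sum>s\<le>t. P s (Y i) / \<tau> s) \<le> r\<^sup>2 * (\<Sum>s\<le>t. Tr s / \<tau> s)}"
  have cG: "99 * real k \<le> 100 * real (card G)"
    using dispersedD[OF disp, of J v] unfolding G_def JQ JT Y_def by (simp add: J_def)
  have shift: "P s (e s) \<le> \<phi> s / (31 * real k) + 2 * r\<^sup>2 * Tr s" if s: "s \<le> t" for s
  proof -
    let ?J = "{0::nat} \<times> {..<d}" and ?v = "\<lambda>sj. score_row d k m z (U s) (snd sj)"
    have J: "(\<Sum>sj\<in>?J. f (snd sj)) = (\<Sum>j<d. f j)" for f :: "nat \<Rightarrow> real"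
      by (rule sum.reindex_bij_witness[of _ "\<lambda>j. (0, j)" snd]) auto
    have Q: "(\<Sum>sj\<in>?J. (ip d (?v sj) y)\<^sup>2) = P s y" for y
      unfolding P_def power_score_rows[OF adm[OF s]] by (rule J)
    have "(\<Sum>sj\<in>?J. ip d (?v sj) (?v sj)) = Tr s"
      unfolding Tr_def score_trace_def by (rule J)
    with wmean_shift[OF disp, of ?J "U s" ?v] k un[OF s] adm[OF s]
    show ?thesis unfolding Q by (simp add: e_def admissible_def \<phi>_def potential_def wsum_def scores_def P_def)
  qed
  have "(\<Sum>s\<le>t. P s (e s) / \<tau> s) \<le> (\<Sum>s\<le>t. (\<phi> s / \<tau> s) / (31 * real k) + 2 * r\<^sup>2 * (Tr s / \<tau> s))"
  proof (rule sum_mono)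
    fix s assume "s \<in> {..t}"
    then have "P s (e s) / \<tau> s \<le> (\<phi> s / (31 * real k) + 2 * r\<^sup>2 * Tr s) / \<tau> s"
      using shift \<tau>n by (intro divide_right_mono) auto
    then show "P s (e s) / \<tau> s \<le> (\<phi> s / \<tau> s) / (31 * real k) + 2 * r\<^sup>2 * (Tr s / \<tau> s)"
      by (simp add: add_divide_distrib mult_ac)
  qed
  also have "\<dots> = (\<Sum>s\<le>t. \<phi> s / \<tau> s) / (31 * real k) + 2 * (r\<^sup>2 * (\<Sum>s\<le>t. Tr s / \<tau> s))"
    by (simp add: sum.distrib sum_divide_distrib sum_distrib_left mult.assoc)
  also have "\<dots> \<le> 2 * real k / (31 * real k) + 2 * (1 / 500)"
    using S rT by (intro add_mono divide_right_mono mult_left_mono) auto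
  also have "\<dots> = 2 / 31 + 1 / 250" using k by simp
  finally have E: "(\<Sum>s\<le>t. P s (e s) / \<tau> s) \<le> 2 / 31 + 1 / 250" .
  \<comment> \<open>\<open>6/500 + 4/31 \<le> 3/20\<close>, which leaves \<open>98/100 - 3/20 \<ge> 4/5\<close> of the mass.\<close>
  have small: "(\<Sum>s\<le>t. q s i / \<tau> s) \<le> 3 / 20" if "i \<in> G" for i
  proof -
    have "q s i \<le> 2 * P s (Y i) + 2 * P s (e s)" if "s \<le> t" for s
    proof -
      have "q s i = (\<Sum>j<d. (ip d (score_row d k m z (U s) j) (Y i) - ip d (score_row d k m z (U s) j) (e s))\<^sup>2)"
        unfolding q_def scores_def power_score_rows[OF adm[OF that]]
        by (simp add: centered_def Y_def e_def ip_diff_right)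
      also have "\<dots> \<le> (\<Sum>j<d. 2 * (ip d (score_row d k m z (U s) j) (Y i))\<^sup>2 + 2 * (ip d (score_row d k m z (U s) j) (e s))\<^sup>2)"
      proof (rule sum_mono)
        fix j
        show "(a - b)\<^sup>2 \<le> 2 * a\<^sup>2 + 2 * b\<^sup>2" for a b :: real
          using zero_le_power2[of "a + b"] by (simp add: power2_eq_square algebra_simps)
      qed
      finally show ?thesis
        unfolding P_def power_score_rows[OF adm[OF that]] by (simp add: sum.distrib sum_distrib_left)
    qed
    then have "(\<Sum>s\<le>t. q s i / \<tau> s) \<le> (\<Sum>s\<le>t. (2 * P s (Y i) + 2 * P s (e s)) / \<tau> s)"
      using \<tau>n by (intro sum_mono divide_right_mono) auto
    also have "\<dots> = 2 * (\<Sum>s\<le>t. P s (Y i) / \<tau> s) + 2 * (\<Sum>s\<le>t. P s (e s) / \<tau> s)"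
      by (simp add: add_divide_distrib sum.distrib sum_distrib_left)
    also have "\<dots> \<le> 2 * (1 / 500) + 2 * (2 / 31 + 1 / 250)"
      using that E rT unfolding G_def by auto
    finally show ?thesis by simp
  qed
  have GK: "G \<subseteq> {..<k}" unfolding G_def by auto
  have cG': "card G \<le> k" using card_mono[OF _ GK] by simp
  have "wmass k (U 0) = (\<Sum>i\<in>G. U 0 i) + (\<Sum>i\<in>{..<k} - G. U 0 i)"
    unfolding wmass_def using sum.subset_diff[OF GK, of "U 0"] by simp
  also have "(\<Sum>i\<in>{..<k} - G. U 0 i) \<le> (\<Sum>i\<in>{..<k} - G. 1)" using un(2)[of 0] by (intro sum_mono) auto
  also have "\<dots> = real k - real (card G)" using GK cG' finite_subset[OF GK] by (simp add: card_Diff_subset of_nat_diff)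
  finally have "98 / 100 * real k \<le> (\<Sum>i\<in>G. U 0 i)" using init cG by simp
  moreover have "(\<Sum>i\<in>G. U 0 i - 3 / 20) \<le> (\<Sum>i\<in>G. W t i)"
    using retain small GK by (intro sum_mono) force
  moreover have "(\<Sum>i\<in>G. W t i) \<le> wmass k (W t)"
    unfolding wmass_def using GK W1(1)[of t] by (intro sum_mono2) auto
  moreover have "(\<Sum>i\<in>G. U 0 i - 3 / 20) = (\<Sum>i\<in>G. U 0 i) - 3 / 20 * real (card G)"
    by (simp add: sum_subtractf)
  ultimately have "4 * real k \<le> 5 * wmass k (W t)" using cG' by simp
  then show ?thesis unfolding W_def q_def .
qed

text \<open>
  Either the potential falls below \<open>1000 k r\<^sup>2\<close> times the trace in some round; then the top eigenvalue is at
  most \<open>3000 k r\<^sup>2\<close> there, and it cannot grow later. Or all steps are accepted and each halves the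
  potential; as pruning bounds the initial eigenvalues by \<open>4 d k r\<^sup>2\<close>, the number of rounds suffices to bring
  the potential below \<open>(k r\<^sup>2)\<^sup>2\<^sup>m\<^sup>+\<^sup>1\<close>.
\<close>

theorem filter_correct:
  assumes disp: "dispersed d k z \<mu> r" and r: "0 \<le> r" and k: "k > 0" and d: "d \<le> 4 ^ m"
    and c: "coord_median d k z c"
  shows "vnorm d (\<lambda>j. \<mu> j
    - wmean k z ((filter_step d k m z ^^ (4 * (m + 1)\<^sup>2)) (prune k (sqdist d z c))) j) \<le> 10 * r"
proof -
  define N where "N = 4 * (m + 1)\<^sup>2"
  define U where "U t = (filter_step d k m z ^^ t) (prune k (sqdist d z c))" for t
  have U_Suc: "U (Suc t) = filter_step d k m z (U t)" for t by (simp add: U_def)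
  have U0: "U 0 = prune k (sqdist d z c)" by (simp add: U_def)
  have init: "99 * real k \<le> 100 * wmass k (U 0)" unfolding U0 by (rule prune_mass[OF k])
  have "admissible k (U 0)" using init unfolding admissible_def by (auto simp: U0 prune_def)
  then have adm: "admissible k (U t)" for t
    by (induction t) (auto simp: U_Suc intro: admissible_filter_step(1)[OF k])
  have mono: "i < k \<Longrightarrow> U (t + s) i \<le> U t i" for i t s
    by (induction s) (auto simp: U_Suc intro: order_trans[OF admissible_filter_step(2)[OF k adm]])
  have final: "wquad d k z (U N) v \<le> 3000 * real k * r\<^sup>2 * ip d v v" for v
  proof (cases "\<exists>t\<le>N. potential d k m z (U t) < 1000 * real k * r\<^sup>2 * score_trace d k m z (U t)")
    case True
    then obtain t where t: "t \<le> N" "potential d k m z (U t) \<le> (1000 * real k * r\<^sup>2) * score_trace d k m z (U t)"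
      by (auto intro: less_imp_le)
    have "wquad d k z (U N) v \<le> wquad d k z (U t) v"
      using mono[of _ t "N - t"] t(1) by (intro wquad_mono[OF k adm]) auto
    also have "\<dots> \<le> 3 * (1000 * real k * r\<^sup>2) * ip d v v"
      by (rule wquad_le_of_score[OF adm d _ t(2)]) simp
    finally show ?thesis by simp
  next
    case False
    then have large: "1000 * real k * r\<^sup>2 * score_trace d k m z (U t) \<le> potential d k m z (U t)" if "t \<le> N" for t
      using that by (auto simp: not_less)
    have acc: "4 * real k \<le> 5 * wmass k (downweight k (U t) (scores d k m z (U t)))" if "t \<le> N" for t
      using that
    proof (induction t rule: less_induct)
      case (less t)
      have "U (Suc s) = downweight k (U s) (scores d k m z (U s))" if "s < t" for s
        using less that by (simp add: U_Suc filter_step_def Let_def)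
      then show ?case using less.prems large adm init by (intro step_accepted[OF disp k, where U = U]) auto
    qed
    have dec: "t \<le> N \<Longrightarrow> 2 ^ t * potential d k m z (U t) \<le> potential d k m z (U 0)" for t
    proof (induction t)
      case (Suc t)
      have "2 ^ Suc t * potential d k m z (U (Suc t)) = 2 ^ t * (2 * potential d k m z (U (Suc t)))" by simp
      also have "\<dots> \<le> 2 ^ t * potential d k m z (U t)"
        unfolding U_Suc using Suc.prems by (intro mult_left_mono potential_downweight[OF k adm acc]) auto
      also have "\<dots> \<le> potential d k m z (U 0)" using Suc by simp
      finally show ?case .
    qed simp
    define b where "b = real k * r\<^sup>2"
    have b: "0 \<le> b" by (simp add: b_def)
    have "wquad d k z (U 0) v \<le> 4 * real d * b * ip d v v" for v
    proof -
      have "wquad d k z (U 0) v \<le> (\<Sum>i<k. U 0 i * (ip d v (\<lambda>j. z i j - c j))\<^sup>2)"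
        using centered_quad_le[OF admissible_pos[OF k adm[of 0]], of d v z c]
        unfolding wquad_def by (simp add: ip_commute)
      also have "\<dots> \<le> (\<Sum>i<k. 4 * real d * r\<^sup>2 * ip d v v)"
      proof (rule sum_mono)
        fix i assume i: "i \<in> {..<k}"
        show "U 0 i * (ip d v (\<lambda>j. z i j - c j))\<^sup>2 \<le> 4 * real d * r\<^sup>2 * ip d v v"
        proof (cases "U 0 i = 0")
          case False
          then have one: "U 0 i = 1" by (auto simp: U0 prune_def split: if_splits)
          have "(ip d v (\<lambda>j. z i j - c j))\<^sup>2 \<le> ip d v v * sqdist d z c i"
            using ip_cauchy_schwarz[of d v "\<lambda>j. z i j - c j"]
            by (simp add: sqdist_def ip_def[of d "\<lambda>j. z i j - c j"] power2_eq_square)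
          also have "\<dots> \<le> ip d v v * (4 * real d * r\<^sup>2)"
            using prune_radius[OF disp r k c, of i] i False U0 ip_nonneg by (intro mult_left_mono) auto
          finally show ?thesis using one by (simp add: mult_ac)
        qed (simp add: ip_nonneg)
      qed
      finally show ?thesis by (simp add: b_def mult_ac)
    qed
    then have "potential d k m z (U 0) \<le> real d * (4 * real d * b) ^ (2 * m + 1)"
      by (rule potential_le_of_wquad[OF adm])
    also have "\<dots> = real d * (4 * real d) ^ (2 * m + 1) * b ^ (2 * m + 1)"
      by (simp add: power_mult_distrib)
    \<comment> \<open>The exponent \<open>4 (m + 1)\<^sup>2\<close> exceeds \<open>2 (m + (m + 1) (2 m + 1))\<close>.\<close>
    also have "\<dots> \<le> 2 ^ N * b ^ (2 * m + 1)"
    proof (rule mult_right_mono)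
      have dm: "real d \<le> 4 ^ m" using d by (metis of_nat_le_iff of_nat_numeral of_nat_power)
      then have "4 * real d \<le> 4 ^ (m + 1)" by simp
      then have "real d * (4 * real d) ^ (2 * m + 1) \<le> 4 ^ m * (4 ^ (m + 1)) ^ (2 * m + 1)"
        using dm by (intro mult_mono power_mono) auto
      also have "\<dots> = 4 ^ (m + (m + 1) * (2 * m + 1))" by (simp only: power_add power_mult)
      also have "\<dots> = 2 ^ (2 * (m + (m + 1) * (2 * m + 1)))" by (simp only: power_mult) simp
      also have "\<dots> \<le> 2 ^ N" unfolding N_def by (intro power_increasing) (auto simp: power2_eq_square algebra_simps)
      finally show "real d * (4 * real d) ^ (2 * m + 1) \<le> 2 ^ N" .
    qed (use b in simp)
    finally have "potential d k m z (U 0) \<le> 2 ^ N * b ^ (2 * m + 1)" .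
    with dec[OF order_refl] have "2 ^ N * potential d k m z (U N) \<le> 2 ^ N * b ^ (2 * m + 1)"
      by (rule order_trans)
    then have "potential d k m z (U N) \<le> b ^ (2 * m + 1)" by simp
    then have "wquad d k z (U N) v \<le> b * ip d v v" by (rule wquad_le_of_potential[OF adm b])
    also have "\<dots> \<le> 3000 * b * ip d v v" using b ip_nonneg by (intro mult_right_mono) auto
    finally show ?thesis by (simp add: b_def mult.assoc)
  qed
  define e where "e = (\<lambda>j. wmean k z (U N) j - \<mu> j)"
  define n2 where "n2 = ip d e e"
  have n2: "0 \<le> n2" unfolding n2_def by (rule ip_nonneg)
  have "n2\<^sup>2 \<le> wquad d k z (U N) e / (31 * real k) + 2 * r\<^sup>2 * n2"
    using wmean_shift[OF disp _ k, of "{(0, 0)}" "U N" "\<lambda>_. e"] adm[of N]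
    by (simp add: admissible_def e_def n2_def wquad_def ip_commute)
  also have "\<dots> \<le> 3000 * real k * r\<^sup>2 * n2 / (31 * real k) + 2 * r\<^sup>2 * n2"
    using final[of e] unfolding n2_def by (intro add_right_mono divide_right_mono) auto
  also have "\<dots> = (3000 / 31 + 2) * r\<^sup>2 * n2" using k by (simp add: field_simps)
  also have "\<dots> \<le> 100 * r\<^sup>2 * n2" using n2 by (intro mult_right_mono) auto
  finally have "n2 * n2 \<le> (100 * r\<^sup>2) * n2" by (simp add: power2_eq_square)
  then have "n2 \<le> (10 * r)\<^sup>2" using n2 by (cases "n2 = 0") (auto simp: power2_eq_square)
  then have "vnorm d e \<le> 10 * r" unfolding vnorm_eq_sqrt_ip n2_def using r by (intro real_le_lsqrt) auto
  moreover have "vnorm d (\<lambda>j. \<mu> j - wmean k z (U N) j) = vnorm d e"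
    unfolding vnorm_def L2_set_def e_def by (simp add: power2_commute)
  ultimately show ?thesis unfolding U_def N_def by simp
qed

section \<open>From single directions to families of directions\<close>

definition signed_sum :: "'a set \<Rightarrow> 'a set \<Rightarrow> ('a \<Rightarrow> real) \<Rightarrow> real" where
  "signed_sum J T c = (\<Sum>s\<in>J. if s \<in> T then c s else - c s)"

lemma sum_Pow_insert:
  fixes f :: "'a set \<Rightarrow> real"
  assumes "finite J" "a \<notin> J"
  shows "(\<Sum>T\<in>Pow (insert a J). f T) = (\<Sum>T\<in>Pow J. f T + f (insert a T))"
proof -
  have "(\<Sum>T\<in>Pow (insert a J). f T) = (\<Sum>T\<in>Pow J. f T) + (\<Sum>T\<in>insert a ` Pow J. f T)"
    unfolding Pow_insert using assms by (intro sum.union_disjoint) auto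
  also have "(\<Sum>T\<in>insert a ` Pow J. f T) = (\<Sum>T\<in>Pow J. f (insert a T))"
    using assms(2) by (subst sum.reindex) (auto simp: inj_on_def dest!: insert_ident[THEN iffD1, rotated 2])
  finally show ?thesis by (simp add: sum.distrib)
qed

lemma signed_sum_insert:
  assumes "finite J" "a \<notin> J" "T \<subseteq> J"
  shows "signed_sum (insert a J) T c = signed_sum J T c - c a"
    and "signed_sum (insert a J) (insert a T) c = signed_sum J T c + c a"
proof -
  have "a \<notin> T" using assms by auto
  then show "signed_sum (insert a J) T c = signed_sum J T c - c a"
    using assms by (simp add: signed_sum_def)
  have "(\<Sum>s\<in>J. if s \<in> insert a T then c s else - c s) = (\<Sum>s\<in>J. if s \<in> T then c s else - c s)"
    using assms(2) by (intro sum.cong refl) auto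
  then show "signed_sum (insert a J) (insert a T) c = signed_sum J T c + c a"
    using assms by (simp add: signed_sum_def)
qed

text \<open>
  Khinchine's inequality for the exponents 2 and 4, by induction on the number of signs.
\<close>

lemma signed_sum_moments:
  assumes "finite J"
  shows "(\<Sum>T\<in>Pow J. (signed_sum J T c)\<^sup>2) = 2 ^ card J * (\<Sum>s\<in>J. (c s)\<^sup>2)" (is "?A J")
    and "(\<Sum>T\<in>Pow J. (signed_sum J T c) ^ 4) \<le> 3 * 2 ^ card J * (\<Sum>s\<in>J. (c s)\<^sup>2)\<^sup>2" (is "?B J")
proof -
  have "?A J \<and> ?B J" using assms
  proof (induction J)
    case (insert a J)
    define Q where "Q = (\<Sum>s\<in>J. (c s)\<^sup>2)"
    have IH: "(\<Sum>T\<in>Pow J. (signed_sum J T c)\<^sup>2) = 2 ^ card J * Q"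
      "(\<Sum>T\<in>Pow J. (signed_sum J T c) ^ 4) \<le> 3 * 2 ^ card J * Q\<^sup>2"
      using insert.IH unfolding Q_def by auto
    have Q': "(\<Sum>s\<in>insert a J. (c s)\<^sup>2) = Q + (c a)\<^sup>2" using insert.hyps by (simp add: Q_def)
    have sq: "(x - y)\<^sup>2 + (x + y)\<^sup>2 = 2 * x\<^sup>2 + 2 * y\<^sup>2" for x y :: real
      by (simp add: power2_eq_square algebra_simps)
    have qu: "(x - y) ^ 4 + (x + y) ^ 4 = 2 * x ^ 4 + 12 * y\<^sup>2 * x\<^sup>2 + 2 * y ^ 4" for x y :: real
      by (simp add: power4_eq_xxxx power2_eq_square algebra_simps)
    have c: "card (insert a J) = Suc (card J)" "card (Pow J) = 2 ^ card J"
      using insert.hyps by (simp_all add: card_Pow)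
    have "(\<Sum>T\<in>Pow (insert a J). (signed_sum (insert a J) T c)\<^sup>2)
        = (\<Sum>T\<in>Pow J. (signed_sum J T c - c a)\<^sup>2 + (signed_sum J T c + c a)\<^sup>2)"
      unfolding sum_Pow_insert[OF insert.hyps] using insert.hyps
      by (intro sum.cong refl) (simp add: signed_sum_insert)
    also have "\<dots> = 2 * (2 ^ card J * Q) + 2 * 2 ^ card J * (c a)\<^sup>2"
      unfolding sq sum.distrib sum_distrib_left[symmetric] IH(1) using c(2) by simp
    finally have A: "?A (insert a J)" unfolding Q' c(1) by (simp add: algebra_simps)
    have "(\<Sum>T\<in>Pow (insert a J). (signed_sum (insert a J) T c) ^ 4)
        = (\<Sum>T\<in>Pow J. (signed_sum J T c - c a) ^ 4 + (signed_sum J T c + c a) ^ 4)"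
      unfolding sum_Pow_insert[OF insert.hyps] using insert.hyps
      by (intro sum.cong refl) (simp add: signed_sum_insert)
    also have "\<dots> = 2 * (\<Sum>T\<in>Pow J. (signed_sum J T c) ^ 4) + 12 * (c a)\<^sup>2 * (2 ^ card J * Q) + 2 * 2 ^ card J * (c a) ^ 4"
      unfolding qu sum.distrib sum_distrib_left[symmetric] IH(1) using c(2) by simp
    also have "\<dots> \<le> 2 * (3 * 2 ^ card J * Q\<^sup>2) + 12 * (c a)\<^sup>2 * (2 ^ card J * Q) + 6 * 2 ^ card J * (c a) ^ 4"
      using IH(2) by (intro add_mono mult_left_mono mult_right_mono) auto
    also have "\<dots> = 3 * 2 ^ Suc (card J) * (Q + (c a)\<^sup>2)\<^sup>2"
      by (simp add: power4_eq_xxxx power2_eq_square algebra_simps)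
    finally have "?B (insert a J)" unfolding Q' c(1) .
    with A show ?case by blast
  qed (simp add: signed_sum_def)
  then show "?A J" "?B J" by auto
qed

text \<open>
  A Paley--Zygmund bound for random signs. On the event \<open>X\<^sup>2 \<le> r\<^sup>2\<close> the quadratic polynomial
  \<open>(X\<^sup>2 - Q/2) (10 Q - X\<^sup>2)\<close> in \<open>X\<^sup>2\<close> is not positive, its maximum is \<open>361/16 Q\<^sup>2\<close>, and its mean is at
  least \<open>5/2 Q\<^sup>2\<close> by the moments of order 2 and 4.
\<close>

lemma signed_sum_large:
  assumes J: "finite J" and Q: "2 * r\<^sup>2 < (\<Sum>s\<in>J. (c s)\<^sup>2)"
  shows "2 ^ card J \<le> 10 * real (card {T \<in> Pow J. r\<^sup>2 < (signed_sum J T c)\<^sup>2})"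
proof -
  define q where "q = (\<Sum>s\<in>J. (c s)\<^sup>2)"
  define N where "N = (2::real) ^ card J"
  have q: "2 * r\<^sup>2 < q" "q > 0" using Q zero_le_power2[of r] unfolding q_def by linarith+
  note m = signed_sum_moments[OF J, of c, folded q_def N_def]
  have pt: "16 * ((x - q / 2) * (10 * q - x)) \<le> 361 * q\<^sup>2 * of_bool (r\<^sup>2 < x)" if "x \<ge> 0" for x
  proof (cases "r\<^sup>2 < x")
    case True
    have "0 \<le> (4 * x - 21 * q)\<^sup>2" by simp
    then show ?thesis using True by (simp add: power2_eq_square algebra_simps)
  next
    case False
    then have "(x - q / 2) * (10 * q - x) \<le> 0" using q by (intro mult_nonpos_nonneg) auto
    then show ?thesis using False by simp
  qed
  have "40 * q\<^sup>2 * N = 16 * (21 / 2 * q * (N * q) - 3 * N * q\<^sup>2 - 5 * q\<^sup>2 * N)"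
    by (simp add: power2_eq_square algebra_simps)
  also have "\<dots> \<le> 16 * (21 / 2 * q * (N * q) - (\<Sum>T\<in>Pow J. (signed_sum J T c) ^ 4) - 5 * q\<^sup>2 * N)"
    using m(2) by simp
  also have "\<dots> = (\<Sum>T\<in>Pow J. 16 * (21 / 2 * q * (signed_sum J T c)\<^sup>2 - (signed_sum J T c) ^ 4 - 5 * q\<^sup>2))"
    unfolding sum_distrib_left[symmetric] sum_subtractf m(1)[symmetric] by (simp add: card_Pow J N_def sum_distrib_left)
  also have "\<dots> = (\<Sum>T\<in>Pow J. 16 * (((signed_sum J T c)\<^sup>2 - q / 2) * (10 * q - (signed_sum J T c)\<^sup>2)))"
    by (intro sum.cong refl) (simp add: power4_eq_xxxx power2_eq_square algebra_simps)
  also have "\<dots> \<le> (\<Sum>T\<in>Pow J. 361 * q\<^sup>2 * of_bool (r\<^sup>2 < (signed_sum J T c)\<^sup>2))"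
    by (intro sum_mono pt) simp
  also have "\<dots> = 361 * q\<^sup>2 * real (card {T \<in> Pow J. r\<^sup>2 < (signed_sum J T c)\<^sup>2})"
    using J by (simp add: sum_distrib_left[symmetric] Int_def)
  finally have "q\<^sup>2 * (40 * N) \<le> q\<^sup>2 * (361 * real (card {T \<in> Pow J. r\<^sup>2 < (signed_sum J T c)\<^sup>2}))" by simp
  then have "40 * N \<le> 361 * real (card {T \<in> Pow J. r\<^sup>2 < (signed_sum J T c)\<^sup>2})"
    using q by (subst (asm) mult_le_cancel_left_pos) auto
  then show ?thesis unfolding N_def by simp
qed

text \<open>A bound for single directions extends to families of directions: replace the family by a random
  signed sum, whose squared length is \<open>\<Sum> \<parallel>v s\<parallel>\<^sup>2\<close> on average.\<close>

lemma families_of_directions: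
  fixes Y :: "nat \<Rightarrow> nat \<Rightarrow> real" and v :: "'a \<Rightarrow> nat \<Rightarrow> real"
  assumes I: "finite I" and J: "finite J" and b: "0 \<le> b"
    and dir: "\<And>w. real (card {i \<in> I. r\<^sup>2 < (ip d w (Y i))\<^sup>2}) \<le> a + b * ip d w w"
  shows "real (card {i \<in> I. 2 * r\<^sup>2 * (\<Sum>s\<in>J. ip d (v s) (v s)) < (\<Sum>s\<in>J. (ip d (v s) (Y i))\<^sup>2)}) \<le> 10 * (a + b)"
proof -
  define T where "T = (\<Sum>s\<in>J. ip d (v s) (v s))"
  have Tn: "0 \<le> T" unfolding T_def by (intro sum_nonneg ip_nonneg)
  have ab: "0 \<le> a + b"
    using dir[of "\<lambda>_. 0"] b by (simp add: ip_def)
  show ?thesis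
  proof (cases "T = 0")
    case True
    then have "\<forall>s\<in>J. ip d (v s) (v s) = 0"
      unfolding T_def using J ip_nonneg by (subst (asm) sum_nonneg_eq_0_iff) auto
    then have "\<forall>s\<in>J. (ip d (v s) (Y i))\<^sup>2 = 0" for i
      using ip_cauchy_schwarz[of d _ "Y i"] by (metis antisym mult_zero_left zero_le_power2)
    then have none: "{i \<in> I. 2 * r\<^sup>2 * (\<Sum>s\<in>J. ip d (v s) (v s)) < (\<Sum>s\<in>J. (ip d (v s) (Y i))\<^sup>2)} = {}"
      using True by (auto simp: T_def)
    show ?thesis unfolding none using ab by simp
  next
    case False
    then have T: "T > 0" using Tn by simp
    define w where "w s j = v s j / sqrt T" for s j
    define W where "W S j = signed_sum J S (\<lambda>s. w s j)" for S j
    define N where "N = (2::real) ^ card J"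
    have ipw: "(ip d (w s) y)\<^sup>2 = (ip d (v s) y)\<^sup>2 / T" for s y
      using T by (simp add: w_def[abs_def] ip_commute[of d _ y] ip_divide_right power_divide)
    have ipW: "ip d (W S) y = signed_sum J S (\<lambda>s. ip d (w s) y)" for S y
    proof -
      have "ip d (W S) y = (\<Sum>j<d. \<Sum>s\<in>J. (if s \<in> S then w s j * y j else - (w s j * y j)))"
        unfolding ip_def W_def signed_sum_def sum_distrib_right by (intro sum.cong refl) auto
      also have "\<dots> = (\<Sum>s\<in>J. \<Sum>j<d. (if s \<in> S then w s j * y j else - (w s j * y j)))"
        by (rule sum.swap)
      also have "\<dots> = signed_sum J S (\<lambda>s. ip d (w s) y)"
        unfolding signed_sum_def ip_def by (intro sum.cong refl) (auto simp: sum_negf)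
      finally show ?thesis .
    qed
    have "(\<Sum>S\<in>Pow J. ip d (W S) (W S)) = (\<Sum>j<d. \<Sum>S\<in>Pow J. (signed_sum J S (\<lambda>s. w s j))\<^sup>2)"
      unfolding ip_def W_def by (subst sum.swap) (simp add: power2_eq_square)
    also have "\<dots> = N * (\<Sum>j<d. \<Sum>s\<in>J. (w s j)\<^sup>2)"
      unfolding signed_sum_moments(1)[OF J] by (simp add: sum_distrib_left N_def)
    also have "(\<Sum>j<d. \<Sum>s\<in>J. (w s j)\<^sup>2) = (\<Sum>s\<in>J. ip d (v s) (v s) / T)"
      using T by (subst sum.swap) (simp add: w_def ip_def power_divide sum_divide_distrib power2_eq_square)
    also have "\<dots> = 1" using T by (simp add: sum_divide_distrib[symmetric] T_def)
    finally have len: "(\<Sum>S\<in>Pow J. ip d (W S) (W S)) = N" by simp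
    define R where "R = {i \<in> I. 2 * r\<^sup>2 * T < (\<Sum>s\<in>J. (ip d (v s) (Y i))\<^sup>2)}"
    have R: "finite R" "R \<subseteq> I" using I unfolding R_def by auto
    have "N * real (card R) = (\<Sum>i\<in>R. N)" by simp
    also have "\<dots> \<le> (\<Sum>i\<in>R. 10 * real (card {S \<in> Pow J. r\<^sup>2 < (ip d (W S) (Y i))\<^sup>2}))"
    proof (rule sum_mono)
      fix i assume "i \<in> R"
      then have "2 * r\<^sup>2 < (\<Sum>s\<in>J. (ip d (w s) (Y i))\<^sup>2)"
        unfolding ipw sum_divide_distrib[symmetric] R_def using T by (simp add: pos_less_divide_eq)
      then show "N \<le> 10 * real (card {S \<in> Pow J. r\<^sup>2 < (ip d (W S) (Y i))\<^sup>2})"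
        unfolding ipW N_def by (rule signed_sum_large[OF J])
    qed
    also have "\<dots> = 10 * (\<Sum>i\<in>R. \<Sum>S\<in>Pow J. of_bool (r\<^sup>2 < (ip d (W S) (Y i))\<^sup>2))"
      using J by (simp add: sum_distrib_left Int_def)
    also have "\<dots> = 10 * (\<Sum>S\<in>Pow J. \<Sum>i\<in>R. of_bool (r\<^sup>2 < (ip d (W S) (Y i))\<^sup>2))"
      by (subst sum.swap) simp
    also have "\<dots> \<le> 10 * (\<Sum>S\<in>Pow J. a + b * ip d (W S) (W S))"
    proof (intro mult_left_mono sum_mono)
      fix S
      have "(\<Sum>i\<in>R. of_bool (r\<^sup>2 < (ip d (W S) (Y i))\<^sup>2)) = real (card {i \<in> R. r\<^sup>2 < (ip d (W S) (Y i))\<^sup>2})"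
        using R by (simp add: Int_def)
      also have "\<dots> \<le> real (card {i \<in> I. r\<^sup>2 < (ip d (W S) (Y i))\<^sup>2})"
        using R I by (intro of_nat_mono card_mono) auto
      also have "\<dots> \<le> a + b * ip d (W S) (W S)" by (rule dir)
      finally show "(\<Sum>i\<in>R. of_bool (r\<^sup>2 < (ip d (W S) (Y i))\<^sup>2)) \<le> a + b * ip d (W S) (W S)" .
    qed simp
    also have "\<dots> = N * (10 * (a + b))"
      unfolding sum.distrib sum_distrib_left[symmetric] len using J by (simp add: card_Pow N_def algebra_simps)
    finally have "real (card R) \<le> 10 * (a + b)" by (simp add: N_def)
    then show ?thesis unfolding R_def T_def .
  qed
qed

text \<open>
  The second moments of the coordinates of a product measure, used both for the Gaussian vector and for the
  i.i.d. sample.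
\<close>

lemma PiM_pair_moment:
  fixes f g :: "'b \<Rightarrow> real"
  assumes N: "prob_space N" and I: "finite I" "a \<in> I" "b \<in> I"
    and f: "integrable N f" and g: "integrable N g" and fg: "integrable N (\<lambda>x. f x * g x)"
  shows "integrable (\<Pi>\<^sub>M i\<in>I. N) (\<lambda>X. f (X a) * g (X b))"
    and "(\<integral>X. f (X a) * g (X b) \<partial>(\<Pi>\<^sub>M i\<in>I. N)) =
      (if a = b then \<integral>x. f x * g x \<partial>N else (\<integral>x. f x \<partial>N) * (\<integral>x. g x \<partial>N))"
proof -
  interpret N: prob_space N by fact
  interpret product_sigma_finite "\<lambda>_. N" by standard
  define h where "h i = (if i = a \<and> i = b then (\<lambda>x. f x * g x) else if i = a then f else if i = b then g else (\<lambda>_. 1))" for i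
  have int: "integrable N (h i)" for i unfolding h_def using f g fg by auto
  have pr: "(\<Prod>i\<in>I. h i (X i)) = f (X a) * g (X b)" for X
  proof (cases "a = b")
    case True
    have "(\<Prod>i\<in>I. h i (X i)) = (\<Prod>i\<in>{a}. h i (X i))"
      using I True by (intro prod.mono_neutral_right) (auto simp: h_def)
    then show ?thesis using True by (simp add: h_def)
  next
    case False
    have "(\<Prod>i\<in>I. h i (X i)) = (\<Prod>i\<in>{a, b}. h i (X i))"
      using I False by (intro prod.mono_neutral_right) (auto simp: h_def)
    then show ?thesis using False by (simp add: h_def)
  qed
  show "integrable (\<Pi>\<^sub>M i\<in>I. N) (\<lambda>X. f (X a) * g (X b))"
    using product_integrable_prod[of I h, OF I(1) int] unfolding pr .
  have "(\<integral>X. f (X a) * g (X b) \<partial>(\<Pi>\<^sub>M i\<in>I. N)) = (\<Prod>i\<in>I. \<integral>x. h i x \<partial>N)"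
    using product_integral_prod[of I h, OF I(1) int] unfolding pr .
  also have "\<dots> = (if a = b then \<integral>x. f x * g x \<partial>N else (\<integral>x. f x \<partial>N) * (\<integral>x. g x \<partial>N))"
  proof (cases "a = b")
    case True
    have "(\<Prod>i\<in>I. \<integral>x. h i x \<partial>N) = (\<Prod>i\<in>{a}. \<integral>x. h i x \<partial>N)"
      using I True by (intro prod.mono_neutral_right) (auto simp: h_def N.prob_space)
    then show ?thesis using True by (simp add: h_def)
  next
    case False
    have "(\<Prod>i\<in>I. \<integral>x. h i x \<partial>N) = (\<Prod>i\<in>{a, b}. \<integral>x. h i x \<partial>N)"
      using I False by (intro prod.mono_neutral_right) (auto simp: h_def N.prob_space)
    then show ?thesis using False by (simp add: h_def)
  qed
  finally show "(\<integral>X. f (X a) * g (X b) \<partial>(\<Pi>\<^sub>M i\<in>I. N)) =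
      (if a = b then \<integral>x. f x * g x \<partial>N else (\<integral>x. f x \<partial>N) * (\<integral>x. g x \<partial>N))" .
qed

section \<open>Shifts of Gaussian vectors\<close>

definition gauss :: "real \<Rightarrow> real measure" where
  "gauss \<sigma> = density lborel (\<lambda>x. ennreal (normal_density 0 \<sigma> x))"

definition gauss_vec :: "nat \<Rightarrow> real \<Rightarrow> (nat \<Rightarrow> real) measure" where
  "gauss_vec d \<sigma> = (\<Pi>\<^sub>M i\<in>{..<d}. gauss \<sigma>)"

lemma sets_gauss [measurable_cong, simp]: "sets (gauss \<sigma>) = sets borel"
  by (simp add: gauss_def)

lemma space_gauss [simp]: "space (gauss \<sigma>) = UNIV"
  by (simp add: gauss_def)

lemma prob_space_gauss: "\<sigma> > 0 \<Longrightarrow> prob_space (gauss \<sigma>)"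
  unfolding gauss_def by (rule prob_space_normal_density)

lemma prob_space_gauss_vec: "\<sigma> > 0 \<Longrightarrow> prob_space (gauss_vec d \<sigma>)"
  unfolding gauss_vec_def by (intro prob_space_PiM prob_space_gauss)

lemma gauss_moments:
  assumes "\<sigma> > 0"
  shows "integrable (gauss \<sigma>) (\<lambda>x. x)" "(\<integral>x. x \<partial>gauss \<sigma>) = 0"
    "integrable (gauss \<sigma>) (\<lambda>x. x * x)" "(\<integral>x. x * x \<partial>gauss \<sigma>) = \<sigma>\<^sup>2"
proof -
  have 1: "has_bochner_integral lborel (\<lambda>x. normal_density 0 \<sigma> x * x) 0"
    using normal_moment_odd[OF assms, of 0 0] by simp
  have 2: "has_bochner_integral lborel (\<lambda>x. normal_density 0 \<sigma> x * (x * x)) (\<sigma>\<^sup>2)"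
    using normal_moment_even[OF assms, of 0 1] by (simp add: power2_eq_square)
  show "integrable (gauss \<sigma>) (\<lambda>x. x)" "(\<integral>x. x \<partial>gauss \<sigma>) = 0"
    unfolding gauss_def using 1
    by (auto simp: integrable_density integral_density has_bochner_integral_iff)
  show "integrable (gauss \<sigma>) (\<lambda>x. x * x)" "(\<integral>x. x * x \<partial>gauss \<sigma>) = \<sigma>\<^sup>2"
    unfolding gauss_def using 2
    by (auto simp: integrable_density integral_density has_bochner_integral_iff)
qed

lemma gauss_vec_moments:
  assumes s: "\<sigma> > 0" and ab: "a < d" "b < d"
  shows "integrable (gauss_vec d \<sigma>) (\<lambda>g. g a)" "(\<integral>g. g a \<partial>gauss_vec d \<sigma>) = 0"
    "integrable (gauss_vec d \<sigma>) (\<lambda>g. g a * g b)"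
    "(\<integral>g. g a * g b \<partial>gauss_vec d \<sigma>) = (if a = b then \<sigma>\<^sup>2 else 0)"
proof -
  note G = gauss_moments[OF s]
  interpret prob_space "gauss \<sigma>" by (rule prob_space_gauss[OF s])
  show "integrable (gauss_vec d \<sigma>) (\<lambda>g. g a)" "(\<integral>g. g a \<partial>gauss_vec d \<sigma>) = 0"
    using PiM_pair_moment[OF prob_space_gauss[OF s], of "{..<d}" a a "\<lambda>x. x" "\<lambda>_. 1"] G ab
    by (simp_all add: gauss_vec_def)
  show "integrable (gauss_vec d \<sigma>) (\<lambda>g. g a * g b)"
    "(\<integral>g. g a * g b \<partial>gauss_vec d \<sigma>) = (if a = b then \<sigma>\<^sup>2 else 0)"
    using PiM_pair_moment[OF prob_space_gauss[OF s], of "{..<d}" a b "\<lambda>x. x" "\<lambda>x. x"] G ab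
    by (simp_all add: gauss_vec_def)
qed

lemma gauss_shift:
  fixes \<epsilon> v :: real
  assumes s: "\<sigma> > 0" and e: "\<epsilon> * \<epsilon> = 1" and A[measurable]: "A \<in> sets borel"
  shows "(\<integral>\<^sup>+x. ennreal (exp (- (2 * \<epsilon> * v * x + v\<^sup>2) / (2 * \<sigma>\<^sup>2))) * indicator A (v + \<epsilon> * x) \<partial>gauss \<sigma>) = emeasure (gauss \<sigma>) A"
proof -
  have e1: "\<epsilon> = 1 \<or> \<epsilon> = - 1" using e power2_eq_1_iff[of \<epsilon>] by (simp add: power2_eq_square)
  then have e': "\<epsilon> \<noteq> 0" "\<bar>\<epsilon>\<bar> = 1" by auto
  have dens: "normal_density 0 \<sigma> x * exp (- (2 * \<epsilon> * v * x + v\<^sup>2) / (2 * \<sigma>\<^sup>2)) = normal_density 0 \<sigma> (v + \<epsilon> * x)" for x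
  proof -
    have "(v + \<epsilon> * x)\<^sup>2 = x\<^sup>2 + (2 * \<epsilon> * v * x + v\<^sup>2)"
      using e1 by (auto simp: power2_eq_square algebra_simps)
    then have "- (v + \<epsilon> * x)\<^sup>2 / (2 * \<sigma>\<^sup>2) = - x\<^sup>2 / (2 * \<sigma>\<^sup>2) + - (2 * \<epsilon> * v * x + v\<^sup>2) / (2 * \<sigma>\<^sup>2)"
      by (simp add: add_divide_distrib diff_divide_distrib)
    then have "exp (- (v + \<epsilon> * x)\<^sup>2 / (2 * \<sigma>\<^sup>2))
        = exp (- x\<^sup>2 / (2 * \<sigma>\<^sup>2)) * exp (- (2 * \<epsilon> * v * x + v\<^sup>2) / (2 * \<sigma>\<^sup>2))"
      by (simp only: exp_add)
    then show ?thesis by (simp add: normal_density_def)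
  qed
  have "(\<integral>\<^sup>+x. ennreal (exp (- (2 * \<epsilon> * v * x + v\<^sup>2) / (2 * \<sigma>\<^sup>2))) * indicator A (v + \<epsilon> * x) \<partial>gauss \<sigma>)
      = (\<integral>\<^sup>+x. ennreal (normal_density 0 \<sigma> x) * (ennreal (exp (- (2 * \<epsilon> * v * x + v\<^sup>2) / (2 * \<sigma>\<^sup>2))) * indicator A (v + \<epsilon> * x)) \<partial>lborel)"
    unfolding gauss_def by (subst nn_integral_density) auto
  also have "\<dots> = (\<integral>\<^sup>+x. ennreal (normal_density 0 \<sigma> (v + \<epsilon> * x)) * indicator A (v + \<epsilon> * x) \<partial>lborel)"
  proof (rule nn_integral_cong)
    fix x
    have "ennreal (normal_density 0 \<sigma> x) * (ennreal (exp (- (2 * \<epsilon> * v * x + v\<^sup>2) / (2 * \<sigma>\<^sup>2))) * indicator A (v + \<epsilon> * x))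
      = ennreal (normal_density 0 \<sigma> x * exp (- (2 * \<epsilon> * v * x + v\<^sup>2) / (2 * \<sigma>\<^sup>2))) * indicator A (v + \<epsilon> * x)"
      by (simp only: mult.assoc[symmetric] ennreal_mult[OF normal_density_nonneg exp_ge_zero])
    then show "ennreal (normal_density 0 \<sigma> x) * (ennreal (exp (- (2 * \<epsilon> * v * x + v\<^sup>2) / (2 * \<sigma>\<^sup>2))) * indicator A (v + \<epsilon> * x))
      = ennreal (normal_density 0 \<sigma> (v + \<epsilon> * x)) * indicator A (v + \<epsilon> * x)"
      unfolding dens .
  qed
  also have "\<dots> = (\<integral>\<^sup>+x. ennreal (normal_density 0 \<sigma> x) * indicator A x \<partial>lborel)"
    using e' by (subst nn_integral_real_affine[where c = \<epsilon> and t = v]) auto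
  also have "\<dots> = emeasure (gauss \<sigma>) A"
    unfolding gauss_def by (subst emeasure_density) auto
  finally show ?thesis .
qed

definition affine_map :: "nat \<Rightarrow> (nat \<Rightarrow> real) \<Rightarrow> real \<Rightarrow> (nat \<Rightarrow> real) \<Rightarrow> nat \<Rightarrow> real" where
  "affine_map d v \<epsilon> g = (\<lambda>i\<in>{..<d}. v i + \<epsilon> * g i)"

text \<open>The Cameron--Martin formula in finite dimension, for the maps \<open>g \<mapsto> v + g\<close> and \<open>g \<mapsto> v - g\<close>.\<close>

lemma gauss_vec_shift:
  fixes \<epsilon> :: real
  assumes s: "\<sigma> > 0" and e: "\<epsilon> * \<epsilon> = 1" and F: "F \<in> borel_measurable (gauss_vec d \<sigma>)"
  shows "(\<integral>\<^sup>+g. F g \<partial>gauss_vec d \<sigma>) =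
    (\<integral>\<^sup>+g. ennreal (exp (- (2 * \<epsilon> * ip d v g + ip d v v) / (2 * \<sigma>\<^sup>2))) * F (affine_map d v \<epsilon> g) \<partial>gauss_vec d \<sigma>)"
proof -
  interpret N: prob_space "gauss \<sigma>" by (rule prob_space_gauss[OF s])
  interpret product_sigma_finite "\<lambda>_. gauss \<sigma>" by standard
  let ?G = "gauss_vec d \<sigma>" and ?T = "affine_map d v \<epsilon>"
  define w where "w g = ennreal (exp (- (2 * \<epsilon> * ip d v g + ip d v v) / (2 * \<sigma>\<^sup>2)))" for g
  have T[measurable]: "?T \<in> ?G \<rightarrow>\<^sub>M ?G"
    unfolding affine_map_def gauss_vec_def by measurable
  have w[measurable]: "w \<in> borel_measurable ?G"
    unfolding w_def ip_def gauss_vec_def by measurable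
  have "distr (density ?G w) ?G ?T = (\<Pi>\<^sub>M i\<in>{..<d}. gauss \<sigma>)"
  proof (rule PiM_eqI)
    fix A :: "nat \<Rightarrow> real set" assume A: "\<And>i. i \<in> {..<d} \<Longrightarrow> A i \<in> sets (gauss \<sigma>)"
    have P[measurable]: "Pi\<^sub>E {..<d} A \<in> sets ?G" unfolding gauss_vec_def using A by (intro sets_PiM_I_finite) auto
    have "emeasure (distr (density ?G w) ?G ?T) (Pi\<^sub>E {..<d} A) = (\<integral>\<^sup>+g. indicator (Pi\<^sub>E {..<d} A) g \<partial>distr (density ?G w) ?G ?T)"
      using P by simp
    also have "\<dots> = (\<integral>\<^sup>+g. w g * indicator (Pi\<^sub>E {..<d} A) (?T g) \<partial>?G)"
      by (subst nn_integral_distr) (auto simp: nn_integral_density)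
    also have "\<dots> = (\<integral>\<^sup>+g. (\<Prod>i<d. ennreal (exp (- (2 * \<epsilon> * v i * g i + (v i)\<^sup>2) / (2 * \<sigma>\<^sup>2))) * indicator (A i) (v i + \<epsilon> * g i)) \<partial>?G)"
    proof (rule nn_integral_cong)
      fix g
      have "- (2 * \<epsilon> * ip d v g + ip d v v) / (2 * \<sigma>\<^sup>2) = (\<Sum>i<d. - (2 * \<epsilon> * v i * g i + (v i)\<^sup>2) / (2 * \<sigma>\<^sup>2))"
        by (simp add: ip_def sum_distrib_left sum.distrib sum_negf sum_subtractf sum_divide_distrib[symmetric] power2_eq_square mult.assoc)
      then have "w g = (\<Prod>i<d. ennreal (exp (- (2 * \<epsilon> * v i * g i + (v i)\<^sup>2) / (2 * \<sigma>\<^sup>2))))"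
        unfolding w_def by (simp only: exp_sum[OF finite_lessThan]) (simp add: prod_ennreal)
      moreover have "indicator (Pi\<^sub>E {..<d} A) (?T g) = (\<Prod>i<d. indicator (A i) (v i + \<epsilon> * g i) :: ennreal)"
      proof -
        have "?T g \<in> Pi\<^sub>E {..<d} A \<longleftrightarrow> (\<forall>i<d. v i + \<epsilon> * g i \<in> A i)"
          by (auto simp: affine_map_def PiE_iff)
        then show ?thesis by (auto simp: indicator_def intro!: prod.neutral[symmetric])
      qed
      ultimately show "w g * indicator (Pi\<^sub>E {..<d} A) (?T g) = (\<Prod>i<d. ennreal (exp (- (2 * \<epsilon> * v i * g i + (v i)\<^sup>2) / (2 * \<sigma>\<^sup>2))) * indicator (A i) (v i + \<epsilon> * g i))"
        by (simp add: prod.distrib)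
    qed
    also have "\<dots> = (\<Prod>i<d. \<integral>\<^sup>+x. ennreal (exp (- (2 * \<epsilon> * v i * x + (v i)\<^sup>2) / (2 * \<sigma>\<^sup>2))) * indicator (A i) (v i + \<epsilon> * x) \<partial>gauss \<sigma>)"
      unfolding gauss_vec_def using A
      by (intro product_nn_integral_prod[where f = "\<lambda>i x. ennreal (exp (- (2 * \<epsilon> * v i * x + (v i)\<^sup>2) / (2 * \<sigma>\<^sup>2))) * indicator (A i) (v i + \<epsilon> * x)"]) auto
    also have "\<dots> = (\<Prod>i<d. emeasure (gauss \<sigma>) (A i))"
      using A by (intro prod.cong refl gauss_shift[OF s e]) auto
    finally show "emeasure (distr (density ?G w) ?G ?T) (Pi\<^sub>E {..<d} A) = (\<Prod>i<d. emeasure (gauss \<sigma>) (A i))" .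
  qed (auto simp: gauss_vec_def)
  then have "(\<integral>\<^sup>+g. F g \<partial>?G) = (\<integral>\<^sup>+g. F g \<partial>distr (density ?G w) ?G ?T)" unfolding gauss_vec_def by simp
  also have "\<dots> = (\<integral>\<^sup>+g. w g * F (?T g) \<partial>?G)"
    using F by (simp add: nn_integral_distr nn_integral_density)
  finally show ?thesis unfolding w_def .
qed

text \<open>
  Jensen's inequality for \<open>exp\<close> in a form that allows the right-hand side to be infinite.
\<close>

lemma (in prob_space) exp_expectation_le:
  fixes X :: "'a \<Rightarrow> real"
  assumes X: "integrable M X"
  shows "ennreal (exp (expectation X)) \<le> (\<integral>\<^sup>+x. ennreal (exp (X x)) \<partial>M)"
proof -
  have [measurable]: "X \<in> borel_measurable M" using X by auto
  let ?a = "expectation X"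
  define h where "h x = exp ?a * (1 + (X x - ?a))" for x
  have h: "integrable M h" unfolding h_def using X by (intro integrable_mult_right integrable_add integrable_diff) auto
  have "expectation h = exp ?a" unfolding h_def using X by (simp add: prob_space)
  have hle: "h x \<le> exp (X x)" for x
  proof -
    have "exp ?a * (1 + (X x - ?a)) \<le> exp ?a * exp (X x - ?a)" by (intro mult_left_mono exp_ge_add_one_self) auto
    then show ?thesis by (simp add: h_def exp_add[symmetric])
  qed
  show ?thesis
  proof (cases "(\<integral>\<^sup>+x. ennreal (exp (X x)) \<partial>M) = \<infinity>")
    case False
    then have int: "integrable M (\<lambda>x. exp (X x))"
      by (intro integrableI_nonneg) (auto simp: top.not_eq_extremum less_top)
    have "exp ?a \<le> expectation (\<lambda>x. exp (X x))"
      unfolding \<open>expectation h = exp ?a\<close>[symmetric] using h int hle by (intro integral_mono) auto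
    then show ?thesis using int by (simp add: nn_integral_eq_integral)
  qed simp
qed

section \<open>A uniform count over all directions\<close>

lemma ip_affine_map: "ip d (affine_map d v \<epsilon> g) y = ip d v y + \<epsilon> * ip d g y"
  unfolding ip_def affine_map_def by (simp add: sum_distrib_left sum.distrib[symmetric] algebra_simps)

lemma qform_cong: "(\<And>i. i < d \<Longrightarrow> x i = x' i) \<Longrightarrow> (\<And>i. i < d \<Longrightarrow> y i = y' i) \<Longrightarrow> qform d S x y = qform d S x' y'"
  by (simp add: qform_def)

lemma qform_affine_map:
  "qform d S (affine_map d v \<epsilon> g) (affine_map d v \<epsilon> g)
    = qform d S v v + \<epsilon> * (qform d S v g + qform d S g v) + \<epsilon> * \<epsilon> * qform d S g g"
proof -
  have "qform d S (affine_map d v \<epsilon> g) (affine_map d v \<epsilon> g) = qform d S (\<lambda>i. 1 * v i + \<epsilon> * g i) (\<lambda>i. 1 * v i + \<epsilon> * g i)"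
    by (rule qform_cong) (simp_all add: affine_map_def)
  then show ?thesis unfolding qform_linear by (simp add: algebra_simps)
qed

text \<open>
  A uniform bound over all directions by a change of measure. For one direction \<open>\<theta>\<close> the hypothesis
  bounds an exponential moment, so the average over a Gaussian \<open>\<theta>\<close> of
  \<open>exp (lam N \<theta> - c \<theta>\<^sup>T S \<theta>)\<close> has mean at most 1, and by Markov it is at most \<open>1 / \<delta>\<close> with
  probability \<open>1 - \<delta>\<close>. On this single event every \<open>v\<close> is treated at once: moving the Gaussian to
  \<open>v\<close> costs \<open>\<parallel>v\<parallel>\<^sup>2 / (2 \<sigma>\<^sup>2)\<close>, Jensen's inequality brings the exponential outside, and since one of
  \<open>v + g\<close> and \<open>v - g\<close> sees a point whenever \<open>v\<close> does, the shifted counts dominate the count at \<open>v\<close>.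
\<close>

lemma (in prob_space) uniform_direction_count:
  fixes Y :: "nat \<Rightarrow> 'a \<Rightarrow> nat \<Rightarrow> real"
  assumes fin: "finite Gd" and Y: "\<And>b j. b \<in> Gd \<Longrightarrow> j < d \<Longrightarrow> (\<lambda>\<omega>. Y b \<omega> j) \<in> borel_measurable M"
    and lam: "0 \<le> lam" and c: "0 \<le> c" and s: "\<sigma> > 0" and \<delta>: "0 < \<delta>" "\<delta> < 1"
    and mgf: "\<And>\<theta>. (\<integral>\<^sup>+\<omega>. (\<Prod>b\<in>Gd. ennreal (exp (lam * of_bool (r\<^sup>2 < (ip d \<theta> (Y b \<omega>))\<^sup>2)))) \<partial>M)
        \<le> ennreal (exp (c * qform d S \<theta> \<theta>))"
  shows "\<exists>Z\<in>events. prob Z \<ge> 1 - \<delta> \<and> (\<forall>\<omega>\<in>Z. \<forall>v.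
     lam * real (card {b \<in> Gd. r\<^sup>2 < (ip d v (Y b \<omega>))\<^sup>2})
       \<le> 2 * ln (1 / \<delta>) + ip d v v / \<sigma>\<^sup>2 + 2 * c * (qform d S v v + \<sigma>\<^sup>2 * (\<Sum>i<d. S i i)))"
proof -
  let ?G = "gauss_vec d \<sigma>"
  interpret G: prob_space ?G by (rule prob_space_gauss_vec[OF s])
  interpret P: pair_sigma_finite M ?G ..
  define N where "N \<omega> \<theta> = (\<Sum>b\<in>Gd. of_bool (r\<^sup>2 < (ip d \<theta> (Y b \<omega>))\<^sup>2) :: real)" for \<omega> \<theta>
  define H where "H \<omega> \<theta> = lam * N \<omega> \<theta> - c * qform d S \<theta> \<theta>" for \<omega> \<theta>
  define W where "W \<omega> = (\<integral>\<^sup>+g. ennreal (exp (H \<omega> g)) \<partial>?G)" for \<omega>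
  have comp: "(\<lambda>g. g j) \<in> borel_measurable ?G" if "j < d" for j
    unfolding gauss_vec_def using that measurable_component_singleton[of j "{..<d}" "\<lambda>_. gauss \<sigma>"] by simp
  have comp2: "(\<lambda>p. snd p j) \<in> borel_measurable (M \<Otimes>\<^sub>M ?G)" if "j < d" for j
    using measurable_compose[OF measurable_snd comp[OF that]] .
  have Y2: "(\<lambda>p. Y b (fst p) j) \<in> borel_measurable (M \<Otimes>\<^sub>M ?G)" if "b \<in> Gd" "j < d" for b j
    using measurable_compose[OF measurable_fst Y[OF that]] .
  have Hm: "(\<lambda>p. H (fst p) (snd p)) \<in> borel_measurable (M \<Otimes>\<^sub>M ?G)"
  proof -
    have "(\<lambda>p. ip d (snd p) (Y b (fst p))) \<in> borel_measurable (M \<Otimes>\<^sub>M ?G)" if "b \<in> Gd" for b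
      unfolding ip_def using that by (intro borel_measurable_sum borel_measurable_times comp2 Y2) auto
    then have "(\<lambda>p. of_bool (r\<^sup>2 < (ip d (snd p) (Y b (fst p)))\<^sup>2) :: real) \<in> borel_measurable (M \<Otimes>\<^sub>M ?G)" if "b \<in> Gd" for b
      using that unfolding of_bool_def by measurable
    then have "(\<lambda>p. N (fst p) (snd p)) \<in> borel_measurable (M \<Otimes>\<^sub>M ?G)"
      unfolding N_def by (intro borel_measurable_sum) auto
    moreover have "(\<lambda>p. qform d S (snd p) (snd p)) \<in> borel_measurable (M \<Otimes>\<^sub>M ?G)"
      unfolding qform_def by (intro borel_measurable_sum borel_measurable_times comp2 borel_measurable_const) auto
    ultimately show ?thesis unfolding H_def by (intro borel_measurable_diff borel_measurable_times borel_measurable_const)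
  qed
  have EHm: "(\<lambda>(\<omega>, g). ennreal (exp (H \<omega> g))) \<in> borel_measurable (M \<Otimes>\<^sub>M ?G)"
    unfolding split_beta' using Hm by measurable
  have Wm[measurable]: "W \<in> borel_measurable M"
    unfolding W_def using EHm by (rule G.borel_measurable_nn_integral_fst[unfolded split_beta' fst_conv snd_conv] | rule G.borel_measurable_nn_integral)
  have expN: "ennreal (exp (H \<omega> g)) = (\<Prod>b\<in>Gd. ennreal (exp (lam * of_bool (r\<^sup>2 < (ip d g (Y b \<omega>))\<^sup>2)))) * ennreal (exp (- (c * qform d S g g)))" for \<omega> g
    unfolding H_def N_def diff_conv_add_uminus exp_add sum_distrib_left exp_sum[OF fin]
    by (simp add: ennreal_mult prod_ennreal prod_nonneg)
  have "(\<integral>\<^sup>+\<omega>. W \<omega> \<partial>M) = (\<integral>\<^sup>+g. (\<integral>\<^sup>+\<omega>. ennreal (exp (H \<omega> g)) \<partial>M) \<partial>?G)"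
    unfolding W_def using P.Fubini'[OF EHm] by simp
  also have "\<dots> \<le> (\<integral>\<^sup>+g. 1 \<partial>?G)"
  proof (rule nn_integral_mono)
    fix g assume "g \<in> space ?G"
    have "(\<lambda>\<omega>. ip d g (Y b \<omega>)) \<in> borel_measurable M" if "b \<in> Gd" for b
      unfolding ip_def using that by (intro borel_measurable_sum borel_measurable_times Y) auto
    then have m: "(\<lambda>\<omega>. \<Prod>b\<in>Gd. ennreal (exp (lam * of_bool (r\<^sup>2 < (ip d g (Y b \<omega>))\<^sup>2)))) \<in> borel_measurable M"
      unfolding of_bool_def by (intro borel_measurable_prod_ennreal) measurable
    have "(\<integral>\<^sup>+\<omega>. ennreal (exp (H \<omega> g)) \<partial>M)
        = (\<integral>\<^sup>+\<omega>. (\<Prod>b\<in>Gd. ennreal (exp (lam * of_bool (r\<^sup>2 < (ip d g (Y b \<omega>))\<^sup>2)))) \<partial>M) * ennreal (exp (- (c * qform d S g g)))"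
      unfolding expN by (rule nn_integral_multc[OF m])
    also have "\<dots> \<le> ennreal (exp (c * qform d S g g)) * ennreal (exp (- (c * qform d S g g)))"
      by (intro mult_right_mono mgf) simp
    also have "\<dots> = 1" by (simp add: ennreal_mult[symmetric] exp_add[symmetric])
    finally show "(\<integral>\<^sup>+\<omega>. ennreal (exp (H \<omega> g)) \<partial>M) \<le> 1" .
  qed
  also have "\<dots> = 1" using G.emeasure_space_1 by simp
  finally have EW: "(\<integral>\<^sup>+\<omega>. W \<omega> \<partial>M) \<le> 1" .
  define Bad where "Bad = {\<omega>\<in>space M. 1 \<le> ennreal \<delta> * W \<omega>}"
  have Bm: "Bad \<in> events" unfolding Bad_def by measurable
  have "emeasure M Bad \<le> ennreal \<delta> * (\<integral>\<^sup>+\<omega>. W \<omega> * indicator (space M) \<omega> \<partial>M)"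
    unfolding Bad_def by (rule nn_integral_Markov_inequality) measurable
  also have "(\<integral>\<^sup>+\<omega>. W \<omega> * indicator (space M) \<omega> \<partial>M) = (\<integral>\<^sup>+\<omega>. W \<omega> \<partial>M)"
    by (intro nn_integral_cong) simp
  also have "ennreal \<delta> * (\<integral>\<^sup>+\<omega>. W \<omega> \<partial>M) \<le> ennreal \<delta>" using mult_left_mono[OF EW, of "ennreal \<delta>"] by simp
  finally have "prob Bad \<le> \<delta>" using \<delta> by (simp add: emeasure_eq_measure)
  then have Z: "prob (space M - Bad) \<ge> 1 - \<delta>" using prob_compl[OF Bm] by simp
  have main: "lam * N \<omega> v \<le> 2 * ln (1 / \<delta>) + ip d v v / \<sigma>\<^sup>2 + 2 * c * (qform d S v v + \<sigma>\<^sup>2 * (\<Sum>i<d. S i i))"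
    if \<omega>: "\<omega> \<in> space M - Bad" for \<omega> v
  proof -
    note mom = gauss_vec_moments[OF s, of _ d]
    have \<delta>W: "ennreal \<delta> * W \<omega> < 1" using \<omega> unfolding Bad_def by auto
    define X where "X \<epsilon> g = H \<omega> (affine_map d v \<epsilon> g) - (2 * \<epsilon> * ip d v g + ip d v v) / (2 * \<sigma>\<^sup>2)" for \<epsilon> g
    have intip: "integrable ?G (\<lambda>g. ip d w g)" for w
      unfolding ip_def by (intro Bochner_Integration.integrable_sum integrable_mult_right) (use mom in auto)
    have intq: "integrable ?G (\<lambda>g. qform d S g g)"
      unfolding qform_def using mom(3)
      by (intro Bochner_Integration.integrable_sum) (auto simp: mult.commute[of _ "S _ _"] mult.assoc)
    have Eq: "(\<integral>g. qform d S g g \<partial>?G) = \<sigma>\<^sup>2 * (\<Sum>i<d. S i i)"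
    proof -
      have "(\<integral>g. qform d S g g \<partial>?G) = (\<Sum>i<d. \<Sum>j<d. \<integral>g. S i j * (g i * g j) \<partial>?G)"
        unfolding qform_def using mom(3)
        by (subst Bochner_Integration.integral_sum | intro Bochner_Integration.integrable_sum sum.cong refl | auto simp: mult.commute[of _ "S _ _"] mult.assoc)+
      also have "\<dots> = (\<Sum>i<d. \<Sum>j<d. if j = i then S i i * \<sigma>\<^sup>2 else 0)"
        using mom(4) by (intro sum.cong refl) auto
      finally show ?thesis by (simp add: sum_distrib_left mult.commute)
    qed
    have qvg: "qform d S v g + qform d S g v = ip d (\<lambda>j. \<Sum>i<d. (S i j + S j i) * v i) g" for g
    proof -
      have "qform d S v g = (\<Sum>j<d. (\<Sum>i<d. S i j * v i) * g j)"
        unfolding qform_def by (subst sum.swap) (simp add: sum_distrib_left sum_distrib_right mult_ac)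
      moreover have "qform d S g v = (\<Sum>j<d. (\<Sum>i<d. S j i * v i) * g j)"
        unfolding qform_def by (simp add: sum_distrib_left sum_distrib_right mult_ac)
      ultimately show ?thesis by (simp add: ip_def sum.distrib algebra_simps)
    qed
    have Tm: "affine_map d v \<epsilon> \<in> ?G \<rightarrow>\<^sub>M ?G" for \<epsilon> unfolding affine_map_def gauss_vec_def by measurable
    have Hom: "H \<omega> \<in> borel_measurable ?G"
      using measurable_compose[OF measurable_Pair1'[of \<omega> M ?G] Hm] \<omega> by simp
    have Nm: "(\<lambda>g. N \<omega> (affine_map d v \<epsilon> g)) \<in> borel_measurable ?G" for \<epsilon>
    proof -
      have [measurable]: "(\<lambda>g. ip d w g) \<in> borel_measurable ?G" for w using intip by auto
      show ?thesis unfolding N_def ip_affine_map ip_commute[of d _ "Y _ \<omega>"] of_bool_def by measurable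
    qed
    have Nb: "norm (N \<omega> \<theta>) \<le> real (card Gd)" for \<theta>
      unfolding N_def using sum_mono[of Gd "\<lambda>b. of_bool (r\<^sup>2 < (ip d \<theta> (Y b \<omega>))\<^sup>2)" "\<lambda>_. 1::real"]
      by (simp add: sum_nonneg)
    have intN: "integrable ?G (\<lambda>g. N \<omega> (affine_map d v \<epsilon> g))" for \<epsilon>
      by (rule G.integrable_const_bound[OF _ Nm, where B="real (card Gd)"]) (intro AE_I2 Nb)
    have intX: "integrable ?G (X \<epsilon>)" for \<epsilon>
      unfolding X_def H_def qform_affine_map qvg using intN intip intq by auto
    have low: "G.expectation (X \<epsilon>) < ln (1 / \<delta>)" if e: "\<epsilon> * \<epsilon> = 1" for \<epsilon>
    proof -
      have pt: "ennreal (exp (- (2 * \<epsilon> * ip d v g + ip d v v) / (2 * \<sigma>\<^sup>2))) * ennreal (exp (H \<omega> (affine_map d v \<epsilon> g)))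
          = ennreal (exp (X \<epsilon> g))" for g
      proof -
        have "X \<epsilon> g = - (2 * \<epsilon> * ip d v g + ip d v v) / (2 * \<sigma>\<^sup>2) + H \<omega> (affine_map d v \<epsilon> g)"
          unfolding X_def minus_divide_left[symmetric] by simp
        then show ?thesis by (simp only: exp_add ennreal_mult[OF exp_ge_zero exp_ge_zero])
      qed
      have "(\<lambda>g. ennreal (exp (H \<omega> g))) \<in> borel_measurable ?G" using Hom by measurable
      from gauss_vec_shift[OF s e this, of v]
      have "W \<omega> = (\<integral>\<^sup>+g. ennreal (exp (X \<epsilon> g)) \<partial>?G)" unfolding W_def pt .
      then have "ennreal (exp (G.expectation (X \<epsilon>))) \<le> W \<omega>" using G.exp_expectation_le[OF intX] by simp
      then have "ennreal \<delta> * ennreal (exp (G.expectation (X \<epsilon>))) < 1" using \<delta>W by (meson le_less_trans mult_left_mono zero_le)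
      then have "\<delta> * exp (G.expectation (X \<epsilon>)) < 1" using \<delta> by (simp add: ennreal_mult[symmetric] ennreal_less_one_iff)
      then have "exp (G.expectation (X \<epsilon>)) < 1 / \<delta>" using \<delta> by (simp add: field_simps)
      then have "ln (exp (G.expectation (X \<epsilon>))) < ln (1 / \<delta>)" using \<delta> by (subst ln_less_cancel_iff) auto
      then show ?thesis by simp
    qed
    have "lam * N \<omega> v - c * (2 * qform d S v v + 2 * qform d S g g) - ip d v v / \<sigma>\<^sup>2 \<le> X 1 g + X (-1) g" for g
    proof -
      have "of_bool (r\<^sup>2 < a\<^sup>2) \<le> (of_bool (r\<^sup>2 < (a + b)\<^sup>2) + of_bool (r\<^sup>2 < (a - b)\<^sup>2) :: real)" for a b :: real
      proof -
        have "(a + b)\<^sup>2 + (a - b)\<^sup>2 = 2 * a\<^sup>2 + 2 * b\<^sup>2" by (simp add: power2_eq_square algebra_simps)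
        then have "r\<^sup>2 < a\<^sup>2 \<Longrightarrow> r\<^sup>2 < (a + b)\<^sup>2 \<or> r\<^sup>2 < (a - b)\<^sup>2" using zero_le_power2[of b] by linarith
        then show ?thesis by auto
      qed
      then have "N \<omega> v \<le> N \<omega> (affine_map d v 1 g) + N \<omega> (affine_map d v (-1) g)"
        unfolding N_def ip_affine_map sum.distrib[symmetric] by (intro sum_mono) simp
      then have "lam * N \<omega> v \<le> lam * (N \<omega> (affine_map d v 1 g) + N \<omega> (affine_map d v (-1) g))"
        using lam by (rule mult_left_mono)
      moreover have "X 1 g + X (-1) g = lam * (N \<omega> (affine_map d v 1 g) + N \<omega> (affine_map d v (-1) g))
          - c * (2 * qform d S v v + 2 * qform d S g g) - ip d v v / \<sigma>\<^sup>2"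
        unfolding X_def H_def qform_affine_map by (simp add: algebra_simps add_divide_distrib diff_divide_distrib)
      ultimately show ?thesis by simp
    qed
    then have "G.expectation (\<lambda>g. lam * N \<omega> v - c * (2 * qform d S v v + 2 * qform d S g g) - ip d v v / \<sigma>\<^sup>2)
        \<le> G.expectation (\<lambda>g. X 1 g + X (-1) g)"
      using intX intq by (intro integral_mono) auto
    also have "\<dots> = G.expectation (X 1) + G.expectation (X (-1))" using intX by (intro Bochner_Integration.integral_add)
    also have "\<dots> \<le> 2 * ln (1 / \<delta>)" using low[of 1] low[of "-1"] by simp
    also have "G.expectation (\<lambda>g. lam * N \<omega> v - c * (2 * qform d S v v + 2 * qform d S g g) - ip d v v / \<sigma>\<^sup>2)
        = lam * N \<omega> v - c * (2 * qform d S v v + 2 * (\<sigma>\<^sup>2 * (\<Sum>i<d. S i i))) - ip d v v / \<sigma>\<^sup>2"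
      using intq by (simp add: Eq G.prob_space)
    finally show ?thesis by (simp add: algebra_simps)
  qed
  have card: "N \<omega> v = real (card {b \<in> Gd. r\<^sup>2 < (ip d v (Y b \<omega>))\<^sup>2})" for \<omega> v
    using fin by (simp add: N_def Int_def)
  show ?thesis using Z main Bm unfolding card by (intro bexI[of _ "space M - Bad"]) auto
qed

text \<open>
  Functions of disjoint blocks of independent coordinates are independent.
\<close>

lemma nn_integral_blocks:
  assumes D: "prob_space D" and I: "finite I" and fin: "finite G" and K: "\<And>b. b \<in> G \<Longrightarrow> K b \<subseteq> I"
    and disj: "disjoint_family_on K G" and f: "\<And>b. b \<in> G \<Longrightarrow> f b \<in> borel_measurable (\<Pi>\<^sub>M i\<in>K b. D)"
  shows "(\<integral>\<^sup>+X. (\<Prod>b\<in>G. f b (restrict X (K b))) \<partial>(\<Pi>\<^sub>M i\<in>I. D)) = (\<Prod>b\<in>G. \<integral>\<^sup>+X. f b (restrict X (K b)) \<partial>(\<Pi>\<^sub>M i\<in>I. D))"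
proof (cases "I = {}")
  case True
  interpret D: prob_space D by fact
  interpret P: prob_space "\<Pi>\<^sub>M i\<in>I. D" by (intro prob_space_PiM D)
  have e: "f b (restrict X (K b)) = f b (\<lambda>_. undefined)" if "b \<in> G" for X b
    using K[OF that] True by (simp add: restrict_def)
  have "(\<integral>\<^sup>+X. (\<Prod>b\<in>G. f b (restrict X (K b))) \<partial>(\<Pi>\<^sub>M i\<in>I. D)) = (\<integral>\<^sup>+X. (\<Prod>b\<in>G. f b (\<lambda>_. undefined)) \<partial>(\<Pi>\<^sub>M i\<in>I. D))"
    by (intro nn_integral_cong prod.cong refl e)
  also have "\<dots> = (\<Prod>b\<in>G. f b (\<lambda>_. undefined))" by (simp add: P.emeasure_space_1)
  also have "\<dots> = (\<Prod>b\<in>G. \<integral>\<^sup>+X. f b (restrict X (K b)) \<partial>(\<Pi>\<^sub>M i\<in>I. D))"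
    by (intro prod.cong refl) (simp add: e P.emeasure_space_1)
  finally show ?thesis .
next
  case False
  interpret P: prob_space "\<Pi>\<^sub>M i\<in>I. D" by (intro prob_space_PiM D)
  have "distr (\<Pi>\<^sub>M i\<in>I. D) (\<Pi>\<^sub>M i\<in>I. D) (\<lambda>x. \<lambda>i\<in>I. x i) = distr (\<Pi>\<^sub>M i\<in>I. D) (\<Pi>\<^sub>M i\<in>I. D) (\<lambda>x. x)"
    by (intro distr_cong refl) (auto simp: space_PiM)
  also have "\<dots> = (\<Pi>\<^sub>M i\<in>I. distr (\<Pi>\<^sub>M i\<in>I. D) D (\<lambda>x. x i))"
    unfolding distr_id using D
    by (intro PiM_cong refl distr_PiM_component[of I "\<lambda>_. D", symmetric]) auto
  finally have "P.indep_vars (\<lambda>_. D) (\<lambda>i X. X i) I"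
    by (subst P.indep_vars_iff_distr_eq_PiM'[OF False]) auto
  from P.indep_vars_restrict[OF this K disj]
  have "P.indep_vars (\<lambda>b. \<Pi>\<^sub>M i\<in>K b. D) (\<lambda>b X. restrict X (K b)) G" by simp
  then have "P.indep_vars (\<lambda>_. borel) (\<lambda>b X. f b (restrict X (K b))) G"
    by (rule P.indep_vars_compose2) (use f in auto)
  then show ?thesis by (intro P.indep_vars_nn_integral fin) auto
qed

section \<open>Block means of i.i.d. samples\<close>

text \<open>
  Both arguments bound \<open>\<theta>\<^sup>T \<Sigma> \<theta> / \<parallel>\<theta>\<parallel>\<^sup>2\<close>. The spectral norm gives the right rate; the trace covers the case
  that \<open>log (1/\<delta>)\<close> is much smaller than the number of blocks, which is at least 1.
\<close>

definition cov_bound :: "nat \<Rightarrow> (nat \<Rightarrow> real) measure \<Rightarrow> real" where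
  "cov_bound d D = min (spectral_norm d (cov_mat D)) (trace_mat d (cov_mat D))"

definition dev :: "nat \<Rightarrow> (nat \<Rightarrow> real) measure \<Rightarrow> (nat \<Rightarrow> real) \<Rightarrow> (nat \<Rightarrow> real) \<Rightarrow> real" where
  "dev d D \<theta> x = ip d \<theta> (\<lambda>j. x j - mean_vec D j)"

context
  fixes D :: "(nat \<Rightarrow> real) measure" and d :: nat
  assumes D: "prob_space D" and sets_D: "sets D = sets (Rd d)" and fin: "finite_mean_cov d D"
begin

lemma D_component: "j < d \<Longrightarrow> (\<lambda>x. x j) \<in> borel_measurable D"
  unfolding measurable_cong_sets[OF sets_D refl] Rd_def
  using measurable_component_singleton[of j "{..<d}" "\<lambda>_. borel"] by simp

lemma dev_measurable: "dev d D \<theta> \<in> borel_measurable D"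
  unfolding dev_def ip_def
  by (intro borel_measurable_sum borel_measurable_times borel_measurable_diff borel_measurable_const D_component) auto

lemma dev_moments:
  shows "integrable D (dev d D \<theta>)" "(\<integral>x. dev d D \<theta> x \<partial>D) = 0"
    "integrable D (\<lambda>x. dev d D \<theta> x * dev d D \<theta> x)"
    "(\<integral>x. dev d D \<theta> x * dev d D \<theta> x \<partial>D) = qform d (cov_mat D) \<theta> \<theta>"
proof -
  interpret prob_space D by (rule D)
  have i1: "integrable D (\<lambda>x. x j)" if "j < d" for j using fin that unfolding finite_mean_cov_def by simp
  have i2: "integrable D (\<lambda>x. (x i - mean_vec D i) * (x j - mean_vec D j))" if "i < d" "j < d" for i j
    using fin that unfolding finite_mean_cov_def by simp
  show "integrable D (dev d D \<theta>)"
    unfolding dev_def ip_def using i1 by (intro Bochner_Integration.integrable_sum) auto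
  have "(\<integral>x. dev d D \<theta> x \<partial>D) = (\<Sum>j<d. \<integral>x. \<theta> j * (x j - mean_vec D j) \<partial>D)"
    unfolding dev_def ip_def using i1 by (intro Bochner_Integration.integral_sum) auto
  also have "\<dots> = 0"
    using i1 by (intro sum.neutral ballI) (simp add: prob_space mean_vec_def)
  finally show "(\<integral>x. dev d D \<theta> x \<partial>D) = 0" .
  have sq: "dev d D \<theta> x * dev d D \<theta> x
      = (\<Sum>i<d. \<Sum>j<d. \<theta> i * \<theta> j * ((x i - mean_vec D i) * (x j - mean_vec D j)))" for x
    unfolding dev_def ip_def sum_product by (intro sum.cong refl) (simp add: mult_ac)
  show "integrable D (\<lambda>x. dev d D \<theta> x * dev d D \<theta> x)"
    unfolding sq using i2 by (intro Bochner_Integration.integrable_sum integrable_mult_right) auto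
  have "(\<integral>x. dev d D \<theta> x * dev d D \<theta> x \<partial>D)
      = (\<Sum>i<d. \<integral>x. (\<Sum>j<d. \<theta> i * \<theta> j * ((x i - mean_vec D i) * (x j - mean_vec D j))) \<partial>D)"
    unfolding sq using i2 by (intro Bochner_Integration.integral_sum Bochner_Integration.integrable_sum integrable_mult_right) auto
  also have "\<dots> = (\<Sum>i<d. \<Sum>j<d. \<integral>x. \<theta> i * \<theta> j * ((x i - mean_vec D i) * (x j - mean_vec D j)) \<partial>D)"
    using i2 by (intro sum.cong refl Bochner_Integration.integral_sum integrable_mult_right) auto
  also have "\<dots> = qform d (cov_mat D) \<theta> \<theta>"
    unfolding qform_def cov_mat_def by (intro sum.cong refl) (simp add: mult_ac)
  finally show "(\<integral>x. dev d D \<theta> x * dev d D \<theta> x \<partial>D) = qform d (cov_mat D) \<theta> \<theta>" .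
qed

lemma qform_cov_nonneg: "0 \<le> qform d (cov_mat D) \<theta> \<theta>"
  unfolding dev_moments(4)[symmetric] by (intro integral_nonneg_AE) simp

lemma trace_cov_nonneg: "0 \<le> trace_mat d (cov_mat D)"
  unfolding trace_mat_def cov_mat_def by (intro sum_nonneg integral_nonneg_AE) auto

lemma qform_le_trace: "qform d (cov_mat D) \<theta> \<theta> \<le> trace_mat d (cov_mat D) * ip d \<theta> \<theta>"
proof -
  have i2: "integrable D (\<lambda>x. (x i - mean_vec D i) * (x i - mean_vec D i))" if "i < d" for i
    using fin that unfolding finite_mean_cov_def by simp
  have "qform d (cov_mat D) \<theta> \<theta> \<le> (\<integral>x. ip d \<theta> \<theta> * (\<Sum>i<d. (x i - mean_vec D i) * (x i - mean_vec D i)) \<partial>D)"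
    unfolding dev_moments(4)[symmetric]
  proof (rule integral_mono)
    show "dev d D \<theta> x * dev d D \<theta> x \<le> ip d \<theta> \<theta> * (\<Sum>i<d. (x i - mean_vec D i) * (x i - mean_vec D i))" for x
      using ip_cauchy_schwarz[of d \<theta> "\<lambda>j. x j - mean_vec D j"]
      by (simp add: dev_def power2_eq_square ip_def[of d "\<lambda>j. x j - mean_vec D j"])
  qed (use dev_moments(3) i2 in \<open>auto intro!: Bochner_Integration.integrable_sum integrable_mult_right\<close>)
  also have "\<dots> = ip d \<theta> \<theta> * (\<Sum>i<d. \<integral>x. (x i - mean_vec D i) * (x i - mean_vec D i) \<partial>D)"
    using i2 by (subst integral_mult_right_zero, subst Bochner_Integration.integral_sum) auto
  finally show ?thesis by (simp add: trace_mat_def cov_mat_def mult.commute)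
qed

end

lemma spectral_norm_bdd: "bdd_above ((\<lambda>v. vnorm d (\<lambda>i. \<Sum>j<d. S i j * v j)) ` {v. vnorm d v \<le> 1})"
proof (rule bdd_aboveI2)
  fix v assume "v \<in> {v. vnorm d v \<le> 1}"
  then have v1: "vnorm d v \<le> 1" by simp
  have v: "\<bar>v j\<bar> \<le> 1" if "j < d" for j
  proof -
    have "\<bar>v j\<bar> \<le> vnorm d v"
      using member_le_L2_set[of "{..<d}" j "\<lambda>j. \<bar>v j\<bar>"] that by (simp add: vnorm_def L2_set_def)
    then show ?thesis using v1 by simp
  qed
  have "vnorm d (\<lambda>i. \<Sum>j<d. S i j * v j) \<le> (\<Sum>i<d. \<bar>\<Sum>j<d. S i j * v j\<bar>)"
    unfolding vnorm_def by (rule L2_set_le_sum_abs)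
  also have "\<dots> \<le> (\<Sum>i<d. \<Sum>j<d. \<bar>S i j\<bar>)"
  proof (rule sum_mono)
    fix i
    have "\<bar>\<Sum>j<d. S i j * v j\<bar> \<le> (\<Sum>j<d. \<bar>S i j * v j\<bar>)" by (rule sum_abs)
    also have "\<dots> \<le> (\<Sum>j<d. \<bar>S i j\<bar>)"
      using v by (intro sum_mono) (simp add: abs_mult mult_left_le)
    finally show "\<bar>\<Sum>j<d. S i j * v j\<bar> \<le> (\<Sum>j<d. \<bar>S i j\<bar>)" .
  qed
  finally show "vnorm d (\<lambda>i. \<Sum>j<d. S i j * v j) \<le> (\<Sum>i<d. \<Sum>j<d. \<bar>S i j\<bar>)" .
qed

lemma spectral_norm_nonneg: "0 \<le> spectral_norm d S"
proof -
  have "vnorm d (\<lambda>i. \<Sum>j<d. S i j * (\<lambda>_. 0) j) \<le> spectral_norm d S"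
    unfolding spectral_norm_def by (rule cSUP_upper[OF _ spectral_norm_bdd]) (simp add: vnorm_def L2_set_def)
  then show ?thesis by (simp add: vnorm_def L2_set_def)
qed

lemma qform_le_spectral_norm: "qform d S \<theta> \<theta> \<le> spectral_norm d S * ip d \<theta> \<theta>"
proof (cases "ip d \<theta> \<theta> = 0")
  case True
  then have "\<theta> i = 0" if "i < d" for i
    using that sum_nonneg_eq_0_iff[of "{..<d}" "\<lambda>i. \<theta> i * \<theta> i"] by (simp add: ip_def)
  then show ?thesis by (simp add: qform_def True)
next
  case False
  then have pos: "ip d \<theta> \<theta> > 0" using ip_nonneg[of d \<theta>] by simp
  define n where "n = sqrt (ip d \<theta> \<theta>)"
  have n: "n > 0" "n * n = ip d \<theta> \<theta>" using pos by (auto simp: n_def)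
  define v where "v j = \<theta> j / n" for j
  have "ip d v v = ip d \<theta> \<theta> / (n * n)" by (simp add: v_def ip_def sum_divide_distrib[symmetric])
  then have vv: "ip d v v = 1" using n pos by simp
  define w where "w i = (\<Sum>j<d. S i j * v j)" for i
  have q: "qform d S \<theta> \<theta> = (n * n) * ip d v w"
    unfolding qform_def ip_def w_def v_def sum_distrib_left using n False by (intro sum.cong refl) simp
  have "ip d v w \<le> vnorm d w"
  proof -
    have "(ip d v w)\<^sup>2 \<le> ip d w w" using ip_cauchy_schwarz[of d v w] vv by simp
    then show ?thesis unfolding vnorm_eq_sqrt_ip by (rule real_le_rsqrt)
  qed
  also have "vnorm d w \<le> spectral_norm d S"
    unfolding spectral_norm_def w_def
    by (rule cSUP_upper[OF _ spectral_norm_bdd]) (simp add: vnorm_eq_sqrt_ip vv)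
  finally have "(n * n) * ip d v w \<le> (n * n) * spectral_norm d S" by (intro mult_left_mono) auto
  then show ?thesis unfolding q n(2) by (simp add: mult.commute)
qed

text \<open>
  For \<open>r = 0\<close> the quotient is 0, and the claim says that \<open>X\<close> vanishes almost surely. This case arises for
  distributions concentrated in a point.
\<close>

lemma chebyshev_sq:
  fixes X :: "'a \<Rightarrow> real"
  assumes M: "prob_space M" and X: "integrable M (\<lambda>x. X x * X x)" "X \<in> borel_measurable M"
    and r0: "r = 0 \<Longrightarrow> (\<integral>x. X x * X x \<partial>M) = 0"
  shows "measure M {x \<in> space M. r\<^sup>2 < (X x)\<^sup>2} \<le> (\<integral>x. X x * X x \<partial>M) / r\<^sup>2"
proof -
  interpret prob_space M by fact
  note X(2)[measurable]
  show ?thesis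
  proof (cases "r = 0")
    case True
    then have "AE x in M. X x * X x = 0"
      using r0 integral_nonneg_eq_0_iff_AE[OF X(1)] by simp
    then have "prob {x \<in> space M. r\<^sup>2 < (X x)\<^sup>2} = 0"
      using True by (subst prob_eq_0) auto
    then show ?thesis using True by simp
  next
    case False
    have "prob {x \<in> space M. r\<^sup>2 < (X x)\<^sup>2} \<le> prob {x \<in> space M. X x * X x \<ge> r\<^sup>2}"
      by (intro finite_measure_mono) (auto simp: power2_eq_square)
    also have "\<dots> \<le> (\<integral>x. X x * X x \<partial>M) / r\<^sup>2"
      using False by (intro integral_Markov_inequality_measure[where A="{}"] X) auto
    finally show ?thesis .
  qed
qed

definition block :: "nat \<Rightarrow> nat \<Rightarrow> nat set" where
  "block s b = {b * s..<b * s + s}"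

lemma card_block: "card (block s b) = s" "finite (block s b)"
  by (simp_all add: block_def)

lemma block_subset: "b < k \<Longrightarrow> k * s \<le> n \<Longrightarrow> block s b \<subseteq> {..<n}"
proof -
  assume "b < k" "k * s \<le> n"
  then have "b * s + s \<le> n" using mult_le_mono1[of "Suc b" k s] by simp
  then show ?thesis by (auto simp: block_def)
qed

lemma block_disjoint: "disjoint_family_on (block s) G"
proof (unfold disjoint_family_on_def, intro ballI impI)
  fix b c :: nat assume "b \<noteq> c"
  have "b * s + s \<le> c * s" if "b < c" for b c :: nat using that mult_le_mono1[of "Suc b" c s] by simp
  then have "b * s + s \<le> c * s \<or> c * s + s \<le> b * s" using \<open>b \<noteq> c\<close> nat_neq_iff by blast
  then show "block s b \<inter> block s c = {}" by (auto simp: block_def)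
qed

text \<open>
  The blocks are disjoint, so distinct blocks contain distinct elements of \<open>B\<close>.
\<close>

lemma card_blocks_meeting:
  assumes "finite B"
  shows "card {b. b < k \<and> block s b \<inter> B \<noteq> {}} \<le> card B"
proof -
  define f where "f b = (SOME i. i \<in> block s b \<inter> B)" for b
  have f: "f b \<in> block s b \<inter> B" if "block s b \<inter> B \<noteq> {}" for b
    unfolding f_def using that by (metis some_in_eq)
  have "inj_on f {b. b < k \<and> block s b \<inter> B \<noteq> {}}"
  proof (rule inj_onI)
    fix b c assume "b \<in> {b. b < k \<and> block s b \<inter> B \<noteq> {}}" "c \<in> {b. b < k \<and> block s b \<inter> B \<noteq> {}}" "f b = f c"
    then have "f b \<in> block s b \<inter> block s c" using f[of b] f[of c] by auto
    then show "b = c" using block_disjoint[of s UNIV] unfolding disjoint_family_on_def by blast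
  qed
  moreover have "f ` {b. b < k \<and> block s b \<inter> B \<noteq> {}} \<subseteq> B" using f by auto
  ultimately show ?thesis using assms by (rule card_inj_on_le)
qed

definition block_mean :: "nat \<Rightarrow> (nat \<Rightarrow> nat \<Rightarrow> real) \<Rightarrow> nat \<Rightarrow> nat \<Rightarrow> real" where
  "block_mean s X b j = (\<Sum>i\<in>block s b. X i j) / real s"


context
  fixes D :: "(nat \<Rightarrow> real) measure" and d :: nat
  assumes D: "prob_space D" and sets_D: "sets D = sets (Rd d)" and fin: "finite_mean_cov d D"
begin

lemma block_mean_dev:
  assumes "s > 0"
  shows "ip d \<theta> (\<lambda>j. block_mean s X b j - mean_vec D j) = (\<Sum>i\<in>block s b. dev d D \<theta> (X i)) / real s"
proof -
  have "(\<Sum>i\<in>block s b. dev d D \<theta> (X i)) = ip d \<theta> (\<lambda>j. \<Sum>i\<in>block s b. X i j) - real s * ip d \<theta> (mean_vec D)"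
    unfolding dev_def ip_diff_right ip_sum_right sum_subtractf by (simp add: card_block)
  then show ?thesis using assms
    unfolding ip_diff_right block_mean_def ip_divide_right by (simp add: diff_divide_distrib)
qed

lemma block_second_moment:
  fixes \<theta> :: "nat \<Rightarrow> real"
  assumes I: "finite I" "block s b \<subseteq> I" and s: "s > 0"
  defines "h \<equiv> \<lambda>X. ip d \<theta> (\<lambda>j. block_mean s X b j - mean_vec D j)"
  shows "integrable (\<Pi>\<^sub>M i\<in>I. D) (\<lambda>X. h X * h X)"
    and "(\<integral>X. h X * h X \<partial>(\<Pi>\<^sub>M i\<in>I. D)) = qform d (cov_mat D) \<theta> \<theta> / real s"
    and "h \<in> borel_measurable (\<Pi>\<^sub>M i\<in>I. D)"
proof -
  note dm = dev_moments[OF D sets_D fin, of \<theta>]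
  note pm = PiM_pair_moment[OF D I(1) _ _ dm(1) dm(1) dm(3)]
  have mem: "i \<in> I" if "i \<in> block s b" for i using that I(2) by auto
  have sq: "h X * h X = (\<Sum>i\<in>block s b. \<Sum>l\<in>block s b. dev d D \<theta> (X i) * dev d D \<theta> (X l)) / (real s * real s)" for X
    unfolding h_def block_mean_dev[OF s] by (simp add: sum_product)
  show "integrable (\<Pi>\<^sub>M i\<in>I. D) (\<lambda>X. h X * h X)"
    unfolding sq by (intro integrable_divide_zero Bochner_Integration.integrable_sum pm(1) mem)
  have "(\<integral>X. h X * h X \<partial>(\<Pi>\<^sub>M i\<in>I. D))
      = (\<integral>X. (\<Sum>i\<in>block s b. \<Sum>l\<in>block s b. dev d D \<theta> (X i) * dev d D \<theta> (X l)) \<partial>(\<Pi>\<^sub>M i\<in>I. D)) / (real s * real s)"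
    unfolding sq by simp
  also have "(\<integral>X. (\<Sum>i\<in>block s b. \<Sum>l\<in>block s b. dev d D \<theta> (X i) * dev d D \<theta> (X l)) \<partial>(\<Pi>\<^sub>M i\<in>I. D))
      = (\<Sum>i\<in>block s b. \<integral>X. (\<Sum>l\<in>block s b. dev d D \<theta> (X i) * dev d D \<theta> (X l)) \<partial>(\<Pi>\<^sub>M i\<in>I. D))"
    by (intro Bochner_Integration.integral_sum Bochner_Integration.integrable_sum pm(1) mem)
  also have "\<dots> = (\<Sum>i\<in>block s b. \<Sum>l\<in>block s b. \<integral>X. dev d D \<theta> (X i) * dev d D \<theta> (X l) \<partial>(\<Pi>\<^sub>M i\<in>I. D))"
    by (intro sum.cong refl Bochner_Integration.integral_sum pm(1) mem)
  also have "\<dots> = (\<Sum>i\<in>block s b. \<Sum>l\<in>block s b. if i = l then qform d (cov_mat D) \<theta> \<theta> else 0)"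
    using mem by (intro sum.cong refl) (simp add: pm(2) dm(2) dm(4))
  also have "\<dots> = real s * qform d (cov_mat D) \<theta> \<theta>"
    by (simp add: card_block)
  finally show "(\<integral>X. h X * h X \<partial>(\<Pi>\<^sub>M i\<in>I. D)) = qform d (cov_mat D) \<theta> \<theta> / real s"
    using s by simp
  show "h \<in> borel_measurable (\<Pi>\<^sub>M i\<in>I. D)"
    unfolding h_def block_mean_dev[OF s]
    by (intro borel_measurable_divide borel_measurable_sum borel_measurable_const
        measurable_compose[OF measurable_component_singleton[of _ I "\<lambda>_. D"] dev_measurable[OF D sets_D fin]] mem)
qed

text \<open>
  The bound of \<open>uniform_direction_count\<close> is used with exponent 20 and \<open>\<sigma>\<^sup>2 = 500 / k\<close>. Passing to families costs the
  factor 10, after which \<open>log (1/\<delta>)\<close> contributes at most \<open>k / 3600\<close>, the translation of the Gaussian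
  \<open>k / 1000\<close>, and the covariance another \<open>k / 1000\<close> by the choice of the constant in \<open>r\<close>. The sum stays below
  \<open>k / 200\<close>, and the blocks that meet \<open>B\<close> are at most \<open>k / 200\<close> more.
\<close>

theorem dispersed_whp:
  assumes I: "finite I" and s: "s > 0" and k: "k > 0" and ks: "k * s \<le> n"
    and B: "finite B" "real (card B) \<le> real k / 200" and I_def: "I = {..<n} - B"
    and \<delta>: "0 < \<delta>" "\<delta> < 1" "ln (1 / \<delta>) \<le> real k / 3600"
    and r: "0 \<le> r" "r\<^sup>2 = 500000 * exp 20 * (cov_bound d D + trace_mat d (cov_mat D) / real k) / real s"
  shows "\<exists>Z\<in>sets (\<Pi>\<^sub>M i\<in>I. D). measure (\<Pi>\<^sub>M i\<in>I. D) Z \<ge> 1 - \<delta> \<and>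
    (\<forall>X\<in>Z. \<forall>z. (\<forall>b<k. block s b \<inter> B = {} \<longrightarrow> (\<forall>j<d. z b j = block_mean s X b j))
       \<longrightarrow> dispersed d k z (mean_vec D) (sqrt 2 * r))"
proof -
  let ?M = "\<Pi>\<^sub>M i\<in>I. D" and ?S = "cov_mat D"
  interpret P: prob_space ?M by (intro prob_space_PiM D)
  define Gd where "Gd = {b. b < k \<and> block s b \<inter> B = {}}"
  define Y where "Y b X = (\<lambda>j. block_mean s X b j - mean_vec D j)" for b X
  define \<rho> where "\<rho> = cov_bound d D"
  define Tr where "Tr = trace_mat d ?S"
  define kk where "kk = (exp 20 :: real)"
  define c where "c = kk * real k / (real s * r\<^sup>2)"
  define \<sigma> where "\<sigma> = sqrt (500 / real k)"
  have \<sigma>: "\<sigma> > 0" "\<sigma>\<^sup>2 = 500 / real k" using k by (simp_all add: \<sigma>_def)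
  have finGd: "finite Gd" unfolding Gd_def by simp
  have sub: "block s b \<subseteq> I" if "b \<in> Gd" for b
    using that block_subset[of b k s n] ks unfolding Gd_def I_def by auto
  have Tr: "0 \<le> Tr" unfolding Tr_def by (rule trace_cov_nonneg[OF D sets_D fin])
  have \<rho>: "0 \<le> \<rho>" using Tr spectral_norm_nonneg[of d ?S] by (simp add: \<rho>_def cov_bound_def Tr_def)
  have q\<rho>: "qform d ?S v v \<le> \<rho> * ip d v v" for v
    using qform_le_trace[OF D sets_D fin, of v] qform_le_spectral_norm[of d ?S v]
    by (simp add: \<rho>_def cov_bound_def min_def)
  have qn: "0 \<le> qform d ?S v v" for v by (rule qform_cov_nonneg[OF D sets_D fin])
  have kk: "kk > 0" by (simp add: kk_def)
  have r2: "r\<^sup>2 = 500000 * kk * (\<rho> + Tr / real k) / real s" using r(2) by (simp add: \<rho>_def Tr_def kk_def)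
  have c: "0 \<le> c" using kk by (simp add: c_def)
  have r0: "\<rho> = 0" if "r = 0"
  proof -
    have "\<rho> + Tr / real k = 0" using r2 that kk s by simp
    moreover have "0 \<le> Tr / real k" using Tr by simp
    ultimately show ?thesis using \<rho> by linarith
  qed
  have cbound: "c * (\<rho> + Tr / real k) \<le> real k / 500000"
  proof (cases "r = 0")
    case False
    have "c * (\<rho> + Tr / real k) = real k * (500000 * kk * (\<rho> + Tr / real k) / real s) / (500000 * r\<^sup>2)"
      by (simp add: c_def)
    also have "\<dots> = real k / 500000" unfolding r2[symmetric] using False by simp
    finally show ?thesis by simp
  qed (simp add: c_def)
  have Ycomp: "(\<lambda>X. Y b X j) \<in> borel_measurable ?M" if b: "b \<in> Gd" and j: "j < d" for b j
  proof -
    have "ip d (unit_vec j) (Y b X) = Y b X j" for X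
      by (subst ip_commute) (rule ip_unit_vec[OF j])
    then show ?thesis using block_second_moment(3)[OF I sub[OF b] s, of "unit_vec j"] by (simp add: Y_def[symmetric])
  qed
  have one: "(\<integral>\<^sup>+X. ennreal (exp (20 * of_bool (r\<^sup>2 < (ip d \<theta> (Y b X))\<^sup>2))) \<partial>?M)
      \<le> ennreal (exp (kk * (qform d ?S \<theta> \<theta> / (real s * r\<^sup>2))))" if b: "b \<in> Gd" for b \<theta>
  proof -
    note m = block_second_moment[OF I sub[OF b] s, of \<theta>, folded Y_def]
    define E where "E = {X \<in> space ?M. r\<^sup>2 < (ip d \<theta> (Y b X))\<^sup>2}"
    have E[measurable]: "E \<in> sets ?M" unfolding E_def using m(3) by measurable
    have "r = 0 \<Longrightarrow> qform d ?S \<theta> \<theta> = 0" using q\<rho>[of \<theta>] qn[of \<theta>] r0 by simp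
    then have p: "measure ?M E \<le> qform d ?S \<theta> \<theta> / (real s * r\<^sup>2)"
      using chebyshev_sq[OF P.prob_space_axioms m(1) m(3), of r] unfolding m(2) E_def by simp
    have "(\<integral>\<^sup>+X. ennreal (exp (20 * of_bool (r\<^sup>2 < (ip d \<theta> (Y b X))\<^sup>2))) \<partial>?M)
        = (\<integral>\<^sup>+X. 1 + ennreal (kk - 1) * indicator E X \<partial>?M)"
    proof (intro nn_integral_cong)
      fix X assume X: "X \<in> space ?M"
      have "ennreal kk = 1 + ennreal (kk - 1)"
        using ennreal_plus[of 1 "kk - 1"] by (simp add: kk_def)
      then show "ennreal (exp (20 * of_bool (r\<^sup>2 < (ip d \<theta> (Y b X))\<^sup>2))) = 1 + ennreal (kk - 1) * indicator E X"
        using X by (simp add: E_def indicator_def kk_def)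
    qed
    also have "\<dots> = 1 + ennreal (kk - 1) * emeasure ?M E"
      by (subst nn_integral_add) (auto simp: nn_integral_cmult P.emeasure_space_1)
    also have "\<dots> = ennreal (1 + (kk - 1) * measure ?M E)"
      by (simp add: P.emeasure_eq_measure ennreal_mult kk_def)
    also have "\<dots> \<le> ennreal (exp (kk * (qform d ?S \<theta> \<theta> / (real s * r\<^sup>2))))"
    proof (rule ennreal_leI)
      have "(kk - 1) * measure ?M E \<le> kk * (qform d ?S \<theta> \<theta> / (real s * r\<^sup>2))"
        using p kk by (intro mult_mono) auto
      then show "1 + (kk - 1) * measure ?M E \<le> exp (kk * (qform d ?S \<theta> \<theta> / (real s * r\<^sup>2)))"
        using exp_ge_add_one_self[of "kk * (qform d ?S \<theta> \<theta> / (real s * r\<^sup>2))"] by linarith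
    qed
    finally show ?thesis .
  qed
  have mgf: "(\<integral>\<^sup>+X. (\<Prod>b\<in>Gd. ennreal (exp (20 * of_bool (r\<^sup>2 < (ip d \<theta> (Y b X))\<^sup>2)))) \<partial>?M)
      \<le> ennreal (exp (c * qform d ?S \<theta> \<theta>))" for \<theta>
  proof -
    define f where "f b X = ennreal (exp (20 * of_bool (r\<^sup>2 < (ip d \<theta> (Y b X))\<^sup>2)))" for b X
    have fr: "f b (restrict X (block s b)) = f b X" for b X
      unfolding f_def Y_def block_mean_def by simp
    have fm: "f b \<in> borel_measurable (\<Pi>\<^sub>M i\<in>block s b. D)" for b
      using block_second_moment(3)[of "block s b" s b \<theta>] s unfolding f_def Y_def of_bool_def
      by (simp add: card_block)
    have "(\<integral>\<^sup>+X. (\<Prod>b\<in>Gd. f b X) \<partial>?M) = (\<Prod>b\<in>Gd. \<integral>\<^sup>+X. f b X \<partial>?M)"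
      using nn_integral_blocks[OF D I finGd sub block_disjoint fm] unfolding fr .
    also have "\<dots> \<le> (\<Prod>b\<in>Gd. ennreal (exp (kk * (qform d ?S \<theta> \<theta> / (real s * r\<^sup>2)))))"
      unfolding f_def by (intro prod_mono_ennreal one)
    also have "\<dots> = ennreal (exp (real (card Gd) * (kk * (qform d ?S \<theta> \<theta> / (real s * r\<^sup>2)))))"
      by (simp only: prod_constant ennreal_power[OF exp_ge_zero] exp_of_nat_mult)
    also have "\<dots> \<le> ennreal (exp (c * qform d ?S \<theta> \<theta>))"
    proof (intro ennreal_leI, simp)
      have "card Gd \<le> card {..<k}" unfolding Gd_def by (intro card_mono) auto
      then have "real (card Gd) * (kk * (qform d ?S \<theta> \<theta> / (real s * r\<^sup>2))) \<le> real k * (kk * (qform d ?S \<theta> \<theta> / (real s * r\<^sup>2)))"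
        using kk qn by (intro mult_right_mono) auto
      then show "real (card Gd) * (kk * qform d ?S \<theta> \<theta>) / (real s * r\<^sup>2) \<le> c * qform d ?S \<theta> \<theta>"
        by (simp add: c_def mult_ac)
    qed
    finally show ?thesis unfolding f_def .
  qed
  from P.uniform_direction_count[OF finGd Ycomp _ c \<sigma>(1) \<delta>(1,2) mgf]
  obtain Z where Z: "Z \<in> sets ?M" "measure ?M Z \<ge> 1 - \<delta>" and
    cnt: "\<And>X v. X \<in> Z \<Longrightarrow> 20 * real (card {b \<in> Gd. r\<^sup>2 < (ip d v (Y b X))\<^sup>2})
      \<le> 2 * ln (1 / \<delta>) + ip d v v / \<sigma>\<^sup>2 + 2 * c * (qform d ?S v v + \<sigma>\<^sup>2 * (\<Sum>i<d. ?S i i))"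
    by auto
  have "dispersed d k z (mean_vec D) (sqrt 2 * r)"
    if X: "X \<in> Z" and z: "\<forall>b<k. block s b \<inter> B = {} \<longrightarrow> (\<forall>j<d. z b j = block_mean s X b j)" for X z
    unfolding dispersed_def
  proof (intro allI impI)
    fix J :: "(nat \<times> nat) set" and v :: "nat \<times> nat \<Rightarrow> nat \<Rightarrow> real"
    assume J: "finite J"
    define a where "a = (2 * ln (1 / \<delta>) + 2 * c * (\<sigma>\<^sup>2 * Tr)) / 20"
    define e where "e = (real k / 500 + 2 * c * \<rho>) / 20"
    have e: "0 \<le> e" unfolding e_def using c \<rho> by simp
    have dir: "real (card {b \<in> Gd. r\<^sup>2 < (ip d w (Y b X))\<^sup>2}) \<le> a + e * ip d w w" for w
    proof -
      have "c * qform d ?S w w \<le> c * (\<rho> * ip d w w)" using q\<rho> c by (intro mult_left_mono)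
      then have up: "2 * c * (qform d ?S w w + \<sigma>\<^sup>2 * Tr) \<le> 2 * (c * (\<rho> * ip d w w)) + 2 * (c * (\<sigma>\<^sup>2 * Tr))"
        by (simp add: distrib_left)
      have div: "ip d w w / \<sigma>\<^sup>2 = real k / 500 * ip d w w" unfolding \<sigma>(2) by simp
      have "20 * real (card {b \<in> Gd. r\<^sup>2 < (ip d w (Y b X))\<^sup>2})
          \<le> 2 * ln (1 / \<delta>) + real k / 500 * ip d w w + 2 * c * (qform d ?S w w + \<sigma>\<^sup>2 * Tr)"
        using cnt[OF X, of w] unfolding div Tr_def trace_mat_def .
      also have "\<dots> \<le> 2 * ln (1 / \<delta>) + real k / 500 * ip d w w + (2 * (c * (\<rho> * ip d w w)) + 2 * (c * (\<sigma>\<^sup>2 * Tr)))"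
        using up by (intro add_left_mono)
      also have "\<dots> = 20 * (a + e * ip d w w)" unfolding a_def e_def by (simp add: algebra_simps add_divide_distrib)
      finally show ?thesis by simp
    qed
    have "10 * (a + e) = ln (1 / \<delta>) + c * (\<rho> + 500 * (Tr / real k)) + real k / 1000"
      unfolding a_def e_def \<sigma>(2) by (simp add: algebra_simps add_divide_distrib)
    also have "\<dots> \<le> real k / 3600 + 500 * (real k / 500000) + real k / 1000"
    proof (intro add_mono \<delta>(3) order_refl)
      have "c * (\<rho> + 500 * (Tr / real k)) \<le> c * (500 * (\<rho> + Tr / real k))"
        using \<rho> c by (intro mult_left_mono) auto
      also have "\<dots> = 500 * (c * (\<rho> + Tr / real k))" by (rule mult.left_commute)
      also have "\<dots> \<le> 500 * (real k / 500000)" using cbound by (intro mult_left_mono) auto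
      finally show "c * (\<rho> + 500 * (Tr / real k)) \<le> 500 * (real k / 500000)" .
    qed
    also have "\<dots> \<le> real k / 200" by simp
    finally have ae: "10 * (a + e) \<le> real k / 200" .
    let ?T = "\<Sum>s\<in>J. ip d (v s) (v s)"
    define A where "A = {i. i < k \<and> (sqrt 2 * r)\<^sup>2 * ?T < (\<Sum>s\<in>J. (ip d (v s) (\<lambda>j. z i j - mean_vec D j))\<^sup>2)}"
    define A1 where "A1 = {b \<in> Gd. 2 * r\<^sup>2 * ?T < (\<Sum>s\<in>J. (ip d (v s) (Y b X))\<^sup>2)}"
    define A2 where "A2 = {b. b < k \<and> block s b \<inter> B \<noteq> {}}"
    have "A \<subseteq> A1 \<union> A2"
    proof
      fix i assume i: "i \<in> A"
      show "i \<in> A1 \<union> A2"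
      proof (cases "block s i \<inter> B = {}")
        case True
        then have "i \<in> Gd" using i by (simp add: A_def Gd_def)
        moreover have "ip d (v t) (\<lambda>j. z i j - mean_vec D j) = ip d (v t) (Y i X)" for t
          using z True i by (intro ip_cong) (auto simp: A_def Y_def)
        ultimately show ?thesis using i by (simp add: A_def A1_def power_mult_distrib)
      qed (use i in \<open>simp add: A_def A2_def\<close>)
    qed
    then have "card A \<le> card (A1 \<union> A2)" using finGd by (intro card_mono) (auto simp: A1_def A2_def)
    also have "\<dots> \<le> card A1 + card A2" by (rule card_Un_le)
    finally have "real (card A) \<le> real (card A1) + real (card A2)" by linarith
    also have "real (card A1) \<le> real k / 200"
      using families_of_directions[OF finGd J e dir] ae unfolding A1_def by (rule order_trans)
    also have "real (card A2) \<le> real k / 200"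
      using card_blocks_meeting[OF B(1), of k s] B(2) unfolding A2_def by linarith
    finally show "real (card {i. i < k \<and> (sqrt 2 * r)\<^sup>2 * ?T < (\<Sum>s\<in>J. (ip d (v s) (\<lambda>j. z i j - mean_vec D j))\<^sup>2)})
      \<le> real k / 100" unfolding A_def by simp
  qed
  with Z show ?thesis by blast
qed

end

section \<open>Reasoning about programs and their cost\<close>

text \<open>
  The registers and arrays a command may write. Specifications below state only what a command computes;
  that everything else is unchanged follows from these sets.
\<close>

primrec wregs :: "com \<Rightarrow> nat set" where
  "wregs Skip = {}"
| "wregs (NAssign r e) = {r}"
| "wregs (RAssign a i j e) = {}"
| "wregs (Draw a i j) = {}"
| "wregs (Seq c1 c2) = wregs c1 \<union> wregs c2"
| "wregs (If b c1 c2) = wregs c1 \<union> wregs c2"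
| "wregs (While b c) = wregs c"

primrec warrs :: "com \<Rightarrow> nat set" where
  "warrs Skip = {}"
| "warrs (NAssign r e) = {}"
| "warrs (RAssign a i j e) = {a}"
| "warrs (Draw a i j) = {a}"
| "warrs (Seq c1 c2) = warrs c1 \<union> warrs c2"
| "warrs (If b c1 c2) = warrs c1 \<union> warrs c2"
| "warrs (While b c) = warrs c"

definition agree :: "nat set \<Rightarrow> nat set \<Rightarrow> state \<Rightarrow> state \<Rightarrow> bool" where
  "agree R A s s' \<longleftrightarrow> (\<forall>r. r \<notin> R \<longrightarrow> reg s' r = reg s r) \<and>
     (\<forall>a i j. a \<notin> A \<longrightarrow> cell s' (a, i, j) = cell s (a, i, j))"

lemma agree_reg: "agree R A s s' \<Longrightarrow> r \<notin> R \<Longrightarrow> reg s' r = reg s r"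
  by (simp add: agree_def)

lemma exec_agree: "exec u c s t s' \<Longrightarrow> agree (wregs c) (warrs c) s s'"
  by (induction rule: exec.induct) (auto simp: agree_def)

lemma exec_SeqI:
  assumes "\<exists>t s1. exec u c1 s t s1 \<and> t \<le> T1 \<and> Q s1"
    and "\<And>s1. Q s1 \<Longrightarrow> agree (wregs c1) (warrs c1) s s1 \<Longrightarrow> \<exists>t s2. exec u c2 s1 t s2 \<and> t \<le> T2 \<and> R s2"
  shows "\<exists>t s2. exec u (Seq c1 c2) s t s2 \<and> t \<le> 1 + T1 + T2 \<and> R s2"
proof -
  obtain t1 s1 where 1: "exec u c1 s t1 s1" "t1 \<le> T1" "Q s1" using assms(1) by blast
  obtain t2 s2 where 2: "exec u c2 s1 t2 s2" "t2 \<le> T2" "R s2"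
    using assms(2)[OF 1(3) exec_agree[OF 1(1)]] by blast
  show ?thesis using exec.Seq[OF 1(1) 2(1)] 1(2) 2(2,3) by (intro exI[of _ "1 + t1 + t2"] exI[of _ s2]) auto
qed

lemma exec_weaken:
  assumes "\<exists>t s1. exec u c s t s1 \<and> t \<le> T \<and> Q s1" "T \<le> T'"
    and "\<And>s1. Q s1 \<Longrightarrow> agree (wregs c) (warrs c) s s1 \<Longrightarrow> R s1"
  shows "\<exists>t s1. exec u c s t s1 \<and> t \<le> T' \<and> R s1"
  using assms exec_agree by (meson order_trans)

lemma exec_RAssignI:
  "Q (s\<lparr>cell := (cell s)((a, nval i s, nval j s) := rval e s)\<rparr>) \<Longrightarrow>
    \<exists>t s1. exec u (RAssign a i j e) s t s1 \<and> t \<le> 1 + ncost i + ncost j + rcost e \<and> Q s1"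
  using exec.RAssign by blast

lemma exec_NAssignI:
  "Q (s\<lparr>reg := (reg s)(r := nval e s)\<rparr>) \<Longrightarrow>
    \<exists>t s1. exec u (NAssign r e) s t s1 \<and> t \<le> 1 + ncost e \<and> Q s1"
  using exec.NAssign by blast

lemma exec_IfI:
  assumes "bval b s \<Longrightarrow> \<exists>t s1. exec u c1 s t s1 \<and> t \<le> T \<and> Q s1"
    and "\<not> bval b s \<Longrightarrow> \<exists>t s1. exec u c2 s t s1 \<and> t \<le> T \<and> Q s1"
  shows "\<exists>t s1. exec u (If b c1 c2) s t s1 \<and> t \<le> 1 + bcost b + T \<and> Q s1"
proof (cases "bval b s")
  case True
  with assms(1) obtain t s1 where "exec u c1 s t s1" "t \<le> T" "Q s1" by blast
  then show ?thesis using exec.IfTrue[OF True, of u c1 t s1 c2]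
    by (intro exI[of _ "1 + bcost b + t"] exI[of _ s1]) auto
next
  case False
  with assms(2) obtain t s1 where "exec u c2 s t s1" "t \<le> T" "Q s1" by blast
  then show ?thesis using exec.IfFalse[OF False, of u c2 t s1 c1]
    by (intro exI[of _ "1 + bcost b + t"] exI[of _ s1]) auto
qed

lemma exec_SkipI: "Q s \<Longrightarrow> 1 \<le> T \<Longrightarrow> \<exists>t s1. exec u Skip s t s1 \<and> t \<le> T \<and> Q s1"
  using exec.Skip by blast

text \<open>
  The number of iterations is known in advance in all applications, which makes the invariant depend on
  the iteration and gives termination and cost at once.
\<close>

lemma exec_WhileI:
  assumes init: "Inv 0 s"
    and step: "\<And>i s1. i < n \<Longrightarrow> Inv i s1 \<Longrightarrow> bval b s1 \<and> (\<exists>t s2. exec u c s1 t s2 \<and> t \<le> T \<and> Inv (Suc i) s2)"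
    and stop: "\<And>s1. Inv n s1 \<Longrightarrow> \<not> bval b s1"
  shows "\<exists>t s'. exec u (While b c) s t s' \<and> t \<le> (n + 1) * (1 + bcost b + T) \<and> Inv n s'"
proof -
  have "i \<le> n \<Longrightarrow> Inv i s \<Longrightarrow>
      \<exists>t s'. exec u (While b c) s t s' \<and> t \<le> (n - i + 1) * (1 + bcost b + T) \<and> Inv n s'" for i s
  proof (induction "n - i" arbitrary: i s)
    case 0
    then have "i = n" by simp
    with 0 stop exec.WhileFalse[of b s u c] show ?case
      by (intro exI[of _ "1 + bcost b"] exI[of _ s]) auto
  next
    case (Suc m)
    then have i: "i < n" and m: "m = n - Suc i" by simp_all
    obtain t1 s1 where 1: "bval b s" "exec u c s t1 s1" "t1 \<le> T" "Inv (Suc i) s1"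
      using step[OF i Suc.prems(2)] by blast
    obtain t2 s2 where 2: "exec u (While b c) s1 t2 s2" "t2 \<le> (n - Suc i + 1) * (1 + bcost b + T)" "Inv n s2"
      using Suc.hyps(1)[OF m Suc_leI[OF i] 1(4)] by blast
    have "n - i + 1 = Suc (n - Suc i + 1)" using i by simp
    then have "1 + bcost b + t1 + t2 \<le> (n - i + 1) * (1 + bcost b + T)"
      using 1(3) 2(2) by simp
    with exec.WhileTrue[OF 1(1,2) 2(1)] 2(3) show ?case by blast
  qed
  from this[of 0 s] init show ?thesis by simp
qed

definition For :: "nat \<Rightarrow> nexp \<Rightarrow> com \<Rightarrow> com" where
  "For r e c = Seq (NAssign r (NConst 0)) (While (NLess (NReg r) e) (Seq c (NAssign r (NAdd (NReg r) (NConst 1)))))"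

lemma writes_For [simp]: "wregs (For r e c) = insert r (wregs c)" "warrs (For r e c) = warrs c"
  by (auto simp: For_def)

text \<open>
  The body may assume that only its own targets have changed since the loop was entered, so
  invariants need to describe nothing but what the loop computes.
\<close>

lemma exec_For:
  assumes r: "r \<notin> wregs c"
    and bound: "\<And>s1. agree (insert r (wregs c)) (warrs c) s s1 \<Longrightarrow> nval e s1 = n"
    and init: "Inv 0 (s\<lparr>reg := (reg s)(r := 0)\<rparr>)"
    and inv: "\<And>i s1. Inv i s1 \<Longrightarrow> Inv i (s1\<lparr>reg := (reg s1)(r := i)\<rparr>)"
    and step: "\<And>i s1. i < n \<Longrightarrow> agree (insert r (wregs c)) (warrs c) s s1 \<Longrightarrow> reg s1 r = i \<Longrightarrow> Inv i s1 \<Longrightarrow>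
      \<exists>t s2. exec u c s1 t s2 \<and> t \<le> T \<and> Inv (Suc i) s2"
  shows "\<exists>t s'. exec u (For r e c) s t s' \<and> t \<le> (n + 1) * (T + ncost e + 12) \<and> Inv n s'"
proof -
  let ?A = "agree (insert r (wregs c)) (warrs c) s"
  let ?Inv = "\<lambda>i s1. ?A s1 \<and> reg s1 r = i \<and> Inv i s1"
  have "\<exists>t s'. exec u (For r e c) s t s' \<and>
      t \<le> 1 + (1 + ncost (NConst 0)) + (n + 1) * (1 + bcost (NLess (NReg r) e) + (1 + T + (1 + ncost (NAdd (NReg r) (NConst 1))))) \<and> ?Inv n s'"
    unfolding For_def
  proof (rule exec_SeqI[OF exec_NAssignI[where Q = "\<lambda>s1. s1 = s\<lparr>reg := (reg s)(r := 0)\<rparr>"]])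
    fix s1 assume s1: "s1 = s\<lparr>reg := (reg s)(r := 0)\<rparr>"
    show "\<exists>t s'. exec u (While (NLess (NReg r) e) (Seq c (NAssign r (NAdd (NReg r) (NConst 1))))) s1 t s'
      \<and> t \<le> (n + 1) * (1 + bcost (NLess (NReg r) e) + (1 + T + (1 + ncost (NAdd (NReg r) (NConst 1))))) \<and> ?Inv n s'"
    proof (rule exec_WhileI[where Inv = ?Inv])
      show "?Inv 0 s1" using init by (simp add: s1 agree_def)
    next
      fix i s2 assume i: "i < n" and I: "?Inv i s2"
      have b: "bval (NLess (NReg r) e) s2" using I bound i by simp
      obtain t3 s3 where 3: "exec u c s2 t3 s3" "t3 \<le> T" "Inv (Suc i) s3" using step[OF i] I by blast
      note a = exec_agree[OF 3(1)]
      have r3: "reg s3 r = i" using agree_reg[OF a r] I by simp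
      let ?s4 = "s3\<lparr>reg := (reg s3)(r := Suc i)\<rparr>"
      have "exec u (Seq c (NAssign r (NAdd (NReg r) (NConst 1)))) s2 (1 + t3 + (1 + ncost (NAdd (NReg r) (NConst 1)))) ?s4"
        using exec.Seq[OF 3(1) exec.NAssign[of u r "NAdd (NReg r) (NConst 1)" s3]] r3 by simp
      moreover have "?A ?s4" using I a by (auto simp: agree_def)
      ultimately show "bval (NLess (NReg r) e) s2 \<and> (\<exists>t s'. exec u (Seq c (NAssign r (NAdd (NReg r) (NConst 1)))) s2 t s' \<and>
          t \<le> 1 + T + (1 + ncost (NAdd (NReg r) (NConst 1))) \<and> ?Inv (Suc i) s')"
        using b 3(2) inv[OF 3(3)] by (intro conjI exI[of _ "1 + t3 + (1 + ncost (NAdd (NReg r) (NConst 1)))"] exI[of _ ?s4]) auto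
    next
      fix s2 assume "?Inv n s2" then show "\<not> bval (NLess (NReg r) e) s2" using bound by simp
    qed
  qed simp
  then show ?thesis by (rule exec_weaken) (auto simp: algebra_simps)
qed

abbreviation "N0 \<equiv> NConst 0"

definition SumLoop :: "nat \<Rightarrow> nexp \<Rightarrow> rexp \<Rightarrow> nat \<Rightarrow> com" where
  "SumLoop r e ex acc = Seq (RAssign acc N0 N0 (OfNat N0))
     (For r e (RAssign acc N0 N0 (Add (Cell acc N0 N0) ex)))"

lemma writes_SumLoop [simp]: "wregs (SumLoop r e ex acc) = {r}" "warrs (SumLoop r e ex acc) = {acc}"
  by (auto simp: SumLoop_def)

lemma exec_SumLoop:
  assumes bound: "\<And>s1. agree {r} {acc} s s1 \<Longrightarrow> nval e s1 = n"
    and val: "\<And>i s1. i < n \<Longrightarrow> agree {r} {acc} s s1 \<Longrightarrow> reg s1 r = i \<Longrightarrow> rval ex s1 = f i"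
  shows "\<exists>t s'. exec u (SumLoop r e ex acc) s t s' \<and> t \<le> (n + 1) * (rcost ex + ncost e + 30) \<and>
    cell s' (acc, 0, 0) = (\<Sum>i<n. f i)"
proof -
  have "\<exists>t s'. exec u (SumLoop r e ex acc) s t s' \<and>
     t \<le> 1 + (1 + ncost N0 + ncost N0 + rcost (OfNat N0)) + (n + 1) * ((1 + ncost N0 + ncost N0 + rcost (Add (Cell acc N0 N0) ex)) + ncost e + 12) \<and>
     cell s' (acc, 0, 0) = (\<Sum>i<n. f i)"
    unfolding SumLoop_def
  proof (rule exec_SeqI[OF exec_RAssignI[where Q = "\<lambda>s1. cell s1 (acc, 0, 0) = 0"]])
    fix s1 assume s1: "cell s1 (acc, 0, 0) = 0" "agree (wregs (RAssign acc N0 N0 (OfNat N0))) (warrs (RAssign acc N0 N0 (OfNat N0))) s s1"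
    show "\<exists>t s'. exec u (For r e (RAssign acc N0 N0 (Add (Cell acc N0 N0) ex))) s1 t s' \<and>
      t \<le> (n + 1) * ((1 + ncost N0 + ncost N0 + rcost (Add (Cell acc N0 N0) ex)) + ncost e + 12) \<and>
      cell s' (acc, 0, 0) = (\<Sum>i<n. f i)"
    proof (rule exec_For[where Inv = "\<lambda>i s. cell s (acc, 0, 0) = (\<Sum>l<i. f l)"])
      fix s2 assume "agree (insert r (wregs (RAssign acc N0 N0 (Add (Cell acc N0 N0) ex)))) (warrs (RAssign acc N0 N0 (Add (Cell acc N0 N0) ex))) s1 s2"
      then show "nval e s2 = n" using s1(2) by (intro bound) (auto simp: agree_def)
    next
      fix i s2 assume i: "i < n" and a: "agree (insert r (wregs (RAssign acc N0 N0 (Add (Cell acc N0 N0) ex)))) (warrs (RAssign acc N0 N0 (Add (Cell acc N0 N0) ex))) s1 s2"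
        and r: "reg s2 r = i" and c: "cell s2 (acc, 0, 0) = (\<Sum>l<i. f l)"
      have "rval ex s2 = f i" using s1(2) a r i by (intro val) (auto simp: agree_def)
      with c show "\<exists>t s'. exec u (RAssign acc N0 N0 (Add (Cell acc N0 N0) ex)) s2 t s' \<and>
        t \<le> 1 + ncost N0 + ncost N0 + rcost (Add (Cell acc N0 N0) ex) \<and> cell s' (acc, 0, 0) = (\<Sum>l<Suc i. f l)"
        by (intro exec_RAssignI) simp
    qed (use s1 in auto)
  qed simp
  then show ?thesis by (rule exec_weaken) (auto simp: algebra_simps)
qed

text \<open>A loop that fills row \<open>p\<close> of array \<open>a\<close>, one entry per iteration.\<close>

lemma exec_tabulate:
  assumes r: "r \<notin> wregs c"
    and bound: "\<And>s1. agree (insert r (wregs c)) (warrs c) s s1 \<Longrightarrow> nval e s1 = n"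
    and step: "\<And>i s1. i < n \<Longrightarrow> agree (insert r (wregs c)) (warrs c) s s1 \<Longrightarrow> reg s1 r = i \<Longrightarrow>
      \<exists>t s2. exec u c s1 t s2 \<and> t \<le> T \<and> (R i (cell s2 (a, p, i)) \<and>
        (\<forall>q j. (q, j) \<noteq> (p, i) \<longrightarrow> cell s2 (a, q, j) = cell s1 (a, q, j)))"
  shows "\<exists>t s'. exec u (For r e c) s t s' \<and> t \<le> (n + 1) * (T + ncost e + 12) \<and>
    ((\<forall>i<n. R i (cell s' (a, p, i))) \<and> (\<forall>q j. q \<noteq> p \<longrightarrow> cell s' (a, q, j) = cell s (a, q, j)))"
proof (rule exec_For[OF r bound, where Inv = "\<lambda>i s1. (\<forall>l<i. R l (cell s1 (a, p, l))) \<and> (\<forall>q j. q \<noteq> p \<longrightarrow> cell s1 (a, q, j) = cell s (a, q, j))"])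
  fix i s1 assume i: "i < n" "agree (insert r (wregs c)) (warrs c) s s1" "reg s1 r = i"
    and I: "(\<forall>l<i. R l (cell s1 (a, p, l))) \<and> (\<forall>q j. q \<noteq> p \<longrightarrow> cell s1 (a, q, j) = cell s (a, q, j))"
  show "\<exists>t s2. exec u c s1 t s2 \<and> t \<le> T \<and> ((\<forall>l<Suc i. R l (cell s2 (a, p, l))) \<and> (\<forall>q j. q \<noteq> p \<longrightarrow> cell s2 (a, q, j) = cell s (a, q, j)))"
    using step[OF i] by (rule exec_weaken) (use I in \<open>auto simp: less_Suc_eq\<close>)
qed auto

lemma exec_tabulate_expr:
  assumes bound: "\<And>s1. agree {r} {a} s s1 \<Longrightarrow> nval e s1 = n"
    and row: "\<And>s1. agree {r} {a} s s1 \<Longrightarrow> nval pe s1 = p"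
    and val: "\<And>i s1. i < n \<Longrightarrow> agree {r} {a} s s1 \<Longrightarrow> reg s1 r = i \<Longrightarrow> rval ex s1 = f i"
  shows "\<exists>t s'. exec u (For r e (RAssign a pe (NReg r) ex)) s t s' \<and>
    t \<le> (n + 1) * (rcost ex + ncost pe + ncost e + 14) \<and>
    ((\<forall>i<n. cell s' (a, p, i) = f i) \<and> (\<forall>q j. q \<noteq> p \<longrightarrow> cell s' (a, q, j) = cell s (a, q, j)))"
proof -
  have "\<exists>t s'. exec u (For r e (RAssign a pe (NReg r) ex)) s t s' \<and>
    t \<le> (n + 1) * ((1 + ncost pe + ncost (NReg r) + rcost ex) + ncost e + 12) \<and>
    ((\<forall>i<n. cell s' (a, p, i) = f i) \<and> (\<forall>q j. q \<noteq> p \<longrightarrow> cell s' (a, q, j) = cell s (a, q, j)))"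
  proof (rule exec_tabulate[where R = "\<lambda>i x. x = f i"])
    fix i s1 assume i: "i < n" "reg s1 r = i"
      and a: "agree (insert r (wregs (RAssign a pe (NReg r) ex))) (warrs (RAssign a pe (NReg r) ex)) s s1"
    from a have a': "agree {r} {a} s s1" by simp
    show "\<exists>t s2. exec u (RAssign a pe (NReg r) ex) s1 t s2 \<and> t \<le> 1 + ncost pe + ncost (NReg r) + rcost ex \<and>
      (cell s2 (a, p, i) = f i \<and> (\<forall>q j. (q, j) \<noteq> (p, i) \<longrightarrow> cell s2 (a, q, j) = cell s1 (a, q, j)))"
      using row[OF a'] val[OF i(1) a' i(2)] i(2) by (intro exec_RAssignI) auto
  qed (use bound in auto)
  then show ?thesis by (rule exec_weaken) (auto simp: algebra_simps)
qed

lemma exec_tabulate_sum: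
  assumes bound: "\<And>s1. agree {r, r'} {a, acc} s s1 \<Longrightarrow> nval e s1 = n"
    and row: "\<And>s1. agree {r, r'} {a, acc} s s1 \<Longrightarrow> nval pe s1 = p"
    and bound': "\<And>s1. agree {r, r'} {a, acc} s s1 \<Longrightarrow> nval e' s1 = n'"
    and val: "\<And>i l s1. i < n \<Longrightarrow> l < n' \<Longrightarrow> agree {r, r'} {a, acc} s s1 \<Longrightarrow> reg s1 r = i \<Longrightarrow> reg s1 r' = l \<Longrightarrow> rval ex s1 = f i l"
    and val2: "\<And>i s1. i < n \<Longrightarrow> agree {r, r'} {a, acc} s s1 \<Longrightarrow> reg s1 r = i \<Longrightarrow> cell s1 (acc, 0, 0) = (\<Sum>l<n'. f i l) \<Longrightarrow> rval ex2 s1 = g i"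
    and ne: "r \<noteq> r'" "a \<noteq> acc"
  shows "\<exists>t s'. exec u (For r e (Seq (SumLoop r' e' ex acc) (RAssign a pe (NReg r) ex2))) s t s' \<and>
    t \<le> (n + 1) * ((n' + 1) * (rcost ex + ncost e' + 30) + rcost ex2 + ncost pe + ncost e + 20) \<and>
    ((\<forall>i<n. cell s' (a, p, i) = g i) \<and> (\<forall>q j. q \<noteq> p \<longrightarrow> cell s' (a, q, j) = cell s (a, q, j)))"
proof -
  let ?body = "Seq (SumLoop r' e' ex acc) (RAssign a pe (NReg r) ex2)"
  have W: "insert r (wregs ?body) = {r, r'}" "warrs ?body = {a, acc}" by auto
  have "\<exists>t s'. exec u (For r e ?body) s t s' \<and>
    t \<le> (n + 1) * ((1 + (n' + 1) * (rcost ex + ncost e' + 30) + (1 + ncost pe + ncost (NReg r) + rcost ex2)) + ncost e + 12) \<and>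
    ((\<forall>i<n. cell s' (a, p, i) = g i) \<and> (\<forall>q j. q \<noteq> p \<longrightarrow> cell s' (a, q, j) = cell s (a, q, j)))"
  proof (rule exec_tabulate[where R = "\<lambda>i x. x = g i"], unfold W)
    fix i s1 assume i: "i < n" and a: "agree {r, r'} {a, acc} s s1" and r: "reg s1 r = i"
    show "\<exists>t s2. exec u ?body s1 t s2 \<and>
      t \<le> 1 + (n' + 1) * (rcost ex + ncost e' + 30) + (1 + ncost pe + ncost (NReg r) + rcost ex2) \<and>
      (cell s2 (a, p, i) = g i \<and> (\<forall>q j. (q, j) \<noteq> (p, i) \<longrightarrow> cell s2 (a, q, j) = cell s1 (a, q, j)))"
    proof (rule exec_SeqI[OF exec_SumLoop[where f = "f i" and n = n']])
      fix s2 assume "agree {r'} {acc} s1 s2"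
      then show "nval e' s2 = n'" using a by (intro bound') (auto simp: agree_def)
    next
      fix l s2 assume "l < n'" "agree {r'} {acc} s1 s2" "reg s2 r' = l"
      then show "rval ex s2 = f i l" using a r i ne by (intro val) (auto simp: agree_def)
    next
      fix s2 assume s2: "cell s2 (acc, 0, 0) = (\<Sum>l<n'. f i l)"
        "agree (wregs (SumLoop r' e' ex acc)) (warrs (SumLoop r' e' ex acc)) s1 s2"
      have a2: "agree {r, r'} {a, acc} s s2" using s2(2) a by (auto simp: agree_def)
      have r2: "reg s2 r = i" using s2(2) r ne by (auto simp: agree_def)
      have eq: "cell s2 (a, q, j) = cell s1 (a, q, j)" for q j using s2(2) ne by (auto simp: agree_def)
      show "\<exists>t s3. exec u (RAssign a pe (NReg r) ex2) s2 t s3 \<and> t \<le> 1 + ncost pe + ncost (NReg r) + rcost ex2 \<and>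
        (cell s3 (a, p, i) = g i \<and> (\<forall>q j. (q, j) \<noteq> (p, i) \<longrightarrow> cell s3 (a, q, j) = cell s1 (a, q, j)))"
        using row[OF a2] val2[OF i a2 r2 s2(1)] r2 eq by (intro exec_RAssignI) auto
    qed
  qed (use bound ne in auto)
  then show ?thesis by (rule exec_weaken) (auto simp: algebra_simps)
qed

text \<open>
  Absolute value, minimum and comparison as straight-line expressions, so that loops over them remain
  plain sums. Comparisons become numbers 0 and 1.
\<close>

definition AbsE :: "rexp \<Rightarrow> rexp" where "AbsE e = Sqrt (Mul e e)"

definition MinE :: "rexp \<Rightarrow> rexp \<Rightarrow> rexp" where
  "MinE a b = Div (Sub (Add a b) (AbsE (Sub a b))) (OfNat (NConst 2))"

definition LtE :: "rexp \<Rightarrow> rexp \<Rightarrow> rexp" where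
  "LtE a b = Div (Add (Sub b a) (AbsE (Sub b a))) (Mul (OfNat (NConst 2)) (AbsE (Sub b a)))"

lemma rval_MinE [simp]: "rval (MinE a b) s = min (rval a s) (rval b s)"
  by (simp add: MinE_def AbsE_def min_def abs_if)

text \<open>For equal arguments the quotient is \<open>0 / 0\<close>, which is \<open>0\<close>.\<close>

lemma rval_LtE [simp]: "rval (LtE a b) s = (if rval a s < rval b s then 1 else 0)"
  by (simp add: LtE_def AbsE_def abs_if)

lemma rcost_macros [simp]:
  "rcost (MinE a b) = 2 * (rcost a + rcost b) + rcost a + rcost b + 9"
  "rcost (LtE a b) = 5 * (rcost a + rcost b) + 14"
  by (simp_all add: MinE_def LtE_def AbsE_def)

section \<open>The filter as a program\<close>

abbreviation "sc a \<equiv> Cell a N0 N0"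
abbreviation "ve a r \<equiv> Cell a N0 (NReg r)"
abbreviation "mx a r q \<equiv> Cell a (NReg r) (NReg q)"
abbreviation "rn c \<equiv> OfNat (NConst c)"

text \<open>
  Storage layout. Registers 1 to 5: dimension, number of blocks, block length, exponent \<open>m\<close>, number of
  rounds; the others are loop counters and offsets. Arrays: 2 weighted mean, 3 block means, 4 weights,
  5 median, 6 squared distances from the median, 7 the vector that is iterated, 8 coefficients of an
  application of the operator, 9 scores, 10 new weights; 11 to 16 hold single numbers.
\<close>

definition sized :: "nat \<Rightarrow> nat \<Rightarrow> (nat \<Rightarrow> nat \<Rightarrow> real) \<Rightarrow> state \<Rightarrow> bool" where
  "sized d k z s \<longleftrightarrow> 0 < d \<and> 0 < k \<and> reg s 1 = d \<and> reg s 2 = k \<and> (\<forall>b<k. \<forall>j<d. cell s (3, b, j) = z b j)"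

definition row0 :: "state \<Rightarrow> nat \<Rightarrow> nat \<Rightarrow> (nat \<Rightarrow> real) \<Rightarrow> bool" where
  "row0 s a n f \<longleftrightarrow> (\<forall>i<n. cell s (a, 0, i) = f i)"

definition MeanC :: com where
  "MeanC = Seq (SumLoop 8 (NReg 2) (ve 4 8) 13)
    (For 9 (NReg 1) (Seq (SumLoop 8 (NReg 2) (Mul (ve 4 8) (mx 3 8 9)) 11)
      (RAssign 2 N0 (NReg 9) (Div (sc 11) (sc 13)))))"

lemma writes_MeanC [simp]: "wregs MeanC = {8, 9}" "warrs MeanC = {2, 11, 13}"
  by (auto simp: MeanC_def)

lemma exec_MeanC:
  assumes s: "sized d k z s" "row0 s 4 k U"
  shows "\<exists>t s'. exec u MeanC s t s' \<and> t \<le> 400 * k * d \<and> row0 s' 2 d (wmean k z U)"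
proof -
  obtain d' k' where dk: "d = Suc d'" "k = Suc k'"
    using s by (metis sized_def gr0_implies_Suc)
  have "\<exists>t s'. exec u MeanC s t s' \<and> t \<le> 1 + (k + 1) * (rcost (ve 4 8) + ncost (NReg 2) + 30) +
      (d + 1) * ((k + 1) * (rcost (Mul (ve 4 8) (mx 3 8 9)) + ncost (NReg 2) + 30) + rcost (Div (sc 11) (sc 13)) + ncost N0 + ncost (NReg 1) + 20)
      \<and> ((\<forall>i<d. cell s' (2, 0, i) = wmean k z U i) \<and> True)"
    unfolding MeanC_def
  proof (rule exec_SeqI[OF exec_SumLoop[where f = U and n = k]])
    fix s1 assume s1: "cell s1 (13, 0, 0) = (\<Sum>i<k. U i)" "agree (wregs (SumLoop 8 (NReg 2) (ve 4 8) 13)) (warrs (SumLoop 8 (NReg 2) (ve 4 8) 13)) s s1"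
    show "\<exists>t s'. exec u (For 9 (NReg 1) (Seq (SumLoop 8 (NReg 2) (Mul (ve 4 8) (mx 3 8 9)) 11)
        (RAssign 2 N0 (NReg 9) (Div (sc 11) (sc 13))))) s1 t s' \<and> t \<le> (d + 1) * ((k + 1) * (rcost (Mul (ve 4 8) (mx 3 8 9)) + ncost (NReg 2) + 30) + rcost (Div (sc 11) (sc 13)) + ncost N0 + ncost (NReg 1) + 20)
      \<and> ((\<forall>i<d. cell s' (2, 0, i) = wmean k z U i) \<and> True)"
      by (rule exec_weaken, rule exec_tabulate_sum[where f = "\<lambda>j i. U i * z i j" and g = "wmean k z U" and n = d and n' = k and p = 0])
         (use s s1 in \<open>auto simp: agree_def sized_def row0_def wmean_def wmass_def\<close>)
  qed (use s in \<open>auto simp: agree_def sized_def row0_def\<close>)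
  then show ?thesis
    by (rule exec_weaken) (simp add: dk algebra_simps, simp add: row0_def)
qed

text \<open>
  The operator is applied in two sweeps, first the coefficients \<open>u\<^sub>l \<langle>x\<^sub>l, y\<rangle>\<close> and then their combination, at
  cost \<open>O(k d)\<close>. The second sweep may overwrite \<open>y\<close>, as only the coefficients are still read.
\<close>

definition MatvecC :: com where
  "MatvecC = Seq
    (For 10 (NReg 2) (Seq (SumLoop 9 (NReg 1) (Mul (Sub (mx 3 10 9) (ve 2 9)) (ve 7 9)) 11)
      (RAssign 8 N0 (NReg 10) (Mul (ve 4 10) (sc 11)))))
    (For 9 (NReg 1) (Seq (SumLoop 10 (NReg 2) (Mul (ve 8 10) (Sub (mx 3 10 9) (ve 2 9))) 11)
      (RAssign 7 N0 (NReg 9) (sc 11))))"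

lemma writes_MatvecC [simp]: "wregs MatvecC = {9, 10}" "warrs MatvecC = {7, 8, 11}"
  by (auto simp: MatvecC_def)

lemma exec_MatvecC:
  assumes s: "sized d k z s" "row0 s 4 k U" "row0 s 2 d (wmean k z U)" "row0 s 7 d y"
  shows "\<exists>t s'. exec u MatvecC s t s' \<and> t \<le> 600 * k * d \<and> row0 s' 7 d (wcov d k z U y)"
proof -
  obtain d' k' where dk: "d = Suc d'" "k = Suc k'"
    using s by (metis sized_def gr0_implies_Suc)
  let ?e1 = "Mul (Sub (mx 3 10 9) (ve 2 9)) (ve 7 9)" and ?e2 = "Mul (ve 8 10) (Sub (mx 3 10 9) (ve 2 9))"
  let ?g = "\<lambda>l. U l * ip d (centered k z U l) y"
  have "\<exists>t s'. exec u MatvecC s t s' \<and> t \<le> 1 +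
      (k + 1) * ((d + 1) * (rcost ?e1 + ncost (NReg 1) + 30) + rcost (Mul (ve 4 10) (sc 11)) + ncost N0 + ncost (NReg 2) + 20) +
      (d + 1) * ((k + 1) * (rcost ?e2 + ncost (NReg 2) + 30) + rcost (sc 11) + ncost N0 + ncost (NReg 1) + 20)
      \<and> ((\<forall>i<d. cell s' (7, 0, i) = wcov d k z U y i) \<and> True)"
    unfolding MatvecC_def
  proof (rule exec_SeqI[OF exec_tabulate_sum[where f = "\<lambda>l j. centered k z U l j * y j" and g = ?g and n = k and n' = d and p = 0]])
    fix s1 assume s1: "(\<forall>i<k. cell s1 (8, 0, i) = ?g i) \<and> (\<forall>q j. q \<noteq> 0 \<longrightarrow> cell s1 (8, q, j) = cell s (8, q, j))"
      "agree (wregs (For 10 (NReg 2) (Seq (SumLoop 9 (NReg 1) ?e1 11) (RAssign 8 N0 (NReg 10) (Mul (ve 4 10) (sc 11))))))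
        (warrs (For 10 (NReg 2) (Seq (SumLoop 9 (NReg 1) ?e1 11) (RAssign 8 N0 (NReg 10) (Mul (ve 4 10) (sc 11)))))) s s1"
    show "\<exists>t s'. exec u (For 9 (NReg 1) (Seq (SumLoop 10 (NReg 2) ?e2 11) (RAssign 7 N0 (NReg 9) (sc 11)))) s1 t s' \<and>
      t \<le> (d + 1) * ((k + 1) * (rcost ?e2 + ncost (NReg 2) + 30) + rcost (sc 11) + ncost N0 + ncost (NReg 1) + 20)
      \<and> ((\<forall>i<d. cell s' (7, 0, i) = wcov d k z U y i) \<and> True)"
      by (rule exec_weaken, rule exec_tabulate_sum[where f = "\<lambda>j l. ?g l * centered k z U l j" and g = "wcov d k z U y" and n = d and n' = k and p = 0])
         (use s s1 in \<open>auto simp: agree_def sized_def row0_def wcov_def covop_def centered_def\<close>)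
  qed (use s in \<open>auto simp: agree_def sized_def row0_def centered_def ip_def\<close>)
  then show ?thesis
    by (rule exec_weaken) (simp add: dk algebra_simps, simp add: row0_def)
qed

definition ScoreC :: com where
  "ScoreC = For 8 (NReg 2) (Seq (For 9 (NReg 1) (RAssign 7 N0 (NReg 9) (Sub (mx 3 8 9) (ve 2 9))))
    (Seq (For 12 (NReg 4) MatvecC)
      (Seq (SumLoop 9 (NReg 1) (Mul (ve 7 9) (ve 7 9)) 11) (RAssign 9 N0 (NReg 8) (sc 11)))))"

lemma writes_ScoreC [simp]: "wregs ScoreC = {8, 9, 10, 12}" "warrs ScoreC = {7, 8, 9, 11}"
  by (auto simp: ScoreC_def)

lemma exec_ScoreC:
  assumes s: "sized d k z s" "row0 s 4 k U" "row0 s 2 d (wmean k z U)" "reg s 4 = m"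
  shows "\<exists>t s'. exec u ScoreC s t s' \<and> t \<le> 2000 * k * k * d * (m + 1) \<and> row0 s' 9 k (scores d k m z U)"
proof -
  obtain d' k' where dk: "d = Suc d'" "k = Suc k'"
    using s by (metis sized_def gr0_implies_Suc)
  let ?c1 = "For 9 (NReg 1) (RAssign 7 N0 (NReg 9) (Sub (mx 3 8 9) (ve 2 9)))" and ?c2 = "For 12 (NReg 4) MatvecC"
    and ?c3 = "SumLoop 9 (NReg 1) (Mul (ve 7 9) (ve 7 9)) 11" and ?c4 = "RAssign 9 N0 (NReg 8) (sc 11)"
  let ?body = "Seq ?c1 (Seq ?c2 (Seq ?c3 ?c4))"
  let ?T1 = "(d + 1) * (rcost (Sub (mx 3 8 9) (ve 2 9)) + ncost N0 + ncost (NReg 1) + 14)"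
  let ?T2 = "(m + 1) * (600 * k * d + ncost (NReg 4) + 12)"
  let ?T3 = "(d + 1) * (rcost (Mul (ve 7 9) (ve 7 9)) + ncost (NReg 1) + 30)"
  let ?T4 = "1 + ncost N0 + ncost (NReg 8) + rcost (sc 11)"
  have "\<exists>t s'. exec u ScoreC s t s' \<and> t \<le> (k + 1) * ((1 + ?T1 + (1 + ?T2 + (1 + ?T3 + ?T4))) + ncost (NReg 2) + 12) \<and>
    ((\<forall>i<k. cell s' (9, 0, i) = scores d k m z U i) \<and> (\<forall>q j. q \<noteq> 0 \<longrightarrow> cell s' (9, q, j) = cell s (9, q, j)))"
    unfolding ScoreC_def
  proof (rule exec_tabulate[where R = "\<lambda>i x. x = scores d k m z U i"])
    fix i s1 assume i: "i < k" "reg s1 8 = i" and a: "agree (insert 8 (wregs ?body)) (warrs ?body) s s1"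
    have S1: "sized d k z s1" "row0 s1 4 k U" "row0 s1 2 d (wmean k z U)" "reg s1 4 = m"
      using s a by (auto simp: agree_def sized_def row0_def)
    let ?x = "centered k z U i"
    show "\<exists>t s2. exec u ?body s1 t s2 \<and> t \<le> 1 + ?T1 + (1 + ?T2 + (1 + ?T3 + ?T4)) \<and>
      (cell s2 (9, 0, i) = scores d k m z U i \<and> (\<forall>q j. (q, j) \<noteq> (0, i) \<longrightarrow> cell s2 (9, q, j) = cell s1 (9, q, j)))"
    proof (rule exec_SeqI[OF exec_tabulate_expr[where f = ?x and n = d and p = 0]])
      fix s2 assume s2: "(\<forall>j<d. cell s2 (7, 0, j) = ?x j) \<and> (\<forall>q j. q \<noteq> 0 \<longrightarrow> cell s2 (7, q, j) = cell s1 (7, q, j))"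
        "agree (wregs ?c1) (warrs ?c1) s1 s2"
      have S2: "sized d k z s2" "row0 s2 4 k U" "row0 s2 2 d (wmean k z U)" "reg s2 4 = m" "reg s2 8 = i"
        and e2: "\<And>q j. cell s2 (9, q, j) = cell s1 (9, q, j)"
        using S1 s2(2) i by (auto simp: agree_def sized_def row0_def)
      show "\<exists>t s3. exec u (Seq ?c2 (Seq ?c3 ?c4)) s2 t s3 \<and> t \<le> 1 + ?T2 + (1 + ?T3 + ?T4) \<and>
        (cell s3 (9, 0, i) = scores d k m z U i \<and> (\<forall>q j. (q, j) \<noteq> (0, i) \<longrightarrow> cell s3 (9, q, j) = cell s1 (9, q, j)))"
      proof (rule exec_SeqI[OF exec_For[where Inv = "\<lambda>e s. row0 s 7 d ((wcov d k z U ^^ e) ?x)" and n = m and T = "600 * k * d"]])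
        fix e s3 assume "agree (insert 12 (wregs MatvecC)) (warrs MatvecC) s2 s3" and y: "row0 s3 7 d ((wcov d k z U ^^ e) ?x)"
        then have "sized d k z s3" "row0 s3 4 k U" "row0 s3 2 d (wmean k z U)"
          using S2 by (auto simp: agree_def sized_def row0_def)
        then show "\<exists>t s4. exec u MatvecC s3 t s4 \<and> t \<le> 600 * k * d \<and> row0 s4 7 d ((wcov d k z U ^^ Suc e) ?x)"
          using exec_MatvecC[OF _ _ _ y] by simp
      next
        fix s3 assume y: "row0 s3 7 d ((wcov d k z U ^^ m) ?x)" and a3: "agree (wregs ?c2) (warrs ?c2) s2 s3"
        have S3: "sized d k z s3" "reg s3 8 = i" and e3: "\<And>q j. cell s3 (9, q, j) = cell s1 (9, q, j)"
          using S2 a3 e2 by (auto simp: agree_def sized_def row0_def)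
        show "\<exists>t s4. exec u (Seq ?c3 ?c4) s3 t s4 \<and> t \<le> 1 + ?T3 + ?T4 \<and>
          (cell s4 (9, 0, i) = scores d k m z U i \<and> (\<forall>q j. (q, j) \<noteq> (0, i) \<longrightarrow> cell s4 (9, q, j) = cell s1 (9, q, j)))"
        proof (rule exec_SeqI[OF exec_SumLoop[where f = "\<lambda>j. (wcov d k z U ^^ m) ?x j * (wcov d k z U ^^ m) ?x j" and n = d]])
          fix s4 assume s4: "cell s4 (11, 0, 0) = (\<Sum>j<d. (wcov d k z U ^^ m) ?x j * (wcov d k z U ^^ m) ?x j)"
            "agree (wregs ?c3) (warrs ?c3) s3 s4"
          have "reg s4 8 = i" "\<And>q j. cell s4 (9, q, j) = cell s1 (9, q, j)" using S3 e3 s4(2) by (auto simp: agree_def)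
          then show "\<exists>t s5. exec u ?c4 s4 t s5 \<and> t \<le> ?T4 \<and>
            (cell s5 (9, 0, i) = scores d k m z U i \<and> (\<forall>q j. (q, j) \<noteq> (0, i) \<longrightarrow> cell s5 (9, q, j) = cell s1 (9, q, j)))"
            using s4(1) by (intro exec_RAssignI) (auto simp: scores_def power_score_def ip_def)
        qed (use S3 y in \<open>auto simp: agree_def sized_def row0_def\<close>)
      qed (use S2 s2 in \<open>auto simp: agree_def sized_def row0_def\<close>)
    qed (use S1 i in \<open>auto simp: agree_def sized_def row0_def centered_def\<close>)
  qed (use s in \<open>auto simp: agree_def sized_def\<close>)
  then show ?thesis
    by (rule exec_weaken) (simp add: dk algebra_simps, simp add: row0_def)
qed

definition ThresholdC :: com where
  "ThresholdC = Seq (SumLoop 8 (NReg 2) (Mul (ve 4 8) (ve 9 8)) 14)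
    (Seq (SumLoop 8 (NReg 2) (ve 9 8) 15)
      (For 10 (NReg 2) (Seq (SumLoop 8 (NReg 2) (Mul (ve 4 8) (MinE (ve 9 8) (ve 9 10))) 16)
        (If (And (Not (RLess (Mul (rn 2) (sc 16)) (sc 14))) (RLess (ve 9 10) (sc 15)))
          (RAssign 15 N0 N0 (ve 9 10)) Skip))))"

lemma writes_ThresholdC [simp]: "wregs ThresholdC = {8, 10}" "warrs ThresholdC = {14, 15, 16}"
  by (auto simp: ThresholdC_def)

lemma exec_ThresholdC:
  assumes s: "sized d k z s" "row0 s 4 k U" "row0 s 9 k q"
  shows "\<exists>t s'. exec u ThresholdC s t s' \<and> t \<le> 800 * k * k \<and> cell s' (15, 0, 0) = threshold k U q"
proof -
  obtain k' where dk: "k = Suc k'" using s by (metis sized_def gr0_implies_Suc)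
  let ?h = "\<lambda>j. \<Sum>i<k. U i * min (q i) (q j)"
  let ?S = "\<lambda>n. {q j | j. j < n \<and> wsum k U q \<le> 2 * ?h j}"
  let ?c1 = "SumLoop 8 (NReg 2) (Mul (ve 4 8) (ve 9 8)) 14" and ?c2 = "SumLoop 8 (NReg 2) (ve 9 8) 15"
    and ?c3 = "SumLoop 8 (NReg 2) (Mul (ve 4 8) (MinE (ve 9 8) (ve 9 10))) 16"
  let ?b = "And (Not (RLess (Mul (rn 2) (sc 16)) (sc 14))) (RLess (ve 9 10) (sc 15))"
  let ?c4 = "If ?b (RAssign 15 N0 N0 (ve 9 10)) Skip"
  let ?T1 = "(k + 1) * (rcost (Mul (ve 4 8) (ve 9 8)) + ncost (NReg 2) + 30)"
  let ?T2 = "(k + 1) * (rcost (ve 9 8) + ncost (NReg 2) + 30)"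
  let ?T3 = "(k + 1) * (rcost (Mul (ve 4 8) (MinE (ve 9 8) (ve 9 10))) + ncost (NReg 2) + 30)"
  let ?T4 = "1 + bcost ?b + (1 + ncost N0 + ncost N0 + rcost (ve 9 10))"
  have "\<exists>t s'. exec u ThresholdC s t s' \<and> t \<le> 1 + ?T1 + (1 + ?T2 + (k + 1) * ((1 + ?T3 + ?T4) + ncost (NReg 2) + 12)) \<and>
    cell s' (15, 0, 0) = Min (insert (\<Sum>i<k. q i) (?S k))"
    unfolding ThresholdC_def
  proof (rule exec_SeqI[OF exec_SumLoop[where f = "\<lambda>i. U i * q i" and n = k]])
    fix s1 assume s1: "cell s1 (14, 0, 0) = (\<Sum>i<k. U i * q i)" "agree (wregs ?c1) (warrs ?c1) s s1"
    have S1: "sized d k z s1" "row0 s1 4 k U" "row0 s1 9 k q" "cell s1 (14, 0, 0) = wsum k U q"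
      using s s1 by (auto simp: agree_def sized_def row0_def wsum_def)
    show "\<exists>t s'. exec u (Seq ?c2 (For 10 (NReg 2) (Seq ?c3 ?c4))) s1 t s' \<and> t \<le> 1 + ?T2 + (k + 1) * ((1 + ?T3 + ?T4) + ncost (NReg 2) + 12) \<and>
      cell s' (15, 0, 0) = Min (insert (\<Sum>i<k. q i) (?S k))"
    proof (rule exec_SeqI[OF exec_SumLoop[where f = q and n = k]])
      fix s2 assume s2: "cell s2 (15, 0, 0) = (\<Sum>i<k. q i)" "agree (wregs ?c2) (warrs ?c2) s1 s2"
      have S2: "sized d k z s2" "row0 s2 4 k U" "row0 s2 9 k q" "cell s2 (14, 0, 0) = wsum k U q"
        using S1 s2 by (auto simp: agree_def sized_def row0_def)
      show "\<exists>t s'. exec u (For 10 (NReg 2) (Seq ?c3 ?c4)) s2 t s' \<and> t \<le> (k + 1) * ((1 + ?T3 + ?T4) + ncost (NReg 2) + 12) \<and>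
        cell s' (15, 0, 0) = Min (insert (\<Sum>i<k. q i) (?S k))"
      proof (rule exec_For[where Inv = "\<lambda>n s. cell s (15, 0, 0) = Min (insert (\<Sum>i<k. q i) (?S n))"])
        fix i s3 assume i: "i < k" "reg s3 10 = i"
          and a: "agree (insert 10 (wregs (Seq ?c3 ?c4))) (warrs (Seq ?c3 ?c4)) s2 s3"
          and I: "cell s3 (15, 0, 0) = Min (insert (\<Sum>i<k. q i) (?S i))"
        have S3: "sized d k z s3" "row0 s3 4 k U" "row0 s3 9 k q" "cell s3 (14, 0, 0) = wsum k U q"
          using S2 a by (auto simp: agree_def sized_def row0_def)
        show "\<exists>t s4. exec u (Seq ?c3 ?c4) s3 t s4 \<and> t \<le> 1 + ?T3 + ?T4 \<and>
          cell s4 (15, 0, 0) = Min (insert (\<Sum>i<k. q i) (?S (Suc i)))"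
        proof (rule exec_SeqI[OF exec_SumLoop[where f = "\<lambda>l. U l * min (q l) (q i)" and n = k]])
          fix s4 assume s4: "cell s4 (16, 0, 0) = ?h i" "agree (wregs ?c3) (warrs ?c3) s3 s4"
          have v: "cell s4 (14, 0, 0) = wsum k U q" "cell s4 (9, 0, reg s4 10) = q i" "cell s4 (15, 0, 0) = Min (insert (\<Sum>i<k. q i) (?S i))"
            using S3 s4(2) i I by (auto simp: agree_def row0_def)
          have fin: "finite (insert (\<Sum>i<k. q i) (?S i))" by simp
          have Suc: "?S (Suc i) = (if wsum k U q \<le> 2 * ?h i then insert (q i) (?S i) else ?S i)"
            by (auto simp: less_Suc_eq)
          have b: "bval ?b s4 \<longleftrightarrow> wsum k U q \<le> 2 * ?h i \<and> q i < Min (insert (\<Sum>i<k. q i) (?S i))"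
            using v s4(1) by (simp add: not_less)
          have M: "Min (insert (\<Sum>i<k. q i) (insert (q i) (?S i))) = min (q i) (Min (insert (\<Sum>i<k. q i) (?S i)))"
            using fin by (subst insert_commute) (rule Min_insert, auto)
          show "\<exists>t s5. exec u ?c4 s4 t s5 \<and> t \<le> ?T4 \<and> cell s5 (15, 0, 0) = Min (insert (\<Sum>i<k. q i) (?S (Suc i)))"
          proof (rule exec_IfI)
            assume "bval ?b s4"
            with b have "wsum k U q \<le> 2 * ?h i" "q i < Min (insert (\<Sum>i<k. q i) (?S i))" by auto
            then show "\<exists>t s5. exec u (RAssign 15 N0 N0 (ve 9 10)) s4 t s5 \<and> t \<le> 1 + ncost N0 + ncost N0 + rcost (ve 9 10) \<and>
              cell s5 (15, 0, 0) = Min (insert (\<Sum>i<k. q i) (?S (Suc i)))"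
              unfolding Suc using v M by (intro exec_RAssignI) simp
          next
            assume nb: "\<not> bval ?b s4"
            have "Min (insert (\<Sum>i<k. q i) (?S (Suc i))) = Min (insert (\<Sum>i<k. q i) (?S i))"
            proof (cases "wsum k U q \<le> 2 * ?h i")
              case True
              then have "\<not> q i < Min (insert (\<Sum>i<k. q i) (?S i))" using nb b by blast
              then have le: "Min (insert (\<Sum>i<k. q i) (?S i)) \<le> q i" by (simp only: not_less)
              show ?thesis unfolding Suc using True by (simp only: if_True M min_absorb2[OF le])
            qed (simp only: Suc if_False)
            then show "\<exists>t s5. exec u Skip s4 t s5 \<and> t \<le> 1 + ncost N0 + ncost N0 + rcost (ve 9 10) \<and>
              cell s5 (15, 0, 0) = Min (insert (\<Sum>i<k. q i) (?S (Suc i)))"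
              using v(3) by (intro exec_SkipI) auto
          qed
        qed (use S3 i in \<open>auto simp: agree_def sized_def row0_def\<close>)
      qed (use S2 s2 in \<open>auto simp: agree_def sized_def\<close>)
    qed (use S1 in \<open>auto simp: agree_def sized_def row0_def\<close>)
  qed (use s in \<open>auto simp: agree_def sized_def row0_def\<close>)
  then show ?thesis
    by (rule exec_weaken) (simp add: dk algebra_simps, simp add: threshold_def)
qed

definition DownC :: com where
  "DownC = Seq (For 8 (NReg 2) (RAssign 10 N0 (NReg 8)
      (Mul (ve 4 8) (Sub (rn 1) (MinE (rn 1) (Div (ve 9 8) (sc 15)))))))
    (Seq (SumLoop 8 (NReg 2) (ve 10 8) 13)
      (If (Not (RLess (Mul (rn 5) (sc 13)) (Mul (rn 4) (OfNat (NReg 2)))))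
        (For 8 (NReg 2) (RAssign 4 N0 (NReg 8) (ve 10 8))) Skip))"

lemma writes_DownC [simp]: "wregs DownC = {8}" "warrs DownC = {4, 10, 13}"
  by (auto simp: DownC_def)

lemma exec_DownC:
  assumes s: "sized d k z s" "row0 s 4 k U" "row0 s 9 k q" "cell s (15, 0, 0) = threshold k U q"
  shows "\<exists>t s'. exec u DownC s t s' \<and> t \<le> 300 * k \<and>
    row0 s' 4 k (if 4 * real k \<le> 5 * wmass k (downweight k U q) then downweight k U q else U)"
proof -
  obtain k' where dk: "k = Suc k'" using s by (metis sized_def gr0_implies_Suc)
  let ?V = "downweight k U q"
  let ?R = "\<lambda>s'. row0 s' 4 k (if 4 * real k \<le> 5 * wmass k ?V then ?V else U)"
  let ?e1 = "Mul (ve 4 8) (Sub (rn 1) (MinE (rn 1) (Div (ve 9 8) (sc 15))))"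
  let ?c1 = "For 8 (NReg 2) (RAssign 10 N0 (NReg 8) ?e1)" and ?c2 = "SumLoop 8 (NReg 2) (ve 10 8) 13"
  let ?b = "Not (RLess (Mul (rn 5) (sc 13)) (Mul (rn 4) (OfNat (NReg 2))))"
  let ?c3 = "For 8 (NReg 2) (RAssign 4 N0 (NReg 8) (ve 10 8))"
  let ?T1 = "(k + 1) * (rcost ?e1 + ncost N0 + ncost (NReg 2) + 14)"
  let ?T2 = "(k + 1) * (rcost (ve 10 8) + ncost (NReg 2) + 30)"
  let ?T3 = "(k + 1) * (rcost (ve 10 8) + ncost N0 + ncost (NReg 2) + 14)"
  have "\<exists>t s'. exec u DownC s t s' \<and> t \<le> 1 + ?T1 + (1 + ?T2 + (1 + bcost ?b + ?T3)) \<and> ?R s'"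
    unfolding DownC_def
  proof (rule exec_SeqI[OF exec_tabulate_expr[where f = ?V and n = k and p = 0]])
    fix s1 assume s1: "(\<forall>i<k. cell s1 (10, 0, i) = ?V i) \<and> (\<forall>q j. q \<noteq> 0 \<longrightarrow> cell s1 (10, q, j) = cell s (10, q, j))"
      "agree (wregs ?c1) (warrs ?c1) s s1"
    have S1: "sized d k z s1" "row0 s1 4 k U" "row0 s1 10 k ?V"
      using s s1 by (auto simp: agree_def sized_def row0_def)
    show "\<exists>t s'. exec u (Seq ?c2 (If ?b ?c3 Skip)) s1 t s' \<and> t \<le> 1 + ?T2 + (1 + bcost ?b + ?T3) \<and> ?R s'"
    proof (rule exec_SeqI[OF exec_SumLoop[where f = ?V and n = k]])
      fix s2 assume s2: "cell s2 (13, 0, 0) = (\<Sum>i<k. ?V i)" "agree (wregs ?c2) (warrs ?c2) s1 s2"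
      have S2: "sized d k z s2" "row0 s2 4 k U" "row0 s2 10 k ?V" "cell s2 (13, 0, 0) = wmass k ?V"
        using S1 s2 by (auto simp: agree_def sized_def row0_def wmass_def)
      have b: "bval ?b s2 \<longleftrightarrow> 4 * real k \<le> 5 * wmass k ?V"
        using S2 by (simp add: sized_def not_less)
      show "\<exists>t s'. exec u (If ?b ?c3 Skip) s2 t s' \<and> t \<le> 1 + bcost ?b + ?T3 \<and> ?R s'"
      proof (rule exec_IfI)
        assume "bval ?b s2"
        with b have acc: "4 * real k \<le> 5 * wmass k ?V" by blast
        show "\<exists>t s'. exec u ?c3 s2 t s' \<and> t \<le> ?T3 \<and> ?R s'"
          by (rule exec_weaken, rule exec_tabulate_expr[where f = ?V and n = k and p = 0])
             (use S2 acc in \<open>auto simp: agree_def sized_def row0_def\<close>)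
      next
        assume "\<not> bval ?b s2"
        with b have "\<not> 4 * real k \<le> 5 * wmass k ?V" by blast
        then show "\<exists>t s'. exec u Skip s2 t s' \<and> t \<le> ?T3 \<and> ?R s'"
          using S2(2) by (intro exec_SkipI) auto
      qed
    qed (use S1 in \<open>auto simp: agree_def sized_def row0_def\<close>)
  qed (use s in \<open>auto simp: agree_def sized_def row0_def downweight_def\<close>)
  then show ?thesis by (rule exec_weaken) (simp add: dk, assumption)
qed

definition RoundC :: com where
  "RoundC = Seq MeanC (Seq ScoreC (Seq ThresholdC DownC))"

lemma writes_RoundC [simp]: "wregs RoundC = {8, 9, 10, 12}" "warrs RoundC = {2, 4, 7, 8, 9, 10, 11, 13, 14, 15, 16}"
  by (auto simp: RoundC_def)

lemma exec_RoundC: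
  assumes s: "sized d k z s" "row0 s 4 k U" "reg s 4 = m"
  shows "\<exists>t s'. exec u RoundC s t s' \<and> t \<le> 4000 * k * k * d * (m + 1) \<and> row0 s' 4 k (filter_step d k m z U)"
proof -
  obtain d' k' where dk: "d = Suc d'" "k = Suc k'"
    using s by (metis sized_def gr0_implies_Suc)
  let ?q = "scores d k m z U"
  have "\<exists>t s'. exec u RoundC s t s' \<and> t \<le> 1 + 400 * k * d + (1 + 2000 * k * k * d * (m + 1) + (1 + 800 * k * k + 300 * k)) \<and>
    row0 s' 4 k (filter_step d k m z U)"
    unfolding RoundC_def
  proof (rule exec_SeqI[OF exec_MeanC[OF s(1,2)]])
    fix s1 assume s1: "row0 s1 2 d (wmean k z U)" "agree (wregs MeanC) (warrs MeanC) s s1"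
    have S1: "sized d k z s1" "row0 s1 4 k U" "reg s1 4 = m"
      using s s1 by (auto simp: agree_def sized_def row0_def)
    show "\<exists>t s'. exec u (Seq ScoreC (Seq ThresholdC DownC)) s1 t s' \<and> t \<le> 1 + 2000 * k * k * d * (m + 1) + (1 + 800 * k * k + 300 * k) \<and>
      row0 s' 4 k (filter_step d k m z U)"
    proof (rule exec_SeqI[OF exec_ScoreC[OF S1(1,2) s1(1) S1(3)]])
      fix s2 assume s2: "row0 s2 9 k ?q" "agree (wregs ScoreC) (warrs ScoreC) s1 s2"
      have S2: "sized d k z s2" "row0 s2 4 k U" using S1 s2 by (auto simp: agree_def sized_def row0_def)
      show "\<exists>t s'. exec u (Seq ThresholdC DownC) s2 t s' \<and> t \<le> 1 + 800 * k * k + 300 * k \<and>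
        row0 s' 4 k (filter_step d k m z U)"
      proof (rule exec_SeqI[OF exec_ThresholdC[OF S2 s2(1)]])
        fix s3 assume s3: "cell s3 (15, 0, 0) = threshold k U ?q" "agree (wregs ThresholdC) (warrs ThresholdC) s2 s3"
        have S3: "sized d k z s3" "row0 s3 4 k U" "row0 s3 9 k ?q"
          using S2 s2(1) s3(2) by (auto simp: agree_def sized_def row0_def)
        show "\<exists>t s'. exec u DownC s3 t s' \<and> t \<le> 300 * k \<and> row0 s' 4 k (filter_step d k m z U)"
          using exec_DownC[OF S3 s3(1)] unfolding filter_step_def Let_def .
      qed
    qed
  qed
  then show ?thesis by (rule exec_weaken) (simp add: dk algebra_simps, assumption)
qed

definition FilterC :: com where
  "FilterC = Seq (For 17 (NReg 5) RoundC) MeanC"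

lemma exec_FilterC:
  assumes s: "sized d k z s" "row0 s 4 k U" "reg s 4 = m" "reg s 5 = N"
  shows "\<exists>t s'. exec u FilterC s t s' \<and> t \<le> (N + 1) * (4100 * k * k * d * (m + 1)) + 500 * k * d \<and>
    row0 s' 2 d (wmean k z ((filter_step d k m z ^^ N) U))"
proof -
  obtain d' k' where dk: "d = Suc d'" "k = Suc k'"
    using s by (metis sized_def gr0_implies_Suc)
  have T: "4000 * k * k * d * (m + 1) + ncost (NReg 5) + 12 \<le> 4100 * k * k * d * (m + 1)"
    by (simp add: dk algebra_simps)
  have "\<exists>t s'. exec u FilterC s t s' \<and> t \<le> 1 + (N + 1) * (4000 * k * k * d * (m + 1) + ncost (NReg 5) + 12) + 400 * k * d \<and>
    row0 s' 2 d (wmean k z ((filter_step d k m z ^^ N) U))"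
    unfolding FilterC_def
  proof (rule exec_SeqI[OF exec_For[where Inv = "\<lambda>t s. row0 s 4 k ((filter_step d k m z ^^ t) U)" and n = N]])
    fix t s1 assume "agree (insert 17 (wregs RoundC)) (warrs RoundC) s s1" and U: "row0 s1 4 k ((filter_step d k m z ^^ t) U)"
    then have "sized d k z s1" "reg s1 4 = m" using s by (auto simp: agree_def sized_def)
    from exec_RoundC[OF this(1) U this(2)]
    show "\<exists>t' s2. exec u RoundC s1 t' s2 \<and> t' \<le> 4000 * k * k * d * (m + 1) \<and> row0 s2 4 k ((filter_step d k m z ^^ Suc t) U)"
      by simp
  next
    fix s1 assume U: "row0 s1 4 k ((filter_step d k m z ^^ N) U)" and a: "agree (wregs (For 17 (NReg 5) RoundC)) (warrs (For 17 (NReg 5) RoundC)) s s1"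
    have "sized d k z s1" using s a by (auto simp: agree_def sized_def)
    from exec_MeanC[OF this U]
    show "\<exists>t s'. exec u MeanC s1 t s' \<and> t \<le> 400 * k * d \<and> row0 s' 2 d (wmean k z ((filter_step d k m z ^^ N) U))" .
  qed (use s in \<open>auto simp: agree_def row0_def\<close>)
  then show ?thesis
  proof (rule exec_weaken)
    have "1 + 400 * k * d \<le> 500 * k * d" by (simp add: dk algebra_simps)
    with mult_le_mono2[OF T, of "N + 1"]
    show "1 + (N + 1) * (4000 * k * k * d * (m + 1) + ncost (NReg 5) + 12) + 400 * k * d
      \<le> (N + 1) * (4100 * k * k * d * (m + 1)) + 500 * k * d" by linarith
  qed
qed

definition MedianC :: com where
  "MedianC = For 9 (NReg 1) (For 8 (NReg 2)
    (Seq (SumLoop 10 (NReg 2) (LtE (mx 3 10 9) (mx 3 8 9)) 11)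
      (Seq (SumLoop 10 (NReg 2) (LtE (mx 3 8 9) (mx 3 10 9)) 12)
        (If (And (Not (RLess (OfNat (NReg 2)) (Mul (rn 2) (sc 11)))) (Not (RLess (OfNat (NReg 2)) (Mul (rn 2) (sc 12)))))
          (RAssign 5 N0 (NReg 9) (mx 3 8 9)) Skip))))"

lemma writes_MedianC [simp]: "wregs MedianC = {8, 9, 10}" "warrs MedianC = {5, 11, 12}"
  by (auto simp: MedianC_def)

lemma sum_indicator:
  fixes k :: nat
  shows "(\<Sum>l<k. if P l then 1 else 0 :: real) = real (card {l. l < k \<and> P l})"
proof -
  have "(\<Sum>l<k. if P l then 1 else 0 :: real) = (\<Sum>l\<in>{l. l < k \<and> P l}. 1)"
    by (rule sum.mono_neutral_cong_right) auto
  then show ?thesis by simp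
qed

lemma exec_MedianC:
  assumes s: "sized d k z s"
  shows "\<exists>t s'. exec u MedianC s t s' \<and> t \<le> 2000 * k * k * d \<and> coord_median d k z (\<lambda>j. cell s' (5, 0, j))"
proof -
  obtain d' k' where dk: "d = Suc d'" "k = Suc k'"
    using s by (metis sized_def gr0_implies_Suc)
  define M where "M j x \<longleftrightarrow> 2 * card {l. l < k \<and> z l j < x} \<le> k \<and> 2 * card {l. l < k \<and> x < z l j} \<le> k" for j x
  let ?c1 = "SumLoop 10 (NReg 2) (LtE (mx 3 10 9) (mx 3 8 9)) 11"
    and ?c2 = "SumLoop 10 (NReg 2) (LtE (mx 3 8 9) (mx 3 10 9)) 12"
  let ?b = "And (Not (RLess (OfNat (NReg 2)) (Mul (rn 2) (sc 11)))) (Not (RLess (OfNat (NReg 2)) (Mul (rn 2) (sc 12))))"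
  let ?c3 = "If ?b (RAssign 5 N0 (NReg 9) (mx 3 8 9)) Skip"
  let ?body = "Seq ?c1 (Seq ?c2 ?c3)"
  let ?T = "(k + 1) * (rcost (LtE (mx 3 10 9) (mx 3 8 9)) + ncost (NReg 2) + 30)"
  let ?T3 = "1 + bcost ?b + (1 + ncost N0 + ncost (NReg 9) + rcost (mx 3 8 9))"
  have "\<exists>t s'. exec u MedianC s t s' \<and>
    t \<le> (d + 1) * ((k + 1) * ((1 + ?T + (1 + ?T + ?T3)) + ncost (NReg 2) + 12) + ncost (NReg 1) + 12) \<and>
    ((\<forall>j<d. M j (cell s' (5, 0, j))) \<and> (\<forall>q j. q \<noteq> 0 \<longrightarrow> cell s' (5, q, j) = cell s (5, q, j)))"
    unfolding MedianC_def
  proof (rule exec_tabulate)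
    fix j s1 assume j: "j < d" "reg s1 9 = j" and a: "agree (insert 9 (wregs (For 8 (NReg 2) ?body))) (warrs (For 8 (NReg 2) ?body)) s s1"
    have S1: "sized d k z s1" using s a by (auto simp: agree_def sized_def)
    let ?Inv = "\<lambda>i s2. ((\<exists>l<i. M j (z l j)) \<longrightarrow> M j (cell s2 (5, 0, j))) \<and>
        (\<forall>q j'. (q, j') \<noteq> (0, j) \<longrightarrow> cell s2 (5, q, j') = cell s1 (5, q, j'))"
    have ex: "\<exists>l<k. M j (z l j)"
      using median_exists[of k "\<lambda>l. z l j"] dk by (auto simp: M_def)
    have "\<exists>t s2. exec u (For 8 (NReg 2) ?body) s1 t s2 \<and> t \<le> (k + 1) * ((1 + ?T + (1 + ?T + ?T3)) + ncost (NReg 2) + 12) \<and> ?Inv k s2"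
    proof (rule exec_For)
      fix i s2 assume i: "i < k" "reg s2 8 = i" and a2: "agree (insert 8 (wregs ?body)) (warrs ?body) s1 s2" and I: "?Inv i s2"
      have S2: "sized d k z s2" "reg s2 9 = j" using S1 j a2 by (auto simp: agree_def sized_def)
      show "\<exists>t s3. exec u ?body s2 t s3 \<and> t \<le> 1 + ?T + (1 + ?T + ?T3) \<and> ?Inv (Suc i) s3"
      proof (rule exec_SeqI[OF exec_SumLoop[where f = "\<lambda>l. if z l j < z i j then 1 else 0" and n = k]])
        fix s3 assume s3: "cell s3 (11, 0, 0) = (\<Sum>l<k. if z l j < z i j then 1 else 0)" "agree (wregs ?c1) (warrs ?c1) s2 s3"
        have S3: "sized d k z s3" "reg s3 9 = j" "reg s3 8 = i" and e3: "\<And>q j'. cell s3 (5, q, j') = cell s2 (5, q, j')"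
          using S2 i s3(2) by (auto simp: agree_def sized_def)
        have "\<exists>t s4. exec u (Seq ?c2 ?c3) s3 t s4 \<and> t \<le> 1 + (k + 1) * (rcost (LtE (mx 3 8 9) (mx 3 10 9)) + ncost (NReg 2) + 30) + ?T3 \<and> ?Inv (Suc i) s4"
        proof (rule exec_SeqI[OF exec_SumLoop[where f = "\<lambda>l. if z i j < z l j then 1 else 0" and n = k]])
          fix s4 assume s4: "cell s4 (12, 0, 0) = (\<Sum>l<k. if z i j < z l j then 1 else 0)" "agree (wregs ?c2) (warrs ?c2) s3 s4"
          have S4: "reg s4 2 = k" "reg s4 9 = j" "reg s4 8 = i" "cell s4 (3, i, j) = z i j" "cell s4 (11, 0, 0) = cell s3 (11, 0, 0)"
            and e4: "\<And>q j'. cell s4 (5, q, j') = cell s2 (5, q, j')"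
            using S3 e3 i(1) j(1) s4(2) by (auto simp: agree_def sized_def)
          have b: "bval ?b s4 \<longleftrightarrow> M j (z i j)"
            using S4 s3(1) s4(1) unfolding sum_indicator M_def by simp linarith
          show "\<exists>t s5. exec u ?c3 s4 t s5 \<and> t \<le> ?T3 \<and> ?Inv (Suc i) s5"
          proof (rule exec_IfI)
            assume "bval ?b s4"
            with b have "M j (z i j)" by blast
            then show "\<exists>t s5. exec u (RAssign 5 N0 (NReg 9) (mx 3 8 9)) s4 t s5 \<and>
              t \<le> 1 + ncost N0 + ncost (NReg 9) + rcost (mx 3 8 9) \<and> ?Inv (Suc i) s5"
              using S4 e4 I by (intro exec_RAssignI) auto
          next
            assume "\<not> bval ?b s4"
            with b have "\<not> M j (z i j)" by blast
            then show "\<exists>t s5. exec u Skip s4 t s5 \<and> t \<le> 1 + ncost N0 + ncost (NReg 9) + rcost (mx 3 8 9) \<and> ?Inv (Suc i) s5"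
              using e4 I by (intro exec_SkipI) (auto simp: less_Suc_eq)
          qed
        qed (use S3 i j in \<open>auto simp: agree_def sized_def\<close>)
        then show "\<exists>t s4. exec u (Seq ?c2 ?c3) s3 t s4 \<and> t \<le> 1 + ?T + ?T3 \<and> ?Inv (Suc i) s4" by simp
      qed (use S2 i j in \<open>auto simp: agree_def sized_def\<close>)
    qed (use S1 in \<open>auto simp: agree_def sized_def\<close>)
    then show "\<exists>t s2. exec u (For 8 (NReg 2) ?body) s1 t s2 \<and> t \<le> (k + 1) * ((1 + ?T + (1 + ?T + ?T3)) + ncost (NReg 2) + 12) \<and>
      (M j (cell s2 (5, 0, j)) \<and> (\<forall>q j'. (q, j') \<noteq> (0, j) \<longrightarrow> cell s2 (5, q, j') = cell s1 (5, q, j')))"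
      by (rule exec_weaken) (use ex in auto)
  qed (use s in \<open>auto simp: agree_def sized_def\<close>)
  then show ?thesis
    by (rule exec_weaken) (simp add: dk algebra_simps, simp add: coord_median_def M_def)
qed

definition PruneC :: com where
  "PruneC = Seq
    (For 8 (NReg 2) (Seq (SumLoop 9 (NReg 1) (Mul (Sub (mx 3 8 9) (ve 5 9)) (Sub (mx 3 8 9) (ve 5 9))) 11)
      (RAssign 6 N0 (NReg 8) (sc 11))))
    (For 8 (NReg 2) (Seq (SumLoop 10 (NReg 2) (LtE (ve 6 10) (ve 6 8)) 11)
      (RAssign 4 N0 (NReg 8) (LtE (Mul (rn 100) (sc 11)) (Mul (rn 99) (OfNat (NReg 2)))))))"

lemma writes_PruneC [simp]: "wregs PruneC = {8, 9, 10}" "warrs PruneC = {4, 6, 11}"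
  by (auto simp: PruneC_def)

lemma exec_PruneC:
  assumes s: "sized d k z s" "row0 s 5 d c"
  shows "\<exists>t s'. exec u PruneC s t s' \<and> t \<le> 1000 * k * k * d \<and> row0 s' 4 k (prune k (sqdist d z c))"
proof -
  obtain d' k' where dk: "d = Suc d'" "k = Suc k'"
    using s by (metis sized_def gr0_implies_Suc)
  let ?D = "sqdist d z c"
  let ?e1 = "Mul (Sub (mx 3 8 9) (ve 5 9)) (Sub (mx 3 8 9) (ve 5 9))"
  let ?e2 = "LtE (ve 6 10) (ve 6 8)" and ?e3 = "LtE (Mul (rn 100) (sc 11)) (Mul (rn 99) (OfNat (NReg 2)))"
  let ?c1 = "For 8 (NReg 2) (Seq (SumLoop 9 (NReg 1) ?e1 11) (RAssign 6 N0 (NReg 8) (sc 11)))"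
  have "\<exists>t s'. exec u PruneC s t s' \<and> t \<le> 1 +
      (k + 1) * ((d + 1) * (rcost ?e1 + ncost (NReg 1) + 30) + rcost (sc 11) + ncost N0 + ncost (NReg 2) + 20) +
      (k + 1) * ((k + 1) * (rcost ?e2 + ncost (NReg 2) + 30) + rcost ?e3 + ncost N0 + ncost (NReg 2) + 20) \<and>
      ((\<forall>i<k. cell s' (4, 0, i) = prune k ?D i) \<and> True)"
    unfolding PruneC_def
  proof (rule exec_SeqI[OF exec_tabulate_sum[where f = "\<lambda>i j. (z i j - c j)\<^sup>2" and g = ?D and n = k and n' = d and p = 0]])
    fix s1 assume s1: "(\<forall>i<k. cell s1 (6, 0, i) = ?D i) \<and> (\<forall>q j. q \<noteq> 0 \<longrightarrow> cell s1 (6, q, j) = cell s (6, q, j))"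
      "agree (wregs ?c1) (warrs ?c1) s s1"
    have g: "(if 100 * (\<Sum>l<k. if ?D l < ?D i then 1 else 0) < 99 * real k then 1 else 0) = prune k ?D i" for i
      unfolding sum_indicator prune_def by simp
    show "\<exists>t s'. exec u (For 8 (NReg 2) (Seq (SumLoop 10 (NReg 2) ?e2 11) (RAssign 4 N0 (NReg 8) ?e3))) s1 t s' \<and>
      t \<le> (k + 1) * ((k + 1) * (rcost ?e2 + ncost (NReg 2) + 30) + rcost ?e3 + ncost N0 + ncost (NReg 2) + 20) \<and>
      ((\<forall>i<k. cell s' (4, 0, i) = prune k ?D i) \<and> True)"
      by (rule exec_weaken, rule exec_tabulate_sum[where f = "\<lambda>i l. if ?D l < ?D i then 1 else 0" and g = "prune k ?D" and n = k and n' = k and p = 0])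
         (use s s1 g in \<open>auto simp: agree_def sized_def row0_def\<close>)
  qed (use s in \<open>auto simp: agree_def sized_def row0_def power2_eq_square sqdist_def\<close>)
  then show ?thesis
    by (rule exec_weaken) (simp add: dk algebra_simps, simp add: row0_def)
qed

section \<open>The whole estimator as a program\<close>

text \<open>
  Without logarithms, \<open>log (1/\<delta>)\<close> is measured by counting multiplications. This base makes the count at least
  \<open>3600 log (1/\<delta>)\<close> and still at most twice the number \<open>k\<close> of the theorem.
\<close>

definition ratio :: real where "ratio = 3601 / 3600"

definition bucket_count :: "real \<Rightarrow> nat" where
  "bucket_count \<delta> = (LEAST k. 1 \<le> \<delta> * ratio ^ k)"

definition log4 :: "nat \<Rightarrow> nat" where
  "log4 d = (LEAST m. d \<le> 4 ^ m)"

lemma bucket_count_props: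
  assumes "0 < \<delta>"
  shows "1 \<le> \<delta> * ratio ^ bucket_count \<delta>" "\<And>i. i < bucket_count \<delta> \<Longrightarrow> \<delta> * ratio ^ i < 1"
proof -
  obtain n where "1 / \<delta> < ratio ^ n" using real_arch_pow[of ratio "1 / \<delta>"] by (auto simp: ratio_def)
  then have "1 \<le> \<delta> * ratio ^ n" using assms by (simp add: field_simps)
  then show "1 \<le> \<delta> * ratio ^ bucket_count \<delta>" unfolding bucket_count_def by (rule LeastI)
  show "\<delta> * ratio ^ i < 1" if "i < bucket_count \<delta>" for i
    using not_less_Least[OF that[unfolded bucket_count_def]] by simp
qed

lemma log4_props: "d \<le> 4 ^ log4 d" "\<And>i. i < log4 d \<Longrightarrow> 4 ^ i < d"
proof -
  have "d \<le> 4 ^ d" by (rule less_imp_le[OF less_exp[of d, THEN less_le_trans]]) (simp add: power_mono)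
  then show "d \<le> 4 ^ log4 d" unfolding log4_def by (rule LeastI)
  show "4 ^ i < d" if "i < log4 d" for i
    using not_less_Least[OF that[unfolded log4_def]] by simp
qed

definition SizesC :: com where
  "SizesC = Seq (RAssign 11 N0 N0 (sc 1)) (Seq (NAssign 2 N0)
    (Seq (While (RLess (sc 11) (rn 1)) (Seq (RAssign 11 N0 N0 (Mul (sc 11) (Div (rn 3601) (rn 3600)))) (NAssign 2 (NAdd (NReg 2) (NConst 1)))))
    (Seq (NAssign 3 N0) (Seq (NAssign 6 (NReg 2))
    (Seq (While (Not (NLess (NReg 0) (NReg 6))) (Seq (NAssign 6 (NAdd (NReg 6) (NReg 2))) (NAssign 3 (NAdd (NReg 3) (NConst 1)))))
    (Seq (NAssign 4 N0) (Seq (NAssign 6 (NConst 1))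
    (Seq (While (NLess (NReg 6) (NReg 1)) (Seq (NAssign 6 (NAdd (NAdd (NReg 6) (NReg 6)) (NAdd (NReg 6) (NReg 6)))) (NAssign 4 (NAdd (NReg 4) (NConst 1)))))
    (Seq (NAssign 5 N0)
      (For 7 (NAdd (NReg 4) (NConst 1))
        (NAssign 5 (NAdd (NReg 5) (NAdd (NAdd (NAdd (NReg 4) (NReg 4)) (NAdd (NReg 4) (NReg 4))) (NConst 4))))))))))))))"

lemma writes_SizesC [simp]: "wregs SizesC = {2, 3, 4, 5, 6, 7}" "warrs SizesC = {11}"
  by (auto simp: SizesC_def)

lemma exec_SizesC:
  assumes s: "reg s 0 = n" "reg s 1 = d" "cell s (1, 0, 0) = \<delta>" "0 < \<delta>" and k: "bucket_count \<delta> = k" "0 < k"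
    and m: "log4 d = m"
  shows "\<exists>t s'. exec u SizesC s t s' \<and> t \<le> 200 * (k + n div k + m + 1) \<and>
    (reg s' 2 = k \<and> reg s' 3 = n div k \<and> reg s' 4 = m \<and> reg s' 5 = 4 * (m + 1)\<^sup>2)"
proof -
  let ?b1 = "RLess (sc 11) (rn 1)" and ?b2 = "Not (NLess (NReg 0) (NReg 6))" and ?b3 = "NLess (NReg 6) (NReg 1)"
  let ?e1 = "Mul (sc 11) (Div (rn 3601) (rn 3600))" and ?e3 = "NAdd (NAdd (NReg 6) (NReg 6)) (NAdd (NReg 6) (NReg 6))"
  let ?inc = "\<lambda>r. NAdd (NReg r) (NConst 1)" and ?e4 = "NAdd (NReg 5) (NAdd (NAdd (NAdd (NReg 4) (NReg 4)) (NAdd (NReg 4) (NReg 4))) (NConst 4))"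
  let ?w1 = "Seq (RAssign 11 N0 N0 ?e1) (NAssign 2 (?inc 2))"
  let ?w2 = "Seq (NAssign 6 (NAdd (NReg 6) (NReg 2))) (NAssign 3 (?inc 3))"
  let ?w3 = "Seq (NAssign 6 ?e3) (NAssign 4 (?inc 4))"
  let ?K = "\<lambda>s::state. reg s 0 = n \<and> reg s 1 = d"
  let ?I1 = "\<lambda>i (s::state). ?K s \<and> reg s 2 = i \<and> cell s (11, 0, 0) = \<delta> * ratio ^ i"
  let ?I2 = "\<lambda>i (s::state). ?K s \<and> reg s 2 = k \<and> reg s 3 = i \<and> reg s 6 = (i + 1) * k"
  let ?I3 = "\<lambda>i (s::state). ?K s \<and> reg s 2 = k \<and> reg s 3 = n div k \<and> reg s 4 = i \<and> reg s 6 = 4 ^ i"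
  let ?I4 = "\<lambda>i (s::state). reg s 2 = k \<and> reg s 3 = n div k \<and> reg s 4 = m \<and> reg s 5 = i * (4 * m + 4)"
  note bc = bucket_count_props[OF s(4), unfolded k(1)] and lg = log4_props(1)[of d, unfolded m] log4_props(2)[of _ d, unfolded m]
  have w1: "\<exists>t s'. exec u (While ?b1 ?w1) s t s' \<and> t \<le> (k + 1) * (1 + bcost ?b1 + (1 + (1 + 1 + 1 + rcost ?e1) + (1 + ncost (?inc 2)))) \<and> ?I1 k s'"
    if "?I1 0 s" for s
  proof (rule exec_WhileI[where Inv = ?I1, OF that])
    fix i s1 assume i: "i < k" and I: "?I1 i s1"
    have "\<exists>t s2. exec u ?w1 s1 t s2 \<and> t \<le> 1 + (1 + ncost N0 + ncost N0 + rcost ?e1) + (1 + ncost (?inc 2)) \<and> ?I1 (Suc i) s2"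
      apply (rule exec_SeqI[OF exec_RAssignI[where Q = "\<lambda>s. ?K s \<and> reg s 2 = i \<and> cell s (11, 0, 0) = \<delta> * ratio ^ Suc i"]])
      subgoal using I by (simp add: ratio_def)
      subgoal by (rule exec_NAssignI) simp
      done
    then show "bval ?b1 s1 \<and> (\<exists>t s2. exec u ?w1 s1 t s2 \<and> t \<le> 1 + (1 + 1 + 1 + rcost ?e1) + (1 + ncost (?inc 2)) \<and> ?I1 (Suc i) s2)"
      using bc(2)[OF i] I by simp
  next
    fix s1 assume "?I1 k s1" then show "\<not> bval ?b1 s1" using bc(1) by simp
  qed
  have w2: "\<exists>t s'. exec u (While ?b2 ?w2) s t s' \<and> t \<le> (n div k + 1) * (1 + bcost ?b2 + (1 + (1 + 3) + (1 + ncost (?inc 3)))) \<and> ?I2 (n div k) s'"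
    if "?I2 0 s" for s
  proof (rule exec_WhileI[where Inv = ?I2, OF that])
    fix i s1 assume i: "i < n div k" and I: "?I2 i s1"
    have "\<exists>t s2. exec u ?w2 s1 t s2 \<and> t \<le> 1 + (1 + ncost (NAdd (NReg 6) (NReg 2))) + (1 + ncost (?inc 3)) \<and> ?I2 (Suc i) s2"
      apply (rule exec_SeqI[OF exec_NAssignI[where Q = "\<lambda>s. ?K s \<and> reg s 2 = k \<and> reg s 3 = i \<and> reg s 6 = (Suc i + 1) * k"]])
      subgoal using I by simp
      subgoal by (rule exec_NAssignI) simp
      done
    moreover have "(i + 1) * k \<le> n" using i k(2) by (metis Suc_eq_plus1 Suc_leI less_eq_div_iff_mult_less_eq)
    ultimately show "bval ?b2 s1 \<and> (\<exists>t s2. exec u ?w2 s1 t s2 \<and> t \<le> 1 + (1 + 3) + (1 + ncost (?inc 3)) \<and> ?I2 (Suc i) s2)"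
      using I by (simp add: eval_nat_numeral)
  next
    fix s1 assume I: "?I2 (n div k) s1"
    have "n < (n div k + 1) * k" using k(2) by (metis Suc_eq_plus1 dividend_less_div_times add.commute mult_Suc)
    then show "\<not> bval ?b2 s1" using I by simp
  qed
  have w3: "\<exists>t s'. exec u (While ?b3 ?w3) s t s' \<and> t \<le> (m + 1) * (1 + bcost ?b3 + (1 + (1 + ncost ?e3) + (1 + ncost (?inc 4)))) \<and> ?I3 m s'"
    if "?I3 0 s" for s
  proof (rule exec_WhileI[where Inv = ?I3, OF that])
    fix i s1 assume i: "i < m" and I: "?I3 i s1"
    have "\<exists>t s2. exec u ?w3 s1 t s2 \<and> t \<le> 1 + (1 + ncost ?e3) + (1 + ncost (?inc 4)) \<and> ?I3 (Suc i) s2"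
      apply (rule exec_SeqI[OF exec_NAssignI[where Q = "\<lambda>s. ?K s \<and> reg s 2 = k \<and> reg s 3 = n div k \<and> reg s 4 = i \<and> reg s 6 = 4 ^ Suc i"]])
      subgoal using I by simp
      subgoal by (rule exec_NAssignI) simp
      done
    then show "bval ?b3 s1 \<and> (\<exists>t s2. exec u ?w3 s1 t s2 \<and> t \<le> 1 + (1 + ncost ?e3) + (1 + ncost (?inc 4)) \<and> ?I3 (Suc i) s2)"
      using lg(2)[OF i] I by simp
  next
    fix s1 assume "?I3 m s1" then show "\<not> bval ?b3 s1" using lg(1) by simp
  qed
  have w4: "\<exists>t s'. exec u (For 7 (?inc 4) (NAssign 5 ?e4)) s t s' \<and> t \<le> (m + 1 + 1) * ((1 + ncost ?e4) + ncost (?inc 4) + 12) \<and> ?I4 (m + 1) s'"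
    if "?I4 0 s" for s
  proof (rule exec_For[where Inv = ?I4])
    fix i s1 assume "?I4 i s1"
    then show "\<exists>t s2. exec u (NAssign 5 ?e4) s1 t s2 \<and> t \<le> 1 + ncost ?e4 \<and> ?I4 (Suc i) s2"
      by (intro exec_NAssignI) simp
  qed (use that in \<open>auto simp: agree_def\<close>)
  have "\<exists>t s'. exec u SizesC s t s' \<and> t \<le> 1 + (1 + ncost N0 + ncost N0 + rcost (sc 1)) + (1 + (1 + ncost N0) +
    (1 + ((k + 1) * (1 + bcost ?b1 + (1 + (1 + 1 + 1 + rcost ?e1) + (1 + ncost (?inc 2))))) +
    (1 + (1 + ncost N0) + (1 + (1 + ncost (NReg 2)) +
    (1 + ((n div k + 1) * (1 + bcost ?b2 + (1 + (1 + 3) + (1 + ncost (?inc 3))))) +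
    (1 + (1 + ncost N0) + (1 + (1 + ncost (NConst 1)) +
    (1 + ((m + 1) * (1 + bcost ?b3 + (1 + (1 + ncost ?e3) + (1 + ncost (?inc 4))))) +
    (1 + (1 + ncost N0) + ((m + 1 + 1) * ((1 + ncost ?e4) + ncost (?inc 4) + 12)))))))))))
    \<and> ?I4 (m + 1) s'"
    unfolding SizesC_def
    apply (rule exec_SeqI[OF exec_RAssignI[where Q = "\<lambda>s. ?K s \<and> cell s (11, 0, 0) = \<delta>"]])
    subgoal using s by simp
    apply (rule exec_SeqI[OF exec_NAssignI[where Q = "?I1 0"]])
    subgoal by simp
    apply (rule exec_SeqI[OF w1])
    subgoal by simp
    apply (rule exec_SeqI[OF exec_NAssignI[where Q = "\<lambda>s. ?K s \<and> reg s 2 = k \<and> reg s 3 = 0"]])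
    subgoal by simp
    apply (rule exec_SeqI[OF exec_NAssignI[where Q = "?I2 0"]])
    subgoal by simp
    apply (rule exec_SeqI[OF w2])
    subgoal by simp
    apply (rule exec_SeqI[OF exec_NAssignI[where Q = "\<lambda>s. ?K s \<and> reg s 2 = k \<and> reg s 3 = n div k \<and> reg s 4 = 0"]])
    subgoal by simp
    apply (rule exec_SeqI[OF exec_NAssignI[where Q = "?I3 0"]])
    subgoal by simp
    apply (rule exec_SeqI[OF w3])
    subgoal by simp
    apply (rule exec_SeqI[OF exec_NAssignI[where Q = "?I4 0"]])
    subgoal by simp
    apply (rule w4)
    subgoal by simp
    done
  then show ?thesis
    by (rule exec_weaken) (simp add: algebra_simps, simp add: power2_eq_square algebra_simps)
qed

text \<open>
  Indices can be added but not multiplied, so the offset \<open>b w\<close> of block \<open>b\<close> is carried in register 6.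
\<close>

definition BlocksC :: com where
  "BlocksC = Seq (NAssign 6 N0) (For 7 (NReg 2) (Seq
    (For 9 (NReg 1) (Seq (SumLoop 8 (NReg 3) (Cell 0 (NAdd (NReg 6) (NReg 8)) (NReg 9)) 11)
      (RAssign 3 (NReg 7) (NReg 9) (Div (sc 11) (OfNat (NReg 3))))))
    (NAssign 6 (NAdd (NReg 6) (NReg 3)))))"

lemma writes_BlocksC [simp]: "wregs BlocksC = {6, 7, 8, 9}" "warrs BlocksC = {3, 11}"
  by (auto simp: BlocksC_def)

definition array_block_mean :: "nat \<Rightarrow> (nat \<Rightarrow> nat \<Rightarrow> real) \<Rightarrow> nat \<Rightarrow> nat \<Rightarrow> real" where
  "array_block_mean w x b j = (\<Sum>l<w. x (b * w + l) j) / real w"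

lemma exec_BlocksC:
  assumes s: "reg s 1 = d" "reg s 2 = k" "reg s 3 = w" and pos: "0 < d" "0 < k" "0 < w" and le: "k * w \<le> n"
    and x: "\<forall>i<n. \<forall>j<d. cell s (0, i, j) = x i j"
  shows "\<exists>t s'. exec u BlocksC s t s' \<and> t \<le> 1000 * (k * w * d) \<and> sized d k (array_block_mean w x) s'"
proof -
  let ?z = "array_block_mean w x"
  let ?e = "Cell 0 (NAdd (NReg 6) (NReg 8)) (NReg 9)"
  let ?c1 = "For 9 (NReg 1) (Seq (SumLoop 8 (NReg 3) ?e 11) (RAssign 3 (NReg 7) (NReg 9) (Div (sc 11) (OfNat (NReg 3)))))"
  let ?c2 = "NAssign 6 (NAdd (NReg 6) (NReg 3))"
  let ?T1 = "(d + 1) * ((w + 1) * (rcost ?e + ncost (NReg 3) + 30) + rcost (Div (sc 11) (OfNat (NReg 3))) + ncost (NReg 7) + ncost (NReg 1) + 20)"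
  let ?T2 = "1 + ncost (NAdd (NReg 6) (NReg 3))"
  obtain d' k' w' where dk: "d = Suc d'" "k = Suc k'" "w = Suc w'" using pos by (metis gr0_implies_Suc)
  let ?Inv = "\<lambda>b (s::state). reg s 6 = b * w \<and> (\<forall>b'<b. \<forall>j<d. cell s (3, b', j) = ?z b' j)"
  have "\<exists>t s'. exec u BlocksC s t s' \<and> t \<le> 1 + (1 + ncost N0) + (k + 1) * ((1 + ?T1 + ?T2) + ncost (NReg 2) + 12) \<and> ?Inv k s'"
    unfolding BlocksC_def
  proof (rule exec_SeqI[OF exec_NAssignI[where Q = "\<lambda>s. reg s 6 = 0"]])
    fix s1 assume s1: "reg s1 6 = 0" "agree (wregs (NAssign 6 N0)) (warrs (NAssign 6 N0)) s s1"
    show "\<exists>t s'. exec u (For 7 (NReg 2) (Seq ?c1 ?c2)) s1 t s' \<and> t \<le> (k + 1) * ((1 + ?T1 + ?T2) + ncost (NReg 2) + 12) \<and> ?Inv k s'"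
    proof (rule exec_For)
      fix b s2 assume b: "b < k" "reg s2 7 = b" and a: "agree (insert 7 (wregs (Seq ?c1 ?c2))) (warrs (Seq ?c1 ?c2)) s1 s2" and I: "?Inv b s2"
      have S2: "reg s2 1 = d" "reg s2 2 = k" "reg s2 3 = w" "\<forall>i<n. \<forall>j<d. cell s2 (0, i, j) = x i j"
        using s x s1(2) a by (auto simp: agree_def)
      have bw: "b * w + l < n" if "l < w" for l
        using mult_le_mono1[of "Suc b" k w] b(1) le that by simp
      show "\<exists>t s3. exec u (Seq ?c1 ?c2) s2 t s3 \<and> t \<le> 1 + ?T1 + ?T2 \<and> ?Inv (Suc b) s3"
      proof (rule exec_SeqI[OF exec_tabulate_sum[where f = "\<lambda>j l. x (b * w + l) j" and g = "?z b" and n = d and n' = w and p = b]])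
        fix s3 assume s3: "(\<forall>i<d. cell s3 (3, b, i) = ?z b i) \<and> (\<forall>q j. q \<noteq> b \<longrightarrow> cell s3 (3, q, j) = cell s2 (3, q, j))"
          "agree (wregs ?c1) (warrs ?c1) s2 s3"
        have "reg s3 6 = b * w" "reg s3 3 = w" using S2 I s3(2) by (auto simp: agree_def)
        then show "\<exists>t s4. exec u ?c2 s3 t s4 \<and> t \<le> ?T2 \<and> ?Inv (Suc b) s4"
          using s3(1) I by (intro exec_NAssignI) (auto simp: less_Suc_eq)
      qed (use S2 b I bw in \<open>auto simp: agree_def array_block_mean_def\<close>)
    qed (use s s1 in \<open>auto simp: agree_def\<close>)
  qed simp
  then show ?thesis
  proof (rule exec_weaken, goal_cases)
    case 1
    show ?case by (simp add: dk algebra_simps)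
  next
    case (2 s')
    then show ?case using s pos by (auto simp: agree_def sized_def)
  qed
qed

definition MeanEstimator :: com where
  "MeanEstimator = Seq SizesC (Seq BlocksC (Seq MedianC (Seq PruneC FilterC)))"

theorem exec_MeanEstimator:
  fixes x :: "nat \<Rightarrow> nat \<Rightarrow> real"
  assumes d: "0 < d" and \<delta>: "0 < \<delta>" and k: "bucket_count \<delta> = k" "0 < k" "k \<le> n"
  defines "w \<equiv> n div k" and "m \<equiv> log4 d"
  defines "z \<equiv> array_block_mean w x"
  shows "\<exists>t s' c. exec u MeanEstimator (init_state n d \<delta> x) t s' \<and>
    t \<le> 2000 * (n * d) + 60000 * (k * k * d) * (m + 1) ^ 3 \<and> coord_median d k z c \<and>
    (\<forall>j<d. cell s' (2, 0, j) = wmean k z ((filter_step d k m z ^^ (4 * (m + 1)\<^sup>2)) (prune k (sqdist d z c))) j)"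
proof -
  let ?s = "init_state n d \<delta> x" and ?N = "4 * (m + 1)\<^sup>2"
  have w: "0 < w" "k * w \<le> n" using k by (auto simp: w_def div_greater_zero_iff)
  let ?T5 = "(?N + 1) * (4100 * k * k * d * (m + 1)) + 500 * k * d"
  let ?Q = "\<lambda>s'. \<exists>c. coord_median d k z c \<and>
    row0 s' 2 d (wmean k z ((filter_step d k m z ^^ ?N) (prune k (sqdist d z c))))"
  have "\<exists>t s'. exec u MeanEstimator ?s t s' \<and>
    t \<le> 1 + 200 * (k + n div k + m + 1) + (1 + 1000 * (k * w * d) + (1 + 2000 * k * k * d + (1 + 1000 * k * k * d + ?T5))) \<and> ?Q s'"
    unfolding MeanEstimator_def
  proof (rule exec_SeqI[OF exec_SizesC[OF _ _ _ \<delta> k(1,2)]])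
    fix s1 assume s1: "reg s1 2 = k \<and> reg s1 3 = n div k \<and> reg s1 4 = m \<and> reg s1 5 = ?N"
      "agree (wregs SizesC) (warrs SizesC) ?s s1"
    have S1: "reg s1 1 = d" "reg s1 2 = k" "reg s1 3 = w" "\<forall>i<n. \<forall>j<d. cell s1 (0, i, j) = x i j"
      using s1 by (auto simp: agree_def init_state_def w_def)
    show "\<exists>t s'. exec u (Seq BlocksC (Seq MedianC (Seq PruneC FilterC))) s1 t s' \<and>
      t \<le> 1 + 1000 * (k * w * d) + (1 + 2000 * k * k * d + (1 + 1000 * k * k * d + ?T5)) \<and> ?Q s'"
    proof (rule exec_SeqI[OF exec_BlocksC[OF S1(1-3) d k(2) w S1(4), folded z_def]])
      fix s2 assume s2: "sized d k z s2" "agree (wregs BlocksC) (warrs BlocksC) s1 s2"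
      show "\<exists>t s'. exec u (Seq MedianC (Seq PruneC FilterC)) s2 t s' \<and>
        t \<le> 1 + 2000 * k * k * d + (1 + 1000 * k * k * d + ?T5) \<and> ?Q s'"
      proof (rule exec_SeqI[OF exec_MedianC[OF s2(1)]])
        fix s3 assume s3: "coord_median d k z (\<lambda>j. cell s3 (5, 0, j))" "agree (wregs MedianC) (warrs MedianC) s2 s3"
        define c where "c = (\<lambda>j. cell s3 (5, 0, j))"
        have S3: "sized d k z s3" "row0 s3 5 d c" using s2(1) s3(2) by (auto simp: agree_def sized_def row0_def c_def)
        show "\<exists>t s'. exec u (Seq PruneC FilterC) s3 t s' \<and> t \<le> 1 + 1000 * k * k * d + ?T5 \<and> ?Q s'"
        proof (rule exec_SeqI[OF exec_PruneC[OF S3]])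
          fix s4 assume s4: "row0 s4 4 k (prune k (sqdist d z c))" "agree (wregs PruneC) (warrs PruneC) s3 s4"
          have "sized d k z s4" "reg s4 4 = m" "reg s4 5 = ?N"
            using s1(1) s2(2) s3(2) s4(2) S3 by (auto simp: agree_def sized_def)
          from exec_FilterC[OF this(1) s4(1) this(2,3)]
          show "\<exists>t s'. exec u FilterC s4 t s' \<and> t \<le> ?T5 \<and> ?Q s'"
            by (rule exec_weaken) (use s3(1) in \<open>auto simp: c_def\<close>)
        qed
      qed
    qed
  qed (auto simp: init_state_def m_def)
  then obtain t s' c where E: "exec u MeanEstimator ?s t s'"
    and t: "t \<le> 1 + 200 * (k + n div k + m + 1) + (1 + 1000 * (k * w * d) + (1 + 2000 * k * k * d + (1 + 1000 * k * k * d + ?T5)))"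
    and c: "coord_median d k z c" "row0 s' 2 d (wmean k z ((filter_step d k m z ^^ ?N) (prune k (sqdist d z c))))"
    by blast
  have "t \<le> 2000 * (n * d) + 60000 * (k * k * d) * (m + 1) ^ 3"
  proof -
    obtain d' k' where dk: "d = Suc d'" "k = Suc k'" using d k by (metis gr0_implies_Suc)
    have "n div k \<le> n" by simp
    moreover have "n \<le> n * d" using d by simp
    moreover have "k * w * d \<le> n * d" using w by simp
    moreover have "?T5 + 200 * m + 2000 * k * k * d + 1000 * k * k * d + 204 + 200 * k \<le> 60000 * (k * k * d) * (m + 1) ^ 3"
      by (simp add: dk algebra_simps power2_eq_square power3_eq_cube)
    moreover have "t \<le> 2000 * nd + R" if "t \<le> 1 + 200 * (k + q + m + 1) + (1 + 1000 * a + (1 + c1 + (1 + c2 + T)))"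
      "q \<le> n" "n \<le> nd" "a \<le> nd" "T + 200 * m + c1 + c2 + 204 + 200 * k \<le> R" for q nd a c1 c2 T R
      using that by simp
    ultimately show ?thesis using t by blast
  qed
  with E c show ?thesis unfolding row0_def by blast
qed

section \<open>Programs compute measurable functions\<close>

definition state_space :: "state measure" where
  "state_space = vimage_algebra UNIV (\<lambda>s. (reg s, cell s))
     ((\<Pi>\<^sub>M r\<in>UNIV. count_space UNIV) \<Otimes>\<^sub>M (\<Pi>\<^sub>M p\<in>UNIV. borel))"

lemma space_state_space [simp]: "space state_space = UNIV"
  by (simp add: state_space_def)

lemma measurable_reg [measurable]: "(\<lambda>s. reg s r) \<in> state_space \<rightarrow>\<^sub>M count_space UNIV"
proof -
  have "(\<lambda>s. (reg s, cell s)) \<in> state_space \<rightarrow>\<^sub>M (\<Pi>\<^sub>M r\<in>UNIV. count_space UNIV) \<Otimes>\<^sub>M (\<Pi>\<^sub>M p\<in>UNIV. borel)"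
    unfolding state_space_def by (rule measurable_vimage_algebra1) (simp add: space_pair_measure space_PiM)
  from measurable_compose[OF measurable_compose[OF this measurable_fst] measurable_component_singleton[of r]]
  show ?thesis by simp
qed

lemma measurable_cell [measurable]: "(\<lambda>s. cell s p) \<in> borel_measurable state_space"
proof -
  have "(\<lambda>s. (reg s, cell s)) \<in> state_space \<rightarrow>\<^sub>M (\<Pi>\<^sub>M r\<in>UNIV. count_space UNIV) \<Otimes>\<^sub>M (\<Pi>\<^sub>M p\<in>UNIV. borel)"
    unfolding state_space_def by (rule measurable_vimage_algebra1) (simp add: space_pair_measure space_PiM)
  from measurable_compose[OF measurable_compose[OF this measurable_snd] measurable_component_singleton[of p]]
  show ?thesis by simp
qed

lemma measurable_state:
  assumes "\<And>r. (\<lambda>x. reg (f x) r) \<in> M \<rightarrow>\<^sub>M count_space UNIV" "\<And>p. (\<lambda>x. cell (f x) p) \<in> borel_measurable M"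
  shows "f \<in> M \<rightarrow>\<^sub>M state_space"
  unfolding state_space_def
proof (rule measurable_vimage_algebra2)
  have "(\<lambda>x. reg (f x)) \<in> M \<rightarrow>\<^sub>M (\<Pi>\<^sub>M r\<in>UNIV. count_space UNIV)"
    using measurable_restrict[of UNIV "\<lambda>r x. reg (f x) r" M "\<lambda>_. count_space UNIV", OF assms(1)]
    by (simp only: restrict_UNIV)
  moreover have "(\<lambda>x. cell (f x)) \<in> M \<rightarrow>\<^sub>M (\<Pi>\<^sub>M p\<in>UNIV. borel)"
    using measurable_restrict[of UNIV "\<lambda>p x. cell (f x) p" M "\<lambda>_. borel", OF assms(2)]
    by (simp only: restrict_UNIV)
  ultimately show "(\<lambda>x. (reg (f x), cell (f x))) \<in> M \<rightarrow>\<^sub>M (\<Pi>\<^sub>M r\<in>UNIV. count_space UNIV) \<Otimes>\<^sub>M (\<Pi>\<^sub>M p\<in>UNIV. borel)"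
    by (rule measurable_Pair)
qed auto

lemma measurable_nval [measurable]: "nval e \<in> state_space \<rightarrow>\<^sub>M count_space UNIV"
proof (induction e)
  case (NConst c)
  show ?case unfolding nval.simps[abs_def] by measurable
next
  case (NReg r)
  show ?case unfolding nval.simps[abs_def] by measurable
next
  case (NAdd e f)
  note [measurable] = this
  show ?case unfolding nval.simps[abs_def] by measurable
next
  case (NSub e f)
  note [measurable] = this
  show ?case unfolding nval.simps[abs_def] by measurable
qed

lemma measurable_rval [measurable]: "rval e \<in> borel_measurable state_space"
proof (induction e)
  case (Cell a i j)
  have "(\<lambda>s. cell s (a, nval i s, nval j s)) \<in> borel_measurable state_space"
    using measurable_compose_countable[where f = "\<lambda>q s. cell s (a, q)" and g = "\<lambda>s. (nval i s, nval j s)"]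
    by measurable
  then show ?case by simp
next
  case (OfNat e)
  have "(\<lambda>s. real (nval e s)) \<in> borel_measurable state_space" by measurable
  then show ?case by simp
qed (auto simp: fun_eq_iff[symmetric])

lemma measurable_bval [measurable]: "Measurable.pred state_space (bval b)"
proof (induction b)
  case (NLess e f)
  have "Measurable.pred state_space (\<lambda>s. real (nval e s) < real (nval f s))" by measurable
  then show ?case by simp
next
  case (RLess e f)
  have "Measurable.pred state_space (\<lambda>s. rval e s < rval f s)" by measurable
  then show ?case by simp
next
  case (Not b)
  have "Measurable.pred state_space (\<lambda>s. \<not> bval b s)" using Not by measurable
  then show ?case by simp
next
  case (And b c)
  have "Measurable.pred state_space (\<lambda>s. bval b s \<and> bval c s)" using And by measurable
  then show ?case by simp
qed

primrec draw_free :: "com \<Rightarrow> bool" where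
  "draw_free Skip = True"
| "draw_free (NAssign r e) = True"
| "draw_free (RAssign a i j e) = True"
| "draw_free (Draw a i j) = False"
| "draw_free (Seq c1 c2) = (draw_free c1 \<and> draw_free c2)"
| "draw_free (If b c1 c2) = (draw_free c1 \<and> draw_free c2)"
| "draw_free (While b c) = draw_free c"

lemma exec_draw_free: "exec u c s t s' \<Longrightarrow> draw_free c \<Longrightarrow> exec u' c s t s'"
  by (induction rule: exec.induct) (auto intro: exec.intros[simplified])

definition halts :: "com \<Rightarrow> state set" where
  "halts c = {s. \<exists>t s'. exec (\<lambda>_. 0) c s t s'}"

text \<open>The state is left unchanged where \<open>c\<close> diverges, which makes \<open>result c\<close> total.\<close>

definition result :: "com \<Rightarrow> state \<Rightarrow> state" where
  "result c s = (if s \<in> halts c then SOME s'. \<exists>t. exec (\<lambda>_. 0) c s t s' else s)"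

lemma result_eq: "exec (\<lambda>_. 0) c s t s' \<Longrightarrow> result c s = s'"
proof -
  assume e: "exec (\<lambda>_. 0) c s t s'"
  then have "\<exists>t. exec (\<lambda>_. 0) c s t (SOME s'. \<exists>t. exec (\<lambda>_. 0) c s t s')"
    by (intro someI[where P = "\<lambda>s'. \<exists>t. exec (\<lambda>_. 0) c s t s'"]) blast
  then have "(SOME s'. \<exists>t. exec (\<lambda>_. 0) c s t s') = s'" using exec_deterministic[OF e] by blast
  then show "result c s = s'" using e unfolding result_def halts_def by auto
qed

lemma exec_result: "s \<in> halts c \<Longrightarrow> \<exists>t. exec (\<lambda>_. 0) c s t (result c s)"
  using result_eq unfolding halts_def by blast

lemma result_diverge: "s \<notin> halts c \<Longrightarrow> result c s = s"
  by (simp add: result_def)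

lemma halts_Seq: "halts (Seq c1 c2) = {s. s \<in> halts c1 \<and> result c1 s \<in> halts c2}"
proof (intro set_eqI iffI)
  fix s assume "s \<in> halts (Seq c1 c2)"
  then obtain t s' where "exec (\<lambda>_. 0) (Seq c1 c2) s t s'" unfolding halts_def by blast
  then obtain t1 z t2 where "exec (\<lambda>_. 0) c1 s t1 z" "exec (\<lambda>_. 0) c2 z t2 s'" by (blast elim: exec_SeqE)
  then show "s \<in> {s. s \<in> halts c1 \<and> result c1 s \<in> halts c2}" using result_eq unfolding halts_def by blast
next
  fix s assume "s \<in> {s. s \<in> halts c1 \<and> result c1 s \<in> halts c2}"
  then obtain t1 t2 where "exec (\<lambda>_. 0) c1 s t1 (result c1 s)" "exec (\<lambda>_. 0) c2 (result c1 s) t2 (result c2 (result c1 s))"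
    using exec_result by blast
  then show "s \<in> halts (Seq c1 c2)" using exec.Seq unfolding halts_def by blast
qed

lemma result_Seq: "result (Seq c1 c2) s = (if s \<in> halts (Seq c1 c2) then result c2 (result c1 s) else s)"
proof (cases "s \<in> halts (Seq c1 c2)")
  case True
  then obtain t1 t2 where "exec (\<lambda>_. 0) c1 s t1 (result c1 s)" "exec (\<lambda>_. 0) c2 (result c1 s) t2 (result c2 (result c1 s))"
    unfolding halts_Seq using exec_result by blast
  from result_eq[OF exec.Seq[OF this]] show ?thesis using True by simp
qed (simp add: result_diverge)

lemma halts_If: "s \<in> halts (If b c1 c2) \<longleftrightarrow> (if bval b s then s \<in> halts c1 else s \<in> halts c2)"
  unfolding halts_def by (auto elim!: exec_IfE intro: exec.IfTrue exec.IfFalse) 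

lemma result_If: "result (If b c1 c2) s = (if bval b s then result c1 s else result c2 s)"
proof (cases "s \<in> halts (If b c1 c2)")
  case True
  show ?thesis
  proof (cases "bval b s")
    case b: True
    then obtain t where "exec (\<lambda>_. 0) c1 s t (result c1 s)" using True exec_result by (auto simp: halts_If)
    from result_eq[OF exec.IfTrue[OF b this]] b show ?thesis by simp
  next
    case b: False
    then obtain t where "exec (\<lambda>_. 0) c2 s t (result c2 s)" using True exec_result by (auto simp: halts_If)
    from result_eq[OF exec.IfFalse[OF b this]] b show ?thesis by simp
  qed
qed (auto simp: halts_If result_diverge)

definition exits_after :: "bexp \<Rightarrow> com \<Rightarrow> nat \<Rightarrow> state \<Rightarrow> bool" where
  "exits_after b c j s \<longleftrightarrow>
    (\<forall>i<j. bval b ((result c ^^ i) s) \<and> (result c ^^ i) s \<in> halts c) \<and> \<not> bval b ((result c ^^ j) s)"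

lemma exits_after_Suc: "exits_after b c (Suc j) s \<longleftrightarrow> bval b s \<and> s \<in> halts c \<and> exits_after b c j (result c s)"
  unfolding exits_after_def All_less_Suc2 funpow_Suc_right by auto

lemma exits_after_exec: "exits_after b c j s \<Longrightarrow> \<exists>t. exec (\<lambda>_. 0) (While b c) s t ((result c ^^ j) s)"
proof (induction j arbitrary: s)
  case 0
  then have "\<not> bval b s" by (simp add: exits_after_def)
  from exec.WhileFalse[OF this] show ?case unfolding funpow_0 by blast
next
  case (Suc j)
  then have "bval b s" "s \<in> halts c" "exits_after b c j (result c s)" unfolding exits_after_Suc by auto
  moreover from this Suc.IH obtain t2 where "exec (\<lambda>_. 0) (While b c) (result c s) t2 ((result c ^^ j) (result c s))" by blast
  ultimately show ?case using exec_result[of s c] exec.WhileTrue by (metis comp_apply funpow_Suc_right)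
qed

lemma exec_exits_after: "exec (\<lambda>_. 0) (While b c) s t s' \<Longrightarrow> \<exists>j. exits_after b c j s"
proof (induction "While b c" s t s' rule: exec.induct)
  case (WhileFalse s)
  then show ?case by (intro exI[of _ 0]) (simp add: exits_after_def)
next
  case (WhileTrue s t1 s1 t2 s2)
  then obtain j where "exits_after b c j s1" by blast
  then have "exits_after b c (Suc j) s"
    using WhileTrue.hyps(1,2) result_eq[OF WhileTrue.hyps(2)] unfolding exits_after_Suc halts_def by auto
  then show ?case by blast
qed

lemma halts_While: "s \<in> halts (While b c) \<longleftrightarrow> (\<exists>j. exits_after b c j s)"
  using exits_after_exec exec_exits_after unfolding halts_def by blast

lemma result_While:
  "result (While b c) s =
    (if \<exists>j. exits_after b c j s then (result c ^^ (LEAST j. exits_after b c j s)) s else s)"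
proof (cases "\<exists>j. exits_after b c j s")
  case True
  then have "exits_after b c (LEAST j. exits_after b c j s) s" by (rule LeastI_ex)
  from exits_after_exec[OF this] show ?thesis using True result_eq by auto
qed (simp add: halts_While result_diverge)

text \<open>
  Programs compute measurable functions: a loop is the countable union, over the number of iterations,
  of compositions of measurable maps restricted to measurable sets.
\<close>

theorem measurable_result:
  "draw_free c \<Longrightarrow> halts c \<in> sets state_space \<and> result c \<in> state_space \<rightarrow>\<^sub>M state_space"
proof (induction c)
  case Skip
  have "result Skip = (\<lambda>s. s)" using result_eq[OF exec.Skip] by auto
  moreover have "halts Skip = UNIV" unfolding halts_def using exec.Skip by blast
  ultimately show ?case using sets.top[of state_space] by simp
next
  case (NAssign r e)
  have "result (NAssign r e) = (\<lambda>s. s\<lparr>reg := (reg s)(r := nval e s)\<rparr>)" using result_eq[OF exec.NAssign] by auto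
  moreover have "(\<lambda>s. s\<lparr>reg := (reg s)(r := nval e s)\<rparr>) \<in> state_space \<rightarrow>\<^sub>M state_space"
    by (rule measurable_state) (auto simp: fun_upd_def)
  moreover have "halts (NAssign r e) = UNIV" unfolding halts_def using exec.NAssign by blast
  ultimately show ?case using sets.top[of state_space] by simp
next
  case (RAssign a i j e)
  have "result (RAssign a i j e) = (\<lambda>s. s\<lparr>cell := (cell s)((a, nval i s, nval j s) := rval e s)\<rparr>)"
    using result_eq[OF exec.RAssign] by auto
  moreover have "(\<lambda>s. s\<lparr>cell := (cell s)((a, nval i s, nval j s) := rval e s)\<rparr>) \<in> state_space \<rightarrow>\<^sub>M state_space"
  proof (rule measurable_state)
    fix p :: "nat \<times> nat \<times> nat"
    obtain a' i' j' where p: "p = (a', i', j')" by (cases p)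
    have "(\<lambda>s. if a' = a \<and> i' = nval i s \<and> j' = nval j s then rval e s else cell s p) \<in> borel_measurable state_space"
      by measurable
    then show "(\<lambda>s. cell (s\<lparr>cell := (cell s)((a, nval i s, nval j s) := rval e s)\<rparr>) p) \<in> borel_measurable state_space"
      by (simp add: p fun_upd_def)
  qed auto
  moreover have "halts (RAssign a i j e) = UNIV" unfolding halts_def using exec.RAssign by blast
  ultimately show ?case using sets.top[of state_space] by simp
next
  case (Draw a i j)
  then show ?case by simp
next
  case (Seq c1 c2)
  then have [measurable]: "halts c1 \<in> sets state_space" "halts c2 \<in> sets state_space"
    "result c1 \<in> state_space \<rightarrow>\<^sub>M state_space" "result c2 \<in> state_space \<rightarrow>\<^sub>M state_space" by auto
  have "{s \<in> space state_space. s \<in> halts c1 \<and> result c1 s \<in> halts c2} \<in> sets state_space" by measurable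
  then have H[measurable]: "halts (Seq c1 c2) \<in> sets state_space" by (simp add: halts_Seq)
  have "(\<lambda>s. if s \<in> halts (Seq c1 c2) then result c2 (result c1 s) else s) \<in> state_space \<rightarrow>\<^sub>M state_space"
    by measurable
  then show ?case using H result_Seq[of c1 c2] by (simp add: fun_eq_iff[symmetric, of "result (Seq c1 c2)"])
next
  case (If b c1 c2)
  then have [measurable]: "halts c1 \<in> sets state_space" "halts c2 \<in> sets state_space"
    "result c1 \<in> state_space \<rightarrow>\<^sub>M state_space" "result c2 \<in> state_space \<rightarrow>\<^sub>M state_space" by auto
  have "{s \<in> space state_space. if bval b s then s \<in> halts c1 else s \<in> halts c2} \<in> sets state_space" by measurable
  moreover have "halts (If b c1 c2) = {s. if bval b s then s \<in> halts c1 else s \<in> halts c2}" using halts_If by blast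
  moreover have "(\<lambda>s. if bval b s then result c1 s else result c2 s) \<in> state_space \<rightarrow>\<^sub>M state_space" by measurable
  moreover have "result (If b c1 c2) = (\<lambda>s. if bval b s then result c1 s else result c2 s)" using result_If by blast
  ultimately show ?case by simp
next
  case (While b c)
  then have [measurable]: "halts c \<in> sets state_space" "result c \<in> state_space \<rightarrow>\<^sub>M state_space" by auto
  have pow[measurable]: "(result c ^^ i) \<in> state_space \<rightarrow>\<^sub>M state_space" for i
  proof (induction i)
    case (Suc i)
    then have "(\<lambda>s. result c ((result c ^^ i) s)) \<in> state_space \<rightarrow>\<^sub>M state_space" by measurable
    then show ?case by (simp add: comp_def)
  qed (simp add: id_def)
  have E[measurable]: "Measurable.pred state_space (exits_after b c j)" for j
    unfolding exits_after_def[abs_def] by measurable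
  have "{s \<in> space state_space. \<exists>j. exits_after b c j s} \<in> sets state_space" by measurable
  moreover have "halts (While b c) = {s. \<exists>j. exits_after b c j s}" using halts_While by blast
  moreover have "(\<lambda>s. (result c ^^ (LEAST j. exits_after b c j s)) s) \<in> state_space \<rightarrow>\<^sub>M state_space"
    by (rule measurable_compose_countable[where f = "\<lambda>j. result c ^^ j"]) measurable
  then have "(\<lambda>s. if \<exists>j. exits_after b c j s then (result c ^^ (LEAST j. exits_after b c j s)) s else s) \<in> state_space \<rightarrow>\<^sub>M state_space"
    by measurable
  moreover have "result (While b c) = (\<lambda>s. if \<exists>j. exits_after b c j s then (result c ^^ (LEAST j. exits_after b c j s)) s else s)"
    using result_While by blast
  ultimately show ?case by simp
qed

section \<open>The estimator succeeds with high probability\<close>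

lemma draw_free_MeanEstimator: "draw_free MeanEstimator"
  by (simp add: MeanEstimator_def SizesC_def BlocksC_def MedianC_def PruneC_def FilterC_def RoundC_def
      MeanC_def ScoreC_def MatvecC_def ThresholdC_def DownC_def For_def SumLoop_def)

definition estimate :: "nat \<Rightarrow> nat \<Rightarrow> real \<Rightarrow> (nat \<Rightarrow> nat \<Rightarrow> real) \<Rightarrow> nat \<Rightarrow> real" where
  "estimate n d \<delta> x j = cell (result MeanEstimator (init_state n d \<delta> x)) (2, 0, j)"

lemma estimate_measurable:
  assumes x: "\<And>i j. i < n \<Longrightarrow> j < d \<Longrightarrow> (\<lambda>\<omega>. x \<omega> i j) \<in> borel_measurable M"
  shows "(\<lambda>\<omega>. estimate n d \<delta> (x \<omega>) j) \<in> borel_measurable M"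
proof -
  have "(\<lambda>\<omega>. init_state n d \<delta> (x \<omega>)) \<in> M \<rightarrow>\<^sub>M state_space"
  proof (rule measurable_state)
    fix p :: "nat \<times> nat \<times> nat"
    obtain a i l where p: "p = (a, i, l)" by (cases p)
    show "(\<lambda>\<omega>. cell (init_state n d \<delta> (x \<omega>)) p) \<in> borel_measurable M"
      using x by (cases "a = 0 \<and> i < n \<and> l < d") (auto simp: init_state_def p)
  qed (simp add: init_state_def)
  from measurable_compose[OF measurable_compose[OF this conjunct2[OF measurable_result[OF draw_free_MeanEstimator]]] measurable_cell]
  show ?thesis unfolding estimate_def .
qed

text \<open>
  From \<open>1/3601 \<le> ln (3601/3600) \<le> 1/3600\<close>.
\<close>

lemma bucket_count_bounds:
  fixes n :: nat
  assumes \<delta>: "0 < \<delta>" "\<delta> < 1" and k: "k = nat \<lceil>3600 * ln (1 / \<delta>)\<rceil>" "real k \<le> real n / 2"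
  defines "k' \<equiv> bucket_count \<delta>"
  shows "0 < k" "k \<le> k'" "k' \<le> 2 * k" "k' \<le> n" "ln (1 / \<delta>) \<le> real k' / 3600" "real k' \<le> 1 + 3601 * ln (1 / \<delta>)"
proof -
  define L where "L = ln (1 / \<delta>)"
  have L: "0 < L" using \<delta> by (simp add: L_def)
  have kL: "3600 * L \<le> real k" "real k < 3600 * L + 1"
    using L unfolding k(1) L_def[symmetric] by (simp_all add: of_nat_nat) linarith+
  show k0: "0 < k" using kL(1) L by (cases k) auto
  note bc = bucket_count_props[OF \<delta>(1), folded k'_def]
  have r: "ratio > 1" by (simp add: ratio_def)
  have ln_le: "ln ratio \<le> 1 / 3600"
    using ln_add_one_self_le_self[of "1 / 3600"] by (simp add: ratio_def)
  have ln_ge: "1 / 3601 \<le> ln ratio"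
    using ln_add_one_self_le_self2[of "- 1 / 3601"] by (simp add: ratio_def ln_div)
  have "1 / \<delta> \<le> ratio ^ k'" using bc(1) \<delta>(1) by (simp add: field_simps)
  then have "L \<le> ln (ratio ^ k')" unfolding L_def using \<delta> r by (subst ln_le_cancel_iff) auto
  also have "\<dots> = real k' * ln ratio" using r by (simp add: ln_realpow)
  also have "\<dots> \<le> real k' * (1 / 3600)" using ln_le by (intro mult_left_mono) auto
  finally have k'L: "3600 * L \<le> real k'" by simp
  then show "ln (1 / \<delta>) \<le> real k' / 3600" by (simp add: L_def)
  have "real k < real k' + 1" using k'L kL(2) by simp
  then show "k \<le> k'" by simp
  have k'0: "0 < k'" using \<open>k \<le> k'\<close> k0 by simp
  have "ratio ^ (k' - 1) < 1 / \<delta>" using bc(2)[of "k' - 1"] k'0 \<delta>(1) by (simp add: field_simps)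
  then have "ln (ratio ^ (k' - 1)) < L" unfolding L_def using \<delta> r by (subst ln_less_cancel_iff) auto
  then have "real (k' - 1) * ln ratio < L" using r by (simp add: ln_realpow)
  moreover have "real (k' - 1) * (1 / 3601) \<le> real (k' - 1) * ln ratio" using ln_ge by (intro mult_left_mono) auto
  ultimately have up: "real k' < 1 + 3601 * L" using k'0 by (simp add: of_nat_diff)
  then show "real k' \<le> 1 + 3601 * ln (1 / \<delta>)" by (simp add: L_def)
  show k'2: "k' \<le> 2 * k"
  proof (cases "k = 1")
    case True
    then have "real k' < 3" using up kL(1) by simp
    then show ?thesis using True by simp
  next
    case False
    then have "real k \<ge> 2" using k0 by simp
    then have "real k' < 2 * real k + 1" using up kL(1) by linarith
    then show ?thesis by linarith
  qed
  have "2 * real k \<le> real n" using k(2) by simp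
  then show "k' \<le> n" using k'2 by linarith
qed

text \<open>
  The summand \<open>+1\<close> and the factor 3 use \<open>ln (k + d + 1) \<ge> ln 3 \<ge> 1\<close>.
\<close>

lemma log4_bound:
  assumes "1 \<le> d" "1 \<le> k"
  shows "real (log4 d + 1) \<le> 3 * ln (real k + real d + 1)"
proof -
  define m where "m = log4 d"
  have l3: "1 \<le> ln (3 :: real)" using exp_le by (subst ln_ge_iff) auto
  have l4: "1 \<le> ln (4 :: real)" using l3 ln_mono[of 3 4] by linarith
  have big: "ln 3 \<le> ln (real k + real d + 1)" using assms by (subst ln_le_cancel_iff) auto
  have "real m \<le> 1 + ln (real k + real d + 1)"
  proof (cases "m = 0")
    case False
    then have "4 ^ (m - 1) < d" using log4_props(2)[of "m - 1" d] unfolding m_def by simp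
    then have "real (4 ^ (m - 1)) \<le> real k + real d + 1" by linarith
    then have "ln (4 ^ (m - 1)) \<le> ln (real k + real d + 1)" by (subst ln_le_cancel_iff) auto
    then have "real (m - 1) * ln 4 \<le> ln (real k + real d + 1)" by (simp add: ln_realpow)
    moreover have "real (m - 1) * 1 \<le> real (m - 1) * ln 4" using l4 by (intro mult_left_mono) auto
    ultimately show ?thesis using False by (simp add: of_nat_diff)
  qed (use big l3 in auto)
  moreover have "1 \<le> ln (real k + real d + 1)" using l3 big by (rule order_trans)
  ultimately show ?thesis unfolding m_def by simp
qed

lemma array_block_mean_eq: "array_block_mean w x b j = block_mean w x b j"
proof -
  have "(\<Sum>i\<in>{0 + b * w..<w + b * w}. x i j) = (\<Sum>l\<in>{0..<w}. x (l + b * w) j)"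
    by (rule sum.shift_bounds_nat_ivl)
  then show ?thesis by (simp add: array_block_mean_def block_mean_def block_def atLeast0LessThan add.commute)
qed

lemma runs_MeanEstimator:
  assumes "0 < d" "0 < \<delta>" "0 < bucket_count \<delta>" "bucket_count \<delta> \<le> n"
  defines "k \<equiv> bucket_count \<delta>"
  obtains t where "runs MeanEstimator n d \<delta> x u t (estimate n d \<delta> x)"
    "t \<le> 2000 * (n * d) + 60000 * (k * k * d) * (log4 d + 1) ^ 3"
proof -
  obtain t s' where e: "exec (\<lambda>_. 0) MeanEstimator (init_state n d \<delta> x) t s'"
    and t: "t \<le> 2000 * (n * d) + 60000 * (k * k * d) * (log4 d + 1) ^ 3"
    using exec_MeanEstimator[OF assms(1,2) refl assms(3,4), of "\<lambda>_. 0" x] unfolding k_def by blast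
  have "estimate n d \<delta> x = (\<lambda>j. cell s' (2, 0, j))"
    unfolding estimate_def result_eq[OF e] ..
  with exec_draw_free[OF e draw_free_MeanEstimator] have "runs MeanEstimator n d \<delta> x u t (estimate n d \<delta> x)"
    unfolding runs_def by blast
  with t show ?thesis using that by blast
qed

lemma estimate_error:
  assumes d: "0 < d" and \<delta>: "0 < \<delta>" and k: "bucket_count \<delta> = k" "0 < k" "k \<le> n"
    and disp: "dispersed d k (array_block_mean (n div k) x) \<mu> r" and r: "0 \<le> r"
  shows "vnorm d (\<lambda>i. \<mu> i - estimate n d \<delta> x i) \<le> 10 * r"
proof -
  let ?z = "array_block_mean (n div k) x"
  let ?U = "\<lambda>c. (filter_step d k (log4 d) ?z ^^ (4 * (log4 d + 1)\<^sup>2)) (prune k (sqdist d ?z c))"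
  obtain t s' c where e: "exec (\<lambda>_. 0) MeanEstimator (init_state n d \<delta> x) t s'"
    and c: "coord_median d k ?z c" and out: "\<forall>j<d. cell s' (2, 0, j) = wmean k ?z (?U c) j"
    using exec_MeanEstimator[OF d \<delta> k, of "\<lambda>_. 0" x] by blast
  have "vnorm d (\<lambda>i. \<mu> i - estimate n d \<delta> x i) = vnorm d (\<lambda>i. \<mu> i - wmean k ?z (?U c) i)"
    unfolding vnorm_def L2_set_def using out result_eq[OF e] by (simp add: estimate_def)
  also have "\<dots> \<le> 10 * r" by (rule filter_correct[OF disp r k(2) log4_props(1) c])
  finally show ?thesis .
qed

lemma prob_space_random_stream: "prob_space random_stream"
  unfolding random_stream_def by (intro prob_space_PiM prob_space_uniform_measure) auto

text \<open>
  With \<open>k' \<le> 1 + 3601 log (1/\<delta>)\<close> blocks of length at least \<open>n / (2 k')\<close>, the squared radius is at most a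
  constant times \<open>(\<rho> k' + Tr \<Sigma>) / n\<close>. In \<open>\<rho> k'\<close> the summand 1 is charged to the trace and the rest to the
  spectral norm.
\<close>

theorem estimate_whp:
  fixes D :: "(nat \<Rightarrow> real) measure" and n d :: nat
  assumes d: "1 \<le> d" and \<delta>: "0 < \<delta>" "\<delta> < 1" and k: "k = nat \<lceil>3600 * ln (1 / \<delta>)\<rceil>" "real k \<le> real n / 2"
    and D: "prob_space D" "sets D = sets (Rd d)" "finite_mean_cov d D"
    and B: "B \<subseteq> {..<n}" "real (card B) \<le> real k / 200"
  defines "C \<equiv> sqrt (400 * 3601 * (500000 * exp 20))"
  defines "bound \<equiv> C * (sqrt (trace_mat d (cov_mat D) / real n) + sqrt (spectral_norm d (cov_mat D) * ln (1 / \<delta>) / real n))"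
  shows "\<exists>Z\<in>sets (\<Pi>\<^sub>M i\<in>{..<n} - B. D). measure (\<Pi>\<^sub>M i\<in>{..<n} - B. D) Z \<ge> 1 - \<delta> \<and>
    (\<forall>X\<in>Z. vnorm d (\<lambda>i. mean_vec D i - estimate n d \<delta> (contaminate B b X) i) \<le> bound)"
proof -
  define k' where "k' = bucket_count \<delta>"
  note bb = bucket_count_bounds[OF \<delta> k, folded k'_def]
  define w where "w = n div k'"
  have k': "0 < k'" "k' \<le> n" using bb by auto
  have w: "0 < w" "k' * w \<le> n" using k' by (auto simp: w_def div_greater_zero_iff)
  define L where "L = ln (1 / \<delta>)"
  define Tr sn where "Tr = trace_mat d (cov_mat D)" and "sn = spectral_norm d (cov_mat D)"
  define K where "K = (500000 * exp 20 :: real)"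
  define \<rho> where "\<rho> = cov_bound d D"
  define q where "q = K * (\<rho> + Tr / real k') / real w"
  have Tr: "0 \<le> Tr" unfolding Tr_def by (rule trace_cov_nonneg[OF D])
  have sn: "0 \<le> sn" unfolding sn_def by (rule spectral_norm_nonneg)
  have \<rho>: "0 \<le> \<rho>" "\<rho> \<le> sn" "\<rho> \<le> Tr" using Tr sn by (simp_all add: \<rho>_def cov_bound_def Tr_def sn_def)
  have K: "0 < K" by (simp add: K_def)
  have L: "0 < L" using \<delta> by (simp add: L_def)
  have q: "0 \<le> q" unfolding q_def using K \<rho> Tr by simp
  have finB: "finite B" using B(1) finite_subset by blast
  have cB: "real (card B) \<le> real k' / 200" using B(2) bb(2) by simp
  obtain Z where Z: "Z \<in> sets (\<Pi>\<^sub>M i\<in>{..<n} - B. D)" "measure (\<Pi>\<^sub>M i\<in>{..<n} - B. D) Z \<ge> 1 - \<delta>"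
    and disp: "\<And>X z. X \<in> Z \<Longrightarrow> (\<forall>b<k'. block w b \<inter> B = {} \<longrightarrow> (\<forall>j<d. z b j = block_mean w X b j)) \<Longrightarrow>
      dispersed d k' z (mean_vec D) (sqrt 2 * sqrt q)"
    using dispersed_whp[OF D _ w(1) k'(1) w(2) finB cB refl \<delta> bb(5), of "sqrt q"] q
    by (auto simp: q_def K_def \<rho>_def Tr_def)
  have n: "real n \<le> 2 * real k' * real w"
  proof -
    have "n < k' * (w + 1)" unfolding w_def using k'(1) by (simp add: dividend_less_times_div)
    also have "\<dots> \<le> k' * (2 * w)" using w(1) by (intro mult_le_mono2) simp
    finally have "n \<le> 2 * k' * w" by simp
    then show ?thesis by (metis of_nat_le_iff of_nat_mult of_nat_numeral)
  qed
  have npos: "0 < real n" using k' by simp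
  have "200 * q \<le> C\<^sup>2 * (Tr / real n + sn * L / real n)"
  proof -
    have "\<rho> * real k' \<le> \<rho> * (1 + 3601 * L)" using bb(6) \<rho> unfolding L_def by (intro mult_left_mono) auto
    also have "\<dots> \<le> Tr + 3601 * (sn * L)"
    proof -
      have "\<rho> * L \<le> sn * L" using \<rho>(2) L by (intro mult_right_mono) auto
      moreover have "\<rho> * (1 + 3601 * L) = \<rho> + 3601 * (\<rho> * L)" by (simp add: algebra_simps)
      ultimately show ?thesis using \<rho>(3) by linarith
    qed
    finally have \<rho>k: "\<rho> * real k' + Tr \<le> 2 * Tr + 3601 * (sn * L)" by simp
    have "1 / (real k' * real w) \<le> 2 / real n"
      using n npos k' w by (simp add: field_simps)
    then have "(\<rho> * real k' + Tr) * (1 / (real k' * real w)) \<le> (\<rho> * real k' + Tr) * (2 / real n)"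
      using \<rho> Tr by (intro mult_left_mono) auto
    also have "\<dots> \<le> (2 * Tr + 3601 * (sn * L)) * (2 / real n)" using \<rho>k npos by (intro mult_right_mono) auto
    also have "\<dots> \<le> (3601 * Tr + 3601 * (sn * L)) * (2 / real n)"
      using Tr npos by (intro mult_right_mono) auto
    finally have "200 * K * ((\<rho> * real k' + Tr) * (1 / (real k' * real w))) \<le> 200 * K * ((3601 * Tr + 3601 * (sn * L)) * (2 / real n))"
      using K by (intro mult_left_mono) auto
    also have "\<dots> = C\<^sup>2 * (Tr / real n + sn * L / real n)"
      using K unfolding C_def K_def[symmetric] by (simp add: algebra_simps add_divide_distrib)
    also have "200 * K * ((\<rho> * real k' + Tr) * (1 / (real k' * real w))) = 200 * q"
    proof -
      have "\<rho> + Tr / real k' = (\<rho> * real k' + Tr) / real k'" using k' by (simp add: add_divide_distrib)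
      then show ?thesis unfolding q_def by simp
    qed
    finally show ?thesis .
  qed
  have "sqrt (200 * q) = sqrt (10\<^sup>2 * (2 * q))" by simp
  then have "10 * (sqrt 2 * sqrt q) = sqrt (200 * q)" by (simp only: real_sqrt_mult) simp
  also have "\<dots> \<le> sqrt (C\<^sup>2 * (Tr / real n + sn * L / real n))" using \<open>200 * q \<le> _\<close> by (rule real_sqrt_le_mono)
  also have "\<dots> = C * sqrt (Tr / real n + sn * L / real n)" by (simp add: real_sqrt_mult C_def)
  also have "\<dots> \<le> C * (sqrt (Tr / real n) + sqrt (sn * L / real n))"
    using Tr sn L by (intro mult_left_mono sqrt_add_le_add_sqrt) (auto simp: C_def)
  finally have rb: "10 * (sqrt 2 * sqrt q) \<le> bound" by (simp add: bound_def Tr_def sn_def L_def)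
  have "vnorm d (\<lambda>i. mean_vec D i - estimate n d \<delta> (contaminate B b X) i) \<le> bound" if X: "X \<in> Z" for X
  proof -
    let ?x = "contaminate B b X"
    have "array_block_mean w ?x c j = block_mean w X c j" if "block w c \<inter> B = {}" for c j
      using that unfolding array_block_mean_eq block_mean_def
      by (intro arg_cong[where f = "\<lambda>s. s / _"] sum.cong refl) (auto simp: contaminate_def)
    then have "dispersed d k' (array_block_mean w ?x) (mean_vec D) (sqrt 2 * sqrt q)"
      by (intro disp[OF X]) auto
    then have "vnorm d (\<lambda>i. mean_vec D i - estimate n d \<delta> ?x i) \<le> 10 * (sqrt 2 * sqrt q)"
      using d k' \<delta> q unfolding w_def by (intro estimate_error[OF _ _ k'_def[symmetric]]) auto
    then show ?thesis using rb by simp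
  qed
  with Z show ?thesis by blast
qed

theorem theorem1p1:
  shows "\<exists>A>0. \<exists>C>0. \<exists>K>0. \<exists>p::nat. \<exists>P::com.
    \<forall>(n::nat) (d::nat) (\<delta>::real) (k::nat).
      n \<ge> 1 \<longrightarrow> d \<ge> 1 \<longrightarrow> 0 < \<delta> \<longrightarrow> \<delta> < 1 \<longrightarrow> \<delta> \<ge> A * exp (- real n) \<longrightarrow>
      k = nat \<lceil>3600 * ln (1 / \<delta>)\<rceil> \<longrightarrow> real k \<le> real n / 2 \<longrightarrow>
      (\<forall>D B b.
         prob_space D \<longrightarrow> sets D = sets (Rd d) \<longrightarrow> finite_mean_cov d D \<longrightarrow>
         B \<subseteq> {..<n} \<longrightarrow> real (card B) \<le> real k / 200 \<longrightarrow>
         (\<forall>j\<in>B. b j \<in> (\<Pi>\<^sub>M i\<in>{..<n} - B. D) \<rightarrow>\<^sub>M Rd d) \<longrightarrow>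
         measure ((\<Pi>\<^sub>M i\<in>{..<n} - B. D) \<Otimes>\<^sub>M random_stream)
           {(X, u) \<in> space ((\<Pi>\<^sub>M i\<in>{..<n} - B. D) \<Otimes>\<^sub>M random_stream).
             \<exists>t y. runs P n d \<delta> (contaminate B b X) u t y \<and>
               vnorm d (\<lambda>i. mean_vec D i - y i)
                 \<le> C * (sqrt (trace_mat d (cov_mat D) / real n)
                        + sqrt (spectral_norm d (cov_mat D) * ln (1 / \<delta>) / real n))}
           \<ge> 1 - \<delta>) \<and>
      (\<forall>x u. (\<forall>i. u i \<in> {0..1}) \<longrightarrow>
         (\<exists>t y. runs P n d \<delta> x u t y \<and>
            real t \<le> K * (real n * real d
                          + real k ^ 2 * real d * ln (real k + real d + 1) ^ p)))"
proof -
  define C where "C = sqrt (400 * 3601 * (500000 * exp 20 :: real))"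
  define K where "K = (60000 * 4 * 27 :: real)"
  show ?thesis
  proof (rule exI[of _ 1], intro conjI, simp, rule exI[of _ C], intro conjI, simp add: C_def,
      rule exI[of _ K], intro conjI, simp add: K_def, rule exI[of _ 3], rule exI[of _ MeanEstimator],
      intro allI impI conjI)
    fix n d k :: nat and \<delta> :: real and D :: "(nat \<Rightarrow> real) measure" and B and b
    assume d: "d \<ge> 1" and \<delta>: "0 < \<delta>" "\<delta> < 1" and k: "k = nat \<lceil>3600 * ln (1 / \<delta>)\<rceil>" "real k \<le> real n / 2"
      and D: "prob_space D" "sets D = sets (Rd d)" "finite_mean_cov d D"
      and B: "B \<subseteq> {..<n}" "real (card B) \<le> real k / 200"
      and b: "\<forall>j\<in>B. b j \<in> (\<Pi>\<^sub>M i\<in>{..<n} - B. D) \<rightarrow>\<^sub>M Rd d"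
    let ?M = "\<Pi>\<^sub>M i\<in>{..<n} - B. D"
    let ?bound = "C * (sqrt (trace_mat d (cov_mat D) / real n) + sqrt (spectral_norm d (cov_mat D) * ln (1 / \<delta>) / real n))"
    interpret M: prob_space ?M by (intro prob_space_PiM D)
    interpret R: prob_space random_stream by (rule prob_space_random_stream)
    note bb = bucket_count_bounds[OF \<delta> k]
    let ?e = "\<lambda>X. vnorm d (\<lambda>i. mean_vec D i - estimate n d \<delta> (contaminate B b X) i)"
    define G where "G = {X \<in> space ?M. ?e X \<le> ?bound}"
    have coord: "(\<lambda>X. contaminate B b X i j) \<in> borel_measurable ?M" if "i < n" "j < d" for i j
    proof (cases "i \<in> B")
      case True
      have "(\<lambda>x. x j) \<in> borel_measurable (Rd d)"
        using that(2) measurable_component_singleton[of j "{..<d}" "\<lambda>_. borel"] by (simp add: Rd_def)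
      from measurable_compose[OF bspec[OF b True] this] show ?thesis using True by (simp add: contaminate_def)
    next
      case False
      from measurable_compose[OF measurable_component_singleton[of i "{..<n} - B" "\<lambda>_. D"] D_component[OF D that(2)]]
      show ?thesis using False that(1) by (simp add: contaminate_def)
    qed
    have em: "(\<lambda>X. estimate n d \<delta> (contaminate B b X) i) \<in> borel_measurable ?M" for i
      by (rule estimate_measurable[OF coord])
    have "?e \<in> borel_measurable ?M"
      unfolding vnorm_def L2_set_def using em by measurable
    then have Gm: "G \<in> sets ?M" unfolding G_def by measurable
    have iff: "(\<exists>t y. runs MeanEstimator n d \<delta> (contaminate B b X) u t y \<and> vnorm d (\<lambda>i. mean_vec D i - y i) \<le> ?bound)
        \<longleftrightarrow> ?e X \<le> ?bound" for X u
    proof -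
      obtain t where t: "runs MeanEstimator n d \<delta> (contaminate B b X) u t (estimate n d \<delta> (contaminate B b X))"
        using runs_MeanEstimator[of d \<delta> n "contaminate B b X" u] d \<delta> bb by auto
      have "y = estimate n d \<delta> (contaminate B b X)" if "runs MeanEstimator n d \<delta> (contaminate B b X) u t' y" for t' y
      proof -
        from t obtain s1 where "exec u MeanEstimator (init_state n d \<delta> (contaminate B b X)) t s1"
          "estimate n d \<delta> (contaminate B b X) = (\<lambda>j. cell s1 (2, 0, j))" unfolding runs_def by blast
        moreover from that obtain s2 where "exec u MeanEstimator (init_state n d \<delta> (contaminate B b X)) t' s2"
          "y = (\<lambda>j. cell s2 (2, 0, j))" unfolding runs_def by blast
        ultimately show ?thesis using exec_deterministic by metis
      qed
      with t show ?thesis by blast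
    qed
    \<comment> \<open>The output is a function of the sample alone, so the event is a rectangle.\<close>
    have set: "{(X, u) \<in> space (?M \<Otimes>\<^sub>M random_stream).
          \<exists>t y. runs MeanEstimator n d \<delta> (contaminate B b X) u t y \<and> vnorm d (\<lambda>i. mean_vec D i - y i) \<le> ?bound}
        = G \<times> space random_stream"
      unfolding iff by (auto simp: G_def space_pair_measure)
    obtain Z where Z: "Z \<in> sets ?M" "measure ?M Z \<ge> 1 - \<delta>" "\<forall>X\<in>Z. ?e X \<le> ?bound"
      using estimate_whp[OF d \<delta> k D B, of b, folded C_def] by blast
    have "Z \<subseteq> G" using Z sets.sets_into_space[OF Z(1)] unfolding G_def by auto
    then have "measure ?M Z \<le> measure ?M G" using Gm by (rule M.finite_measure_mono)
    with Z(2) have "1 - \<delta> \<le> measure ?M G" by (rule order_trans)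
    also have "\<dots> = measure (?M \<Otimes>\<^sub>M random_stream) (G \<times> space random_stream)"
      using R.emeasure_pair_measure_Times[OF Gm sets.top] by (simp add: R.emeasure_space_1 measure_def)
    finally show "1 - \<delta> \<le> measure (?M \<Otimes>\<^sub>M random_stream)
       {(X, u) \<in> space (?M \<Otimes>\<^sub>M random_stream).
          \<exists>t y. runs MeanEstimator n d \<delta> (contaminate B b X) u t y \<and> vnorm d (\<lambda>i. mean_vec D i - y i) \<le> ?bound}"
      unfolding set .
  next
    fix n d k :: nat and \<delta> :: real and x :: "nat \<Rightarrow> nat \<Rightarrow> real" and u :: "nat \<Rightarrow> real"
    assume d: "d \<ge> 1" and \<delta>: "0 < \<delta>" "\<delta> < 1" and k: "k = nat \<lceil>3600 * ln (1 / \<delta>)\<rceil>" "real k \<le> real n / 2"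
    note bb = bucket_count_bounds[OF \<delta> k]
    define k' where "k' = bucket_count \<delta>"
    define l where "l = ln (real k + real d + 1)"
    obtain t where t: "runs MeanEstimator n d \<delta> x u t (estimate n d \<delta> x)"
      "t \<le> 2000 * (n * d) + 60000 * (k' * k' * d) * (log4 d + 1) ^ 3"
      using runs_MeanEstimator[of d \<delta> n x u] d \<delta> bb unfolding k'_def by auto
    have lm: "real (log4 d + 1) ^ 3 \<le> (3 * l) ^ 3"
      unfolding l_def using log4_bound[of d k] d bb(1) by (intro power_mono) auto
    have l0: "0 \<le> l" unfolding l_def by simp
    have kk: "k' * k' \<le> (2 * k) * (2 * k)" using bb(3) unfolding k'_def by (intro mult_le_mono)
    have "real t \<le> real (2000 * (n * d) + 60000 * (k' * k' * d) * (log4 d + 1) ^ 3)"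
      using t(2) by (simp only: of_nat_le_iff)
    also have "\<dots> \<le> real (2000 * (n * d) + 60000 * ((2 * k) * (2 * k) * d) * (log4 d + 1) ^ 3)"
      by (simp only: of_nat_le_iff) (intro add_left_mono mult_le_mono1 mult_le_mono2 kk)
    also have "\<dots> = 2000 * (real n * real d) + 60000 * 4 * (real k ^ 2 * real d) * real (log4 d + 1) ^ 3"
      by (simp add: power2_eq_square)
    also have "\<dots> \<le> K * (real n * real d) + 60000 * 4 * (real k ^ 2 * real d) * (3 * l) ^ 3"
      using lm by (intro add_mono mult_right_mono mult_left_mono) (auto simp: K_def)
    also have "\<dots> = K * (real n * real d + real k ^ 2 * real d * l ^ 3)"
      by (simp add: K_def power_mult_distrib algebra_simps)
    finally show "\<exists>t y. runs MeanEstimator n d \<delta> x u t y \<and>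
        real t \<le> K * (real n * real d + real k ^ 2 * real d * ln (real k + real d + 1) ^ 3)"
      using t(1) unfolding l_def by blast
  qed
qed

end
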